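(* For every chain $\mathbf{J}$ and $n\in\mathbb{Z}^+$, $\mathbf{F}_n(\mathbf{J}\overrightarrow{\times}\mathbb{Z})\cong \mathbf{Aut}(\mathbf{J})\wr\mathbf{F}_n(\mathbb{Z})$. Consequently, every $n$-periodic $\ell$-pregroup can be embedded in the wreath product of an $\ell$-group and the simple $n$-periodic $\ell$-pregroup $\mathbf{F}_n(\mathbb{Z})$.
   Context: An $\ell$-pregroup is an algebra $(A,\wedge,\vee,\cdot,{}^{\ell},{}^{r},1)$ with lattice reduct, monoid reduct, order-preserving multiplication, and $x^{\ell}x\le 1\le xx^{\ell}$, $xx^{r}\le 1\le x^{r}x$; it is $n$-periodic if it satisfies $x^{\ell^n}=x^{r^n}$; an $\ell$-group is one with $x^\ell=x^r$. For a chain $\Omega$, $\mathbf{F}(\Omega)$ is the $\ell$-pregroup of maps on $\Omega$ with residuals ($f^r(b)=\max\{a:f(a)\le b\}$) and dual residuals ($f^\ell(a)=\min\{b:a\le f(b)\}$) of all orders, under composition, identity, pointwise order, ${}^\ell,{}^r$; $\mathbf{F}_n(\Omega)$ is its subalgebra of $f$ with $f^{\ell^n}=f^{r^n}$. $\mathbf{J}\overrightarrow{\times}\mathbb{Z}$ is the lexicographic product. $\mathbf{Aut}(\mathbf{J})$ is the $\ell$-group of order-automorphisms of $\mathbf{J}$ under composition and pointwise order. For an $\ell$-group $\mathbf{H}$ acting on a chain $\mathbf{J}$ by a left action $*$ monotone in both coordinates, and an $\ell$-pregroup $\mathbf{F}$, the wreath product $\mathbf{H}\wr_{\mathbf{J},*}\mathbf{F}$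 has universe $H\times F^J$ with $(h_1,n_1)(h_2,n_2)=(h_1h_2,(n_1\otimes h_2)\odot n_2)$, where $(n\otimes h)(j)=n(h*j)$ and $(n_1\odot n_2)(j)=n_1(j)n_2(j)$; $(h,n)^\ell=(h^{-1},n^\ell\otimes h^{-1})$, $(h,n)^r=(h^{-1},n^r\otimes h^{-1})$ with ${}^\ell,{}^r$ on $F^J$ computed coordinatewise; $(h_1,n_1)\le(h_2,n_2)$ iff $h_1\le h_2$ and $h_1*j=h_2*j\Rightarrow n_1(j)\le n_2(j)$ for all $j$ (this is a lattice order). $\mathbf{Aut}(\mathbf{J})\wr\mathbf{F}$ denotes this construction with $h*j=h(j)$. *)

theory Defs
  imports "HOL-Algebra.Group_Action" "HOL-Algebra.Galois_Connection"
begin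

section \<open>Lattice-ordered pregroups\<close>

text \<open>
  The lattice reduct is given by its order; meet and join are those of HOL-Algebra, taken in
  \<open>lat A\<close>. The fields \<open>lad\<close> and \<open>rad\<close> are the unary operations written as superscripts l and r.
\<close>

record 'a lpg = "'a monoid" +
  leq :: "'a \<Rightarrow> 'a \<Rightarrow> bool"
  lad :: "'a \<Rightarrow> 'a"
  rad :: "'a \<Rightarrow> 'a"

definition lat :: "('a, 'm) lpg_scheme \<Rightarrow> 'a gorder" where
  "lat A = \<lparr>carrier = carrier A, eq = (=), le = leq A\<rparr>"

locale lpregroup = monoid A for A (structure) +
  assumes lattice_reduct: "lattice (lat A)"
    and lad_closed: "x \<in> carrier A \<Longrightarrow> lad A x \<in> carrier A"
    and rad_closed: "x \<in> carrier A \<Longrightarrow> rad A x \<in> carrier A"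
    and mult_mono: "\<lbrakk>x \<in> carrier A; x' \<in> carrier A; y \<in> carrier A; y' \<in> carrier A;
        leq A x x'; leq A y y'\<rbrakk> \<Longrightarrow> leq A (x \<otimes> y) (x' \<otimes> y')"
    and lad_mult: "x \<in> carrier A \<Longrightarrow> leq A (lad A x \<otimes> x) \<one>"
    and mult_lad: "x \<in> carrier A \<Longrightarrow> leq A \<one> (x \<otimes> lad A x)"
    and mult_rad: "x \<in> carrier A \<Longrightarrow> leq A (x \<otimes> rad A x) \<one>"
    and rad_mult: "x \<in> carrier A \<Longrightarrow> leq A \<one> (rad A x \<otimes> x)"

definition periodic_elem :: "nat \<Rightarrow> ('a, 'm) lpg_scheme \<Rightarrow> 'a \<Rightarrow> bool" where
  "periodic_elem n A x \<longleftrightarrow> (lad A ^^ n) x = (rad A ^^ n) x"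

definition periodic_lpregroup :: "nat \<Rightarrow> ('a, 'm) lpg_scheme \<Rightarrow> bool" where
  "periodic_lpregroup n A \<longleftrightarrow> lpregroup A \<and> (\<forall>x\<in>carrier A. periodic_elem n A x)"

definition lgroup :: "('a, 'm) lpg_scheme \<Rightarrow> bool" where
  "lgroup A \<longleftrightarrow> lpregroup A \<and> (\<forall>x\<in>carrier A. lad A x = rad A x)"

definition lpg_hom :: "('a, 'm) lpg_scheme \<Rightarrow> ('b, 'k) lpg_scheme \<Rightarrow> ('a \<Rightarrow> 'b) set" where
  "lpg_hom A B = {f \<in> hom A B.
     f \<one>\<^bsub>A\<^esub> = \<one>\<^bsub>B\<^esub> \<and> meet_pres (lat A) (lat B) f \<and> join_pres (lat A) (lat B) f \<and>
     (\<forall>x\<in>carrier A. f (lad A x) = lad B (f x)) \<and>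
     (\<forall>x\<in>carrier A. f (rad A x) = rad B (f x))}"

definition lpg_isomorphic :: "('a, 'm) lpg_scheme \<Rightarrow> ('b, 'k) lpg_scheme \<Rightarrow> bool" where
  "lpg_isomorphic A B \<longleftrightarrow> lpregroup A \<and> lpregroup B \<and>
     (\<exists>f\<in>lpg_hom A B. bij_betw f (carrier A) (carrier B))"

definition lpg_embeds :: "('a, 'm) lpg_scheme \<Rightarrow> ('b, 'k) lpg_scheme \<Rightarrow> bool" where
  "lpg_embeds A B \<longleftrightarrow> lpregroup A \<and> lpregroup B \<and>
     (\<exists>f\<in>lpg_hom A B. inj_on f (carrier A))"

definition lpg_congruence :: "('a, 'm) lpg_scheme \<Rightarrow> ('a \<times> 'a) set \<Rightarrow> bool" where
  "lpg_congruence A \<theta> \<longleftrightarrow> equiv (carrier A) \<theta> \<and>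
     (\<forall>(x, x')\<in>\<theta>. (lad A x, lad A x') \<in> \<theta> \<and> (rad A x, rad A x') \<in> \<theta> \<and>
       (\<forall>(y, y')\<in>\<theta>. (x \<otimes>\<^bsub>A\<^esub> y, x' \<otimes>\<^bsub>A\<^esub> y') \<in> \<theta> \<and>
          (x \<sqinter>\<^bsub>lat A\<^esub> y, x' \<sqinter>\<^bsub>lat A\<^esub> y') \<in> \<theta> \<and>
          (x \<squnion>\<^bsub>lat A\<^esub> y, x' \<squnion>\<^bsub>lat A\<^esub> y') \<in> \<theta>))"

definition lpg_simple :: "('a, 'm) lpg_scheme \<Rightarrow> bool" where
  "lpg_simple A \<longleftrightarrow> Id_on (carrier A) \<noteq> carrier A \<times> carrier A \<and>
     {\<theta>. lpg_congruence A \<theta>} = {Id_on (carrier A), carrier A \<times> carrier A}"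

section \<open>Functional pregroups on a chain\<close>

text \<open>
  Chains are structures satisfying \<^locale>\<open>total_order\<close>; maps on them are extensional functions.
  A map has a residual iff it is a \<^const>\<open>lower_adjoint\<close>, and a dual residual iff it is an
  \<^const>\<open>upper_adjoint\<close>.
\<close>

definition residual :: "'a gorder \<Rightarrow> ('a \<Rightarrow> 'a) \<Rightarrow> 'a \<Rightarrow> 'a" where
  "residual \<Omega> f = (\<lambda>b\<in>carrier \<Omega>. THE m. greatest \<Omega> m {a \<in> carrier \<Omega>. f a \<sqsubseteq>\<^bsub>\<Omega>\<^esub> b})"

definition dual_residual :: "'a gorder \<Rightarrow> ('a \<Rightarrow> 'a) \<Rightarrow> 'a \<Rightarrow> 'a" where
  "dual_residual \<Omega> f = (\<lambda>a\<in>carrier \<Omega>. THE m. least \<Omega> m {b \<in> carrier \<Omega>. a \<sqsubseteq>\<^bsub>\<Omega>\<^esub> f b})"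

definition F_lpg :: "'a gorder \<Rightarrow> ('a \<Rightarrow> 'a) lpg" where
  "F_lpg \<Omega> = \<lparr>carrier = {f \<in> carrier \<Omega> \<rightarrow>\<^sub>E carrier \<Omega>.
              \<forall>k. lower_adjoint \<Omega> \<Omega> ((residual \<Omega> ^^ k) f) \<and>
                  upper_adjoint \<Omega> \<Omega> ((dual_residual \<Omega> ^^ k) f)},
           mult = compose (carrier \<Omega>),
           one = (\<lambda>x\<in>carrier \<Omega>. x),
           leq = (\<lambda>f g. \<forall>x\<in>carrier \<Omega>. f x \<sqsubseteq>\<^bsub>\<Omega>\<^esub> g x),
           lad = dual_residual \<Omega>,
           rad = residual \<Omega>\<rparr>"

definition Fn_lpg :: "nat \<Rightarrow> 'a gorder \<Rightarrow> ('a \<Rightarrow> 'a) lpg" where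
  "Fn_lpg n \<Omega> = (F_lpg \<Omega>)\<lparr>carrier := {f \<in> carrier (F_lpg \<Omega>). periodic_elem n (F_lpg \<Omega>) f}\<rparr>"

definition Z_chain :: "int gorder" where
  "Z_chain = \<lparr>carrier = UNIV, eq = (=), le = (\<le>)\<rparr>"

definition lex_product :: "'a gorder \<Rightarrow> 'b gorder \<Rightarrow> ('a \<times> 'b) gorder" where
  "lex_product J K =
     \<lparr>carrier = carrier J \<times> carrier K,
      eq = (=),
      le = (\<lambda>(i, x) (j, y). (i \<noteq> j \<and> i \<sqsubseteq>\<^bsub>J\<^esub> j) \<or> (i = j \<and> x \<sqsubseteq>\<^bsub>K\<^esub> y))\<rparr>"

definition Aut :: "'a gorder \<Rightarrow> ('a \<Rightarrow> 'a) lpg" where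
  "Aut J = \<lparr>carrier = {f \<in> Bij (carrier J).
              \<forall>x\<in>carrier J. \<forall>y\<in>carrier J. f x \<sqsubseteq>\<^bsub>J\<^esub> f y \<longleftrightarrow> x \<sqsubseteq>\<^bsub>J\<^esub> y},
            mult = compose (carrier J),
            one = (\<lambda>x\<in>carrier J. x),
            leq = (\<lambda>f g. \<forall>x\<in>carrier J. f x \<sqsubseteq>\<^bsub>J\<^esub> g x),
            lad = (\<lambda>f. \<lambda>x\<in>carrier J. inv_into (carrier J) f x),
            rad = (\<lambda>f. \<lambda>x\<in>carrier J. inv_into (carrier J) f x)\<rparr>"

section \<open>Wreath products\<close>

text \<open>\<open>act h j\<close> is the result of \<open>h\<close> acting on \<open>j\<close>.\<close>

definition monotone_action :: "('h, 'm) lpg_scheme \<Rightarrow> 'j gorder \<Rightarrow> ('h \<Rightarrow> 'j \<Rightarrow> 'j) \<Rightarrow> bool" where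
  "monotone_action H J act \<longleftrightarrow> group_action H (carrier J) act \<and>
     (\<forall>h\<in>carrier H. \<forall>h'\<in>carrier H. \<forall>j\<in>carrier J. \<forall>j'\<in>carrier J.
        leq H h h' \<and> j \<sqsubseteq>\<^bsub>J\<^esub> j' \<longrightarrow> act h j \<sqsubseteq>\<^bsub>J\<^esub> act h' j')"

definition wreath ::
  "('h, 'm) lpg_scheme \<Rightarrow> 'j gorder \<Rightarrow> ('h \<Rightarrow> 'j \<Rightarrow> 'j) \<Rightarrow> ('f, 'k) lpg_scheme \<Rightarrow>
   ('h \<times> ('j \<Rightarrow> 'f)) lpg" where
  "wreath H J act N =
     \<lparr>carrier = carrier H \<times> (carrier J \<rightarrow>\<^sub>E carrier N),
      mult = (\<lambda>(h1, n1) (h2, n2).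
        (h1 \<otimes>\<^bsub>H\<^esub> h2, \<lambda>j\<in>carrier J. n1 (act h2 j) \<otimes>\<^bsub>N\<^esub> n2 j)),
      one = (\<one>\<^bsub>H\<^esub>, \<lambda>j\<in>carrier J. \<one>\<^bsub>N\<^esub>),
      leq = (\<lambda>(h1, n1) (h2, n2). leq H h1 h2 \<and>
        (\<forall>j\<in>carrier J. act h1 j = act h2 j \<longrightarrow> leq N (n1 j) (n2 j))),
      lad = (\<lambda>(h, n). (inv\<^bsub>H\<^esub> h, \<lambda>j\<in>carrier J. lad N (n (act (inv\<^bsub>H\<^esub> h) j)))),
      rad = (\<lambda>(h, n). (inv\<^bsub>H\<^esub> h, \<lambda>j\<in>carrier J. rad N (n (act (inv\<^bsub>H\<^esub> h) j))))\<rparr>"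

definition Aut_wreath :: "'j gorder \<Rightarrow> ('f, 'k) lpg_scheme \<Rightarrow> (('j \<Rightarrow> 'j) \<times> ('j \<Rightarrow> 'f)) lpg" where
  "Aut_wreath J N = wreath (Aut J) J (\<lambda>h j. h j) N"

text \<open>
  Existential quantification over types is not available, so an existentially quantified chain
  for an algebra on \<open>'a\<close> lives in the type \<open>'a list set set\<close>. This is always infinite and contains
  copies of \<open>'a\<close>, of its power set, of finite and countable products of these, and of the set of
  subsets of such products. Groups acting on that chain live on the self-maps of its type.
\<close>

type_synonym 'a witness = "'a list set set"

end

theory Submission
  imports Defs "HOL-Library.Nat_Bijection"
begin

text \<open>
  Write \<open>\<sigma>\<close> for the shift \<open>(j, k) \<mapsto> (j, k + 1)\<close>. On any chain where every element \<open>x\<close> has a cover \<open>\<sigma> x\<close>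
  and \<open>\<sigma>\<close> is bijective, the second dual residual of \<open>f\<close> is \<open>\<sigma> f \<sigma>\<^sup>-\<^sup>1\<close>, so \<open>n\<close>-periodicity of \<open>f\<close> means
  that \<open>f\<close> commutes with \<open>\<sigma>\<^sup>n\<close>. Hence an \<open>n\<close>-periodic map on \<open>J \<times> \<int>\<close> sends fibres over \<open>J\<close> into fibres,
  each by an \<open>n\<close>-periodic map of \<open>\<int>\<close>, and comparison with its residual shows that the induced map on
  \<open>J\<close> is an automorphism. This is the isomorphism with the wreath product.

  For the embedding, distributivity comes first: if \<open>a \<and> 1 \<le> b \<le> 1 \<le> a \<or> b\<close>, then the same holds with
  \<open>a\<close> replaced by its left adjoint, hence by all iterated ones, and since the join of the even iterates
  is invertible by periodicity this forces \<open>b = 1\<close>; general distributivity reduces to this case.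
  So prime ideals \<open>I\<close> separate points. The sets \<open>{u. u x \<in> I}\<close> form a chain, because
  \<open>v x \<and> u y \<le> (u \<or> v) (x \<and> y) \<le> u x \<or> v y\<close>, and the algebra acts faithfully on the sum of these chains.
  A point that is hit twice by some element lies in a copy of \<open>\<int>\<close> formed by successive covers.
  The union of these copies is invariant, and all elements are injective on its complement, so
  replacing every point of the complement by a copy of \<open>\<int>\<close> extends the action to a chain \<open>J \<times> \<int>\<close>.
\<close>

section \<open>Periodic l-pregroups are distributive\<close>

text \<open>Distributivity can be tested at the unit because \<open>c \<preceq> b\<close> means
  \<open>\<one> \<preceq> rad A c \<otimes> b\<close>. A single adjoint reverses the order, so only
  even iterates can be joined into an element fixed by the double adjoint. Periodicity makes the
  orbit finite, and a fixed element has equal adjoints, so it can be cancelled. The isomorphism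
  needs a cover for every point, which the chain of translates need not offer. Inserting a copy of
  \<int> at a point, with elements acting identically on it, preserves the order only if no element
  identifies that point with another one. This is why collapsed points have to be found inside
  copies of \<int> already. The two kinds of points do not mix, because membership in such a copy is
  reflected by every element and not only preserved; reflection relies on periodicity. That the
  wreath product is an l-pregroup is not checked from its definition: its operations are matched
  with those of maps on J \<times> \<int>, and the laws are carried over.\<close>

sublocale lpregroup \<subseteq> L: lattice "lat A"
  rewrites "carrier (lat A) = carrier A" and "le (lat A) = leq A" and "eq (lat A) = (=)"
  by (rule lattice_reduct) (simp_all add: lat_def)

section \<open>Order, residuation and adjoints in an l-pregroup\<close>

context lpregroup
begin

abbreviation leq_A (infix \<open>\<preceq>\<close> 50) where "x \<preceq> y \<equiv> leq A x y"
abbreviation join_A (infixl \<open>\<^bold>\<squnion>\<close> 65) where "x \<^bold>\<squnion> y \<equiv> x \<squnion>\<^bsub>lat A\<^esub> y"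
abbreviation meet_A (infixl \<open>\<^bold>\<sqinter>\<close> 70) where "x \<^bold>\<sqinter> y \<equiv> x \<sqinter>\<^bsub>lat A\<^esub> y"

declare lad_closed [simp] rad_closed [simp]

lemma le_trans: "x \<preceq> y \<Longrightarrow> y \<preceq> z \<Longrightarrow> x \<in> carrier A \<Longrightarrow> y \<in> carrier A \<Longrightarrow> z \<in> carrier A \<Longrightarrow> x \<preceq> z"
  by (rule L.le_trans)

lemma le_antisym: "x \<preceq> y \<Longrightarrow> y \<preceq> x \<Longrightarrow> x \<in> carrier A \<Longrightarrow> y \<in> carrier A \<Longrightarrow> x = y"
  using L.weak_le_antisym by simp

lemma mult_mono_right:
  "\<lbrakk>y \<preceq> y'; x \<in> carrier A; y \<in> carrier A; y' \<in> carrier A\<rbrakk> \<Longrightarrow> x \<otimes> y \<preceq> x \<otimes> y'"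
  by (simp add: mult_mono)

lemma mult_mono_left:
  "\<lbrakk>x \<preceq> x'; x \<in> carrier A; x' \<in> carrier A; y \<in> carrier A\<rbrakk> \<Longrightarrow> x \<otimes> y \<preceq> x' \<otimes> y"
  by (simp add: mult_mono)

lemma mult_le_right:
  "\<lbrakk>x \<preceq> \<one>; x \<in> carrier A; y \<in> carrier A\<rbrakk> \<Longrightarrow> x \<otimes> y \<preceq> y"
  using mult_mono_left[of x \<one> y] by simp

lemma mult_le_left:
  "\<lbrakk>y \<preceq> \<one>; x \<in> carrier A; y \<in> carrier A\<rbrakk> \<Longrightarrow> x \<otimes> y \<preceq> x"
  using mult_mono_right[of y \<one> x] by simp

lemma le_mult_right:
  "\<lbrakk>\<one> \<preceq> x; x \<in> carrier A; y \<in> carrier A\<rbrakk> \<Longrightarrow> y \<preceq> x \<otimes> y"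
  using mult_mono_left[of \<one> x y] by simp

lemma le_mult_left:
  "\<lbrakk>\<one> \<preceq> y; x \<in> carrier A; y \<in> carrier A\<rbrakk> \<Longrightarrow> x \<preceq> x \<otimes> y"
  using mult_mono_right[of \<one> y x] by simp

text \<open>The inequalities for \<open>rad A x\<close> are the unit and counit of an adjunction.
  Together with the three variants that follow, multiplication by a fixed element on either side is
  both a lower and an upper adjoint.\<close>

lemma mult_le_iff_rad:
  assumes "x \<in> carrier A" "y \<in> carrier A" "z \<in> carrier A"
  shows "x \<otimes> y \<preceq> z \<longleftrightarrow> y \<preceq> rad A x \<otimes> z"
proof
  assume "x \<otimes> y \<preceq> z"
  then have "rad A x \<otimes> (x \<otimes> y) \<preceq> rad A x \<otimes> z" using assms by (simp add: mult_mono_right)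
  moreover have "y \<preceq> rad A x \<otimes> (x \<otimes> y)"
    using assms le_mult_right[OF rad_mult[of x], of y] by (simp add: m_assoc)
  ultimately show "y \<preceq> rad A x \<otimes> z" using assms le_trans by (meson m_closed rad_closed)
next
  assume "y \<preceq> rad A x \<otimes> z"
  then have "x \<otimes> y \<preceq> x \<otimes> (rad A x \<otimes> z)" using assms by (simp add: mult_mono_right)
  moreover have "x \<otimes> (rad A x \<otimes> z) \<preceq> z"
    using assms mult_le_right[OF mult_rad[of x], of z] by (simp add: m_assoc)
  ultimately show "x \<otimes> y \<preceq> z" using assms le_trans by (meson m_closed rad_closed)
qed

lemma le_mult_iff_lad:
  assumes "x \<in> carrier A" "y \<in> carrier A" "z \<in> carrier A"
  shows "z \<preceq> x \<otimes> y \<longleftrightarrow> lad A x \<otimes> z \<preceq> y"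
proof
  assume "z \<preceq> x \<otimes> y"
  then have "lad A x \<otimes> z \<preceq> lad A x \<otimes> (x \<otimes> y)" using assms by (simp add: mult_mono_right)
  moreover have "lad A x \<otimes> (x \<otimes> y) \<preceq> y"
    using assms mult_le_right[OF lad_mult[of x], of y] by (simp add: m_assoc)
  ultimately show "lad A x \<otimes> z \<preceq> y" using assms le_trans by (meson m_closed lad_closed)
next
  assume "lad A x \<otimes> z \<preceq> y"
  then have "x \<otimes> (lad A x \<otimes> z) \<preceq> x \<otimes> y" using assms by (simp add: mult_mono_right)
  moreover have "z \<preceq> x \<otimes> (lad A x \<otimes> z)"
    using assms le_mult_right[OF mult_lad[of x], of z] by (simp add: m_assoc)
  ultimately show "z \<preceq> x \<otimes> y" using assms le_trans by (meson m_closed lad_closed)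
qed

lemma mult_le_iff_lad:
  assumes "x \<in> carrier A" "y \<in> carrier A" "z \<in> carrier A"
  shows "x \<otimes> y \<preceq> z \<longleftrightarrow> x \<preceq> z \<otimes> lad A y"
proof
  assume "x \<otimes> y \<preceq> z"
  then have "x \<otimes> y \<otimes> lad A y \<preceq> z \<otimes> lad A y" using assms by (simp add: mult_mono_left)
  moreover have "x \<preceq> x \<otimes> y \<otimes> lad A y"
    using assms le_mult_left[OF mult_lad[of y], of x] by (simp add: m_assoc)
  ultimately show "x \<preceq> z \<otimes> lad A y" using assms le_trans by (meson m_closed lad_closed)
next
  assume "x \<preceq> z \<otimes> lad A y"
  then have "x \<otimes> y \<preceq> z \<otimes> lad A y \<otimes> y" using assms by (simp add: mult_mono_left)
  moreover have "z \<otimes> lad A y \<otimes> y \<preceq> z"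
    using assms mult_le_left[OF lad_mult[of y], of z] by (simp add: m_assoc)
  ultimately show "x \<otimes> y \<preceq> z" using assms le_trans by (meson m_closed lad_closed)
qed

lemma le_mult_iff_rad:
  assumes "x \<in> carrier A" "y \<in> carrier A" "z \<in> carrier A"
  shows "z \<preceq> x \<otimes> y \<longleftrightarrow> z \<otimes> rad A y \<preceq> x"
proof
  assume "z \<preceq> x \<otimes> y"
  then have "z \<otimes> rad A y \<preceq> x \<otimes> y \<otimes> rad A y" using assms by (simp add: mult_mono_left)
  moreover have "x \<otimes> y \<otimes> rad A y \<preceq> x"
    using assms mult_le_left[OF mult_rad[of y], of x] by (simp add: m_assoc)
  ultimately show "z \<otimes> rad A y \<preceq> x" using assms le_trans by (meson m_closed rad_closed)
next
  assume "z \<otimes> rad A y \<preceq> x"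
  then have "z \<otimes> rad A y \<otimes> y \<preceq> x \<otimes> y" using assms by (simp add: mult_mono_left)
  moreover have "z \<preceq> z \<otimes> rad A y \<otimes> y"
    using assms le_mult_left[OF rad_mult[of y], of z] by (simp add: m_assoc)
  ultimately show "z \<preceq> x \<otimes> y" using assms le_trans by (meson m_closed rad_closed)
qed

text \<open>Upper adjoints preserve meets and lower adjoints preserve joins, so multiplication
  distributes over both. This rule and the next three are the halves that monotonicity does not
  give.\<close>

lemma le_meet_mult:
  assumes "z \<preceq> x \<otimes> p" "z \<preceq> y \<otimes> p" "x \<in> carrier A" "y \<in> carrier A" "p \<in> carrier A" "z \<in> carrier A"
  shows "z \<preceq> (x \<^bold>\<sqinter> y) \<otimes> p"
  using assms by (simp add: le_mult_iff_rad L.meet_le)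

lemma le_mult_meet:
  assumes "z \<preceq> p \<otimes> x" "z \<preceq> p \<otimes> y" "x \<in> carrier A" "y \<in> carrier A" "p \<in> carrier A" "z \<in> carrier A"
  shows "z \<preceq> p \<otimes> (x \<^bold>\<sqinter> y)"
  using assms by (simp add: le_mult_iff_lad L.meet_le)

lemma join_mult_le:
  assumes "x \<otimes> p \<preceq> z" "y \<otimes> p \<preceq> z" "x \<in> carrier A" "y \<in> carrier A" "p \<in> carrier A" "z \<in> carrier A"
  shows "(x \<^bold>\<squnion> y) \<otimes> p \<preceq> z"
  using assms by (simp add: mult_le_iff_lad L.join_le)

lemma mult_join_le:
  assumes "p \<otimes> x \<preceq> z" "p \<otimes> y \<preceq> z" "x \<in> carrier A" "y \<in> carrier A" "p \<in> carrier A" "z \<in> carrier A"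
  shows "p \<otimes> (x \<^bold>\<squnion> y) \<preceq> z"
  using assms by (simp add: mult_le_iff_rad L.join_le)

text \<open>An adjoint is determined by its two inequalities. Hence a map that respects order,
  product and unit respects the adjoints as well.\<close>

lemma lad_unique:
  assumes "x \<in> carrier A" "y \<in> carrier A" "y \<otimes> x \<preceq> \<one>" "\<one> \<preceq> x \<otimes> y"
  shows "lad A x = y"
proof (rule le_antisym)
  show "lad A x \<preceq> y" using le_mult_iff_lad[of x y \<one>] assms by simp
  show "y \<preceq> lad A x" using mult_le_iff_lad[of y x \<one>] assms by simp
qed (use assms in simp_all)

lemma rad_unique:
  assumes "x \<in> carrier A" "y \<in> carrier A" "x \<otimes> y \<preceq> \<one>" "\<one> \<preceq> y \<otimes> x"
  shows "rad A x = y"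
proof (rule le_antisym)
  show "rad A x \<preceq> y" using le_mult_iff_rad[of y x \<one>] assms by simp
  show "y \<preceq> rad A x" using mult_le_iff_rad[of x y \<one>] assms by simp
qed (use assms in simp_all)

lemma lad_rad [simp]: "x \<in> carrier A \<Longrightarrow> lad A (rad A x) = x"
  by (simp add: lad_unique mult_rad rad_mult)

lemma rad_lad [simp]: "x \<in> carrier A \<Longrightarrow> rad A (lad A x) = x"
  by (simp add: rad_unique mult_lad lad_mult)

lemma lad_antimono:
  assumes "x \<preceq> y" "x \<in> carrier A" "y \<in> carrier A"
  shows "lad A y \<preceq> lad A x"
proof -
  have "\<one> \<preceq> x \<otimes> lad A x" using assms mult_lad by blast
  moreover have "x \<otimes> lad A x \<preceq> y \<otimes> lad A x" using assms by (simp add: mult_mono_left)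
  ultimately have "\<one> \<preceq> y \<otimes> lad A x" using assms le_trans by (meson m_closed lad_closed one_closed)
  then show ?thesis using assms le_mult_iff_lad[of y "lad A x" \<one>] by simp
qed

lemma lad_funpow_closed [simp]: "x \<in> carrier A \<Longrightarrow> (lad A ^^ k) x \<in> carrier A"
  by (induction k) auto

lemma rad_funpow_closed [simp]: "x \<in> carrier A \<Longrightarrow> (rad A ^^ k) x \<in> carrier A"
  by (induction k) auto

lemma lad_funpow_rad_funpow: "x \<in> carrier A \<Longrightarrow> (lad A ^^ k) ((rad A ^^ k) x) = x"
  by (induction k arbitrary: x) (simp_all add: funpow_swap1)

lemma rad_funpow_lad_funpow: "x \<in> carrier A \<Longrightarrow> (rad A ^^ k) ((lad A ^^ k) x) = x"
  by (induction k arbitrary: x) (simp_all add: funpow_swap1)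

text \<open>\<open>lad A\<close> and \<open>rad A\<close> are mutually inverse on the carrier, so
  periodicity says that the orbit of \<open>x\<close> under \<open>lad A\<close> closes up after
  \<open>2 * n\<close> steps.\<close>

lemma periodic_elem_iff:
  assumes "x \<in> carrier A"
  shows "periodic_elem n A x \<longleftrightarrow> (lad A ^^ (2 * n)) x = x"
proof -
  have "(lad A ^^ n) ((lad A ^^ n) x) = (lad A ^^ (2 * n)) x" by (simp add: mult_2 funpow_add)
  then show ?thesis unfolding periodic_elem_def
    using assms lad_funpow_rad_funpow[of x n] rad_funpow_lad_funpow[of "(lad A ^^ n) x" n] by fastforce
qed

text \<open>One half of the factorization y = (1 \<sqinter> y)(1 \<squnion> y) known from l-groups;
  the right factor distributes over the meet.\<close>

lemma le_meet_one_mult_join_one: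
  assumes "y \<in> carrier A"
  shows "y \<preceq> (\<one> \<^bold>\<sqinter> y) \<otimes> (\<one> \<^bold>\<squnion> y)"
proof (rule le_meet_mult)
  show "y \<preceq> \<one> \<otimes> (\<one> \<^bold>\<squnion> y)" using assms by (simp add: L.join_right)
  show "y \<preceq> y \<otimes> (\<one> \<^bold>\<squnion> y)" using assms by (simp add: le_mult_left L.join_left)
qed (use assms in simp_all)

lemma cross_mult_le:
  assumes "u \<in> carrier A" "v \<in> carrier A" "x \<in> carrier A" "y \<in> carrier A"
  shows "(v \<otimes> x) \<^bold>\<sqinter> (u \<otimes> y) \<preceq> (u \<otimes> x) \<^bold>\<squnion> (v \<otimes> y)"
proof -
  have "(v \<otimes> x) \<^bold>\<sqinter> (u \<otimes> y) \<preceq> (u \<^bold>\<squnion> v) \<otimes> (x \<^bold>\<sqinter> y)"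
  proof (rule le_mult_meet)
    have "v \<otimes> x \<preceq> (u \<^bold>\<squnion> v) \<otimes> x" using assms by (simp add: mult_mono_left L.join_right)
    then show "(v \<otimes> x) \<^bold>\<sqinter> (u \<otimes> y) \<preceq> (u \<^bold>\<squnion> v) \<otimes> x"
      by - (rule le_trans[OF L.meet_left], use assms in simp_all)
    have "u \<otimes> y \<preceq> (u \<^bold>\<squnion> v) \<otimes> y" using assms by (simp add: mult_mono_left L.join_left)
    then show "(v \<otimes> x) \<^bold>\<sqinter> (u \<otimes> y) \<preceq> (u \<^bold>\<squnion> v) \<otimes> y"
      by - (rule le_trans[OF L.meet_right], use assms in simp_all)
  qed (use assms in simp_all)
  moreover have "(u \<^bold>\<squnion> v) \<otimes> (x \<^bold>\<sqinter> y) \<preceq> (u \<otimes> x) \<^bold>\<squnion> (v \<otimes> y)"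
  proof (rule join_mult_le)
    have "u \<otimes> (x \<^bold>\<sqinter> y) \<preceq> u \<otimes> x" using assms by (simp add: mult_mono_right L.meet_left)
    then show "u \<otimes> (x \<^bold>\<sqinter> y) \<preceq> (u \<otimes> x) \<^bold>\<squnion> (v \<otimes> y)"
      by (rule le_trans) (use assms L.join_left in simp_all)
    have "v \<otimes> (x \<^bold>\<sqinter> y) \<preceq> v \<otimes> y" using assms by (simp add: mult_mono_right L.meet_right)
    then show "v \<otimes> (x \<^bold>\<sqinter> y) \<preceq> (u \<otimes> x) \<^bold>\<squnion> (v \<otimes> y)"
      by (rule le_trans) (use assms L.join_right in simp_all)
  qed (use assms in simp_all)
  ultimately show ?thesis by (rule le_trans) (use assms in simp_all)
qed

text \<open>In a distributive lattice, 1 = 1 \<sqinter> (a \<squnion> b) = (1 \<sqinter> a)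
  \<squnion> (1 \<sqinter> b) \<le> b, so \<open>b\<close> would be the unit. The predicate isolates
  a possible failure of distributivity at the unit.\<close>

definition complements_at_one :: "'a \<Rightarrow> 'a \<Rightarrow> bool" where
  "complements_at_one a b \<longleftrightarrow> a \<^bold>\<sqinter> \<one> \<preceq> b \<and> b \<preceq> \<one> \<and> \<one> \<preceq> a \<^bold>\<squnion> b"

text \<open>Both \<open>\<one>\<close> and \<open>a \<otimes> lad A a\<close> lie above the unit, so
  the inequality holds with a \<sqinter> 1 in place of \<open>b\<close>, and \<open>b\<close> is
  above that meet.\<close>

lemma one_le_mult_join_lad:
  assumes "complements_at_one a b" "a \<in> carrier A" "b \<in> carrier A"
  shows "\<one> \<preceq> b \<otimes> (\<one> \<^bold>\<squnion> lad A a)"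
proof -
  have "\<one> \<preceq> (a \<^bold>\<sqinter> \<one>) \<otimes> (\<one> \<^bold>\<squnion> lad A a)"
  proof (rule le_meet_mult)
    have "a \<otimes> lad A a \<preceq> a \<otimes> (\<one> \<^bold>\<squnion> lad A a)" using assms by (simp add: mult_mono_right L.join_right)
    then show "\<one> \<preceq> a \<otimes> (\<one> \<^bold>\<squnion> lad A a)" by - (rule le_trans[OF mult_lad[of a]], use assms in simp_all)
  qed (use assms L.join_left in simp_all)
  moreover have "(a \<^bold>\<sqinter> \<one>) \<otimes> (\<one> \<^bold>\<squnion> lad A a) \<preceq> b \<otimes> (\<one> \<^bold>\<squnion> lad A a)"
    using assms by (simp add: mult_mono_left complements_at_one_def)
  ultimately show ?thesis by (rule le_trans) (use assms in simp_all)
qed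

text \<open>For x = \<open>lad A a\<close> \<sqinter> 1 one has x a \<le> a \<sqinter> 1 \<le> b and
  x b \<le> b, hence x \<le> x (a \<squnion> b) \<le> b. The join part comes from 1 \<le> b (1
  \<squnion> \<open>lad A a\<close>) and b \<le> 1.\<close>

lemma complements_at_one_lad:
  assumes c: "complements_at_one a b" and [simp]: "a \<in> carrier A" "b \<in> carrier A"
  shows "complements_at_one (lad A a) b"
proof -
  define x where "x = lad A a \<^bold>\<sqinter> \<one>"
  have [simp]: "x \<in> carrier A" and x1: "x \<preceq> \<one>" and xa: "x \<preceq> lad A a"
    by (simp_all add: x_def L.meet_left L.meet_right)
  have "x \<otimes> a \<preceq> a \<^bold>\<sqinter> \<one>"
  proof (rule L.meet_le)
    show "x \<otimes> a \<preceq> a" by (simp add: x1 mult_le_right)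
    have "x \<otimes> a \<preceq> lad A a \<otimes> a" by (simp add: xa mult_mono_left)
    then show "x \<otimes> a \<preceq> \<one>" by (rule le_trans) (simp_all add: lad_mult)
  qed simp_all
  then have "x \<otimes> a \<preceq> b" by (rule le_trans) (use c in \<open>simp_all add: complements_at_one_def\<close>)
  then have "x \<otimes> (a \<^bold>\<squnion> b) \<preceq> b" by (rule mult_join_le) (simp_all add: x1 mult_le_right)
  moreover have "x \<preceq> x \<otimes> (a \<^bold>\<squnion> b)" using c by (simp add: complements_at_one_def le_mult_left)
  ultimately have "x \<preceq> b" using le_trans[of x "x \<otimes> (a \<^bold>\<squnion> b)" b] by simp
  moreover have "b \<otimes> (\<one> \<^bold>\<squnion> lad A a) \<preceq> lad A a \<^bold>\<squnion> b"
  proof (rule mult_join_le)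
    have "b \<otimes> lad A a \<preceq> lad A a" using c by (simp add: complements_at_one_def mult_le_right)
    then show "b \<otimes> lad A a \<preceq> lad A a \<^bold>\<squnion> b" by (rule le_trans) (simp_all add: L.join_left)
  qed (simp_all add: L.join_right)
  ultimately show ?thesis unfolding complements_at_one_def
    using c one_le_mult_join_lad[OF c] le_trans[of \<one> "b \<otimes> (\<one> \<^bold>\<squnion> lad A a)" "lad A a \<^bold>\<squnion> b"]
    by (simp add: x_def complements_at_one_def)
qed

lemma complements_at_one_lad_funpow:
  assumes "complements_at_one a b" "a \<in> carrier A" "b \<in> carrier A"
  shows "complements_at_one ((lad A ^^ k) a) b"
  using assms by (induction k) (simp_all add: complements_at_one_lad)

end

text \<open>The empty set and the whole carrier qualify; each contributes a single point, fixed by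
  every element, to the chain of translates.\<close>

definition (in lpregroup) prime_ideal :: "'a set \<Rightarrow> bool" where
  "prime_ideal I \<longleftrightarrow> I \<subseteq> carrier A \<and> (\<forall>x\<in>I. \<forall>y\<in>carrier A. y \<preceq> x \<longrightarrow> y \<in> I) \<and>
     (\<forall>x\<in>I. \<forall>y\<in>I. x \<^bold>\<squnion> y \<in> I) \<and>
     (\<forall>x\<in>carrier A. \<forall>y\<in>carrier A. x \<^bold>\<sqinter> y \<in> I \<longrightarrow> x \<in> I \<or> y \<in> I)"

section \<open>Consequences of periodicity: distributivity and prime ideals\<close>

locale n_periodic = lpregroup +
  fixes n :: nat
  assumes n_pos: "n \<ge> 1"
    and periodic: "x \<in> carrier A \<Longrightarrow> periodic_elem n A x"
begin

lemma lad_funpow_period: "x \<in> carrier A \<Longrightarrow> (lad A ^^ (2 * n)) x = x"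
  using periodic periodic_elem_iff by blast

text \<open>The double adjoint is monotone, so its iterates at \<open>x\<close> form an increasing
  sequence; after \<open>n\<close> steps it is back at \<open>x\<close>, hence constant.\<close>

lemma lad_lad_fixed:
  assumes x: "x \<in> carrier A" and le: "x \<preceq> lad A (lad A x)"
  shows "lad A (lad A x) = x"
proof (rule le_antisym)
  let ?f = "\<lambda>x. lad A (lad A x)"
  have mono: "?f y \<preceq> ?f z" if "y \<preceq> z" "y \<in> carrier A" "z \<in> carrier A" for y z
    using that by (simp add: lad_antimono)
  have funpow: "(lad A ^^ (2 * k)) y = (?f ^^ k) y" for k y by (induction k) simp_all
  have cl: "(?f ^^ k) x \<in> carrier A" for k using x by (induction k) simp_all
  have "?f x \<preceq> (?f ^^ Suc k) x" for k
  proof (induction k)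
    case (Suc k)
    have "(?f ^^ k) x \<preceq> (?f ^^ Suc k) x" for k
      using cl le x by (induction k) (simp_all add: mono)
    then have "(?f ^^ Suc k) x \<preceq> (?f ^^ Suc (Suc k)) x" .
    with Suc.IH show ?case by (rule le_trans) (use x cl in simp_all)
  qed (use x in simp)
  from this[of "n - 1"] show "?f x \<preceq> x"
    using n_pos lad_funpow_period[OF x] by (simp add: funpow flip: funpow.simps(2))
qed (use assms in simp_all)

text \<open>A fixed element of the double adjoint has \<open>lad A x = rad A x\<close>, and the two
  adjoints bound the product from opposite sides.\<close>

lemma mult_lad_of_fixed:
  assumes x: "x \<in> carrier A" and fixed: "lad A (lad A x) = x"
  shows "x \<otimes> lad A x = \<one>"
proof (rule le_antisym)
  have "lad A x = rad A x" using rad_lad[of "lad A x"] x fixed by simp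
  then show "x \<otimes> lad A x \<preceq> \<one>" using mult_rad x by metis
qed (use x mult_lad in simp_all)

text \<open>
  With \<open>g\<close> the join of the even iterates of \<open>a\<close>, the element \<open>t = 1 \<or> g\<close> is invertible and
  \<open>t \<le> b t\<close>.
\<close>

lemma one_le_of_complements_at_one:
  assumes c: "complements_at_one a b" and [simp]: "a \<in> carrier A" "b \<in> carrier A"
  shows "\<one> \<preceq> b"
proof -
  let ?S = "(\<lambda>k. (lad A ^^ (2 * k)) a) ` {..<n}"
  define g where "g = \<Squnion>\<^bsub>lat A\<^esub> ?S"
  have S: "?S \<subseteq> carrier A" "finite ?S" "?S \<noteq> {}" using n_pos by (auto simp: lessThan_empty_iff)
  have lub: "least (lat A) g (Upper (lat A) ?S)"
    unfolding g_def by (rule L.finite_sup_least) (use S in auto)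
  then have [simp]: "g \<in> carrier A" using least_closed[OF lub] by (simp add: lat_def)
  \<comment> \<open>The join is taken over \<open>k < n\<close> only; periodicity reduces all other
    exponents modulo \<open>2 * n\<close>.\<close>
  have le_g: "(lad A ^^ (2 * k)) a \<preceq> g" for k
  proof -
    have "(lad A ^^ (m * (2 * n))) a = a" for m
      by (induction m) (simp_all add: funpow_add lad_funpow_period)
    moreover have "2 * k = 2 * (k mod n) + k div n * (2 * n)"
      by (metis distrib_left mod_div_mult_eq mult.left_commute)
    ultimately have "(lad A ^^ (2 * k)) a = (lad A ^^ (2 * (k mod n))) a"
      by (simp only: funpow_add comp_apply)
    moreover have "k mod n < n" using n_pos by simp
    ultimately show ?thesis using least_Upper_above[OF lub, of "(lad A ^^ (2 * k)) a"] S
      by (auto simp: lat_def)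
  qed
  have g_le: "g \<preceq> y" if "y \<in> carrier A" "\<And>k. (lad A ^^ (2 * k)) a \<preceq> y" for y
    using least_le[OF lub, of y] that by (auto simp: Upper_def lat_def)
  define t where "t = \<one> \<^bold>\<squnion> g"
  have [simp]: "t \<in> carrier A" and t1: "\<one> \<preceq> t" and tg: "g \<preceq> t"
    by (simp_all add: t_def L.join_left L.join_right)
  have le_t: "\<one> \<^bold>\<squnion> (lad A ^^ (2 * k)) a \<preceq> t" for k
  proof (rule L.join_le)
    show "(lad A ^^ (2 * k)) a \<preceq> t" by (rule le_trans[OF le_g tg]) simp_all
  qed (simp_all add: t1)
  have "t \<preceq> b \<otimes> t"
  proof -
    \<comment> \<open>The earlier inequality is used for \<open>lad A a\<close> instead of
      \<open>a\<close>, so that the adjoint appearing in it is an even iterate and lies below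
      \<open>t\<close>.\<close>
    have "\<one> \<preceq> b \<otimes> (\<one> \<^bold>\<squnion> lad A (lad A a))"
      by (rule one_le_mult_join_lad) (use c in \<open>simp_all add: complements_at_one_lad\<close>)
    also have "b \<otimes> (\<one> \<^bold>\<squnion> lad A (lad A a)) \<preceq> b \<otimes> t"
      using le_t[of 1] by (simp add: mult_mono_right numeral_2_eq_2)
    finally have 1: "\<one> \<preceq> b \<otimes> t" by simp
    have "g \<preceq> b \<otimes> t"
    proof (rule g_le)
      fix k
      let ?a = "(lad A ^^ (2 * k)) a"
      \<comment> \<open>The iterate is split into its meet and its join with the unit; the meet lies
        below \<open>b\<close> and the join below \<open>t\<close>.\<close>
      have "?a \<preceq> (\<one> \<^bold>\<sqinter> ?a) \<otimes> (\<one> \<^bold>\<squnion> ?a)" by (rule le_meet_one_mult_join_one) simp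
      also have "\<dots> \<preceq> b \<otimes> t"
        using le_t[of k] complements_at_one_lad_funpow[OF c, of "2 * k"]
        by (intro mult_mono) (simp_all add: complements_at_one_def meet_comm)
      finally show "?a \<preceq> b \<otimes> t" by simp
    qed simp
    with 1 show "t \<preceq> b \<otimes> t" by (simp add: t_def L.join_le)
  qed
  moreover have "lad A (lad A t) = t"
  proof (rule lad_lad_fixed)
    have mono: "lad A (lad A y) \<preceq> lad A (lad A t)" if "y \<preceq> t" "y \<in> carrier A" for y
      using that by (simp add: lad_antimono)
    have "lad A \<one> = \<one>" by (rule lad_unique) simp_all
    then have "\<one> \<preceq> lad A (lad A t)" using mono[OF t1] by simp
    moreover have "g \<preceq> lad A (lad A t)"
    proof (rule g_le)
      fix k
      \<comment> \<open>Adding a full period first exhibits even the iterate with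
        \<open>k = 0\<close> as the double adjoint of a member of the orbit.\<close>
      have "(lad A ^^ (2 * k)) a = lad A (lad A ((lad A ^^ (2 * (k + n - 1))) a))"
      proof -
        have "(lad A ^^ (2 * k)) a = (lad A ^^ (2 * k + 2 * n)) a"
          by (simp only: funpow_add comp_apply lad_funpow_period \<open>a \<in> carrier A\<close>)
        also have "2 * k + 2 * n = Suc (Suc (2 * (k + n - 1)))" using n_pos by simp
        finally show ?thesis by simp
      qed
      moreover have "(lad A ^^ (2 * (k + n - 1))) a \<preceq> t" by (rule le_trans[OF le_g tg]) simp_all
      ultimately show "(lad A ^^ (2 * k)) a \<preceq> lad A (lad A t)" using mono by simp
    qed simp
    ultimately show "t \<preceq> lad A (lad A t)" by (simp add: t_def L.join_le)
  qed simp
  then have "t \<otimes> lad A t = \<one>" by (simp add: mult_lad_of_fixed)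
  \<comment> \<open>The invertible \<open>t\<close> is cancelled on the right of t \<le> b
    t.\<close>
  ultimately show ?thesis using mult_mono_left[of t "b \<otimes> t" "lad A t"] by (simp add: m_assoc)
qed

text \<open>This cut rule is an equivalent of distributivity. It moves to the unit by residuation:
  \<open>lad A a \<otimes> c\<close> and \<open>w\<close> satisfy \<open>complements_at_one\<close>,
  and the resulting 1 \<le> w \<le> \<open>rad A c \<otimes> b\<close> is the claim.\<close>

lemma distributive_cut:
  assumes ac: "a \<^bold>\<sqinter> c \<preceq> b" and cab: "c \<preceq> a \<^bold>\<squnion> b"
    and [simp]: "a \<in> carrier A" "b \<in> carrier A" "c \<in> carrier A"
  shows "c \<preceq> b"
proof -
  \<comment> \<open>\<open>w\<close> is the largest \<open>x \<le> \<one>\<close> with \<open>c x \<le> b\<close>\<close>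
  define w where "w = \<one> \<^bold>\<sqinter> (rad A c \<otimes> b)"
  have [simp]: "w \<in> carrier A" by (simp add: w_def)
  have le_w: "x \<preceq> w" if "x \<in> carrier A" "x \<preceq> \<one>" "c \<otimes> x \<preceq> b" for x
    using that by (simp add: w_def L.meet_le mult_le_iff_rad)
  have "complements_at_one (lad A a \<otimes> c) w" unfolding complements_at_one_def
  proof (intro conjI)
    \<comment> \<open>\<open>y\<close> is what \<open>x\<close> becomes when moved across
      \<open>c\<close>, in the sense that c x \<le> y c. On the left, \<open>y\<close> can be
      distributed over a \<squnion> b: y a \<le> a \<sqinter> c \<le> b and y b \<le> b.\<close>
    define x where "x = (lad A a \<otimes> c) \<^bold>\<sqinter> \<one>"
    define y where "y = \<one> \<^bold>\<sqinter> (c \<otimes> lad A a)"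
    have [simp]: "x \<in> carrier A" "y \<in> carrier A" by (simp_all add: x_def y_def)
    have x: "x \<preceq> \<one>" "x \<preceq> lad A a \<otimes> c" by (simp_all add: x_def L.meet_left L.meet_right)
    have y: "y \<preceq> \<one>" "y \<preceq> c \<otimes> lad A a" by (simp_all add: y_def L.meet_left L.meet_right)
    have "c \<otimes> x \<preceq> y \<otimes> c" unfolding y_def
    proof (rule le_meet_mult)
      show "c \<otimes> x \<preceq> \<one> \<otimes> c" by (simp add: x mult_le_left)
      show "c \<otimes> x \<preceq> c \<otimes> lad A a \<otimes> c" by (simp add: x mult_mono_right m_assoc)
    qed simp_all
    also have "y \<otimes> c \<preceq> y \<otimes> (a \<^bold>\<squnion> b)" by (simp add: cab mult_mono_right)
    also have "y \<otimes> (a \<^bold>\<squnion> b) \<preceq> b"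
    proof (rule mult_join_le)
      have "y \<otimes> a \<preceq> c \<otimes> (lad A a \<otimes> a)" using mult_mono_left[OF y(2), of a] by (simp add: m_assoc)
      also have "\<dots> \<preceq> c" by (simp add: lad_mult mult_le_left)
      finally have "y \<otimes> a \<preceq> a \<^bold>\<sqinter> c" by (simp add: L.meet_le y mult_le_right)
      then show "y \<otimes> a \<preceq> b" by (rule le_trans) (simp_all add: ac)
    qed (simp_all add: y mult_le_right)
    finally show "x \<preceq> w" using x by (simp add: le_w)
    show "w \<preceq> \<one>" by (simp add: w_def L.meet_left)
    \<comment> \<open>c s \<le> a \<sqinter> c \<le> b puts \<open>s\<close> below \<open>w\<close>,
      and \<open>s\<close> is large enough because 1 \<le> \<open>rad A c \<otimes> c\<close> and
      \<open>\<one> \<preceq> a \<otimes> lad A a\<close> can be inserted in between.\<close>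
    define s where "s = \<one> \<^bold>\<sqinter> (rad A c \<otimes> a)"
    have [simp]: "s \<in> carrier A" by (simp add: s_def)
    have s: "s \<preceq> \<one>" "s \<preceq> rad A c \<otimes> a" by (simp_all add: s_def L.meet_left L.meet_right)
    have "c \<otimes> s \<preceq> a \<^bold>\<sqinter> c" using s by (simp add: L.meet_le mult_le_left mult_le_iff_rad)
    then have "c \<otimes> s \<preceq> b" by (rule le_trans) (simp_all add: ac)
    then have sw: "s \<preceq> w" using s by (simp add: le_w)
    have "\<one> \<preceq> s \<otimes> (\<one> \<^bold>\<squnion> lad A a \<otimes> c)" unfolding s_def
    proof (rule le_meet_mult)
      have "rad A c \<otimes> c \<preceq> rad A c \<otimes> (a \<otimes> lad A a \<otimes> c)"
        by (simp add: mult_mono_right mult_lad le_mult_right)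
      also have "\<dots> = rad A c \<otimes> a \<otimes> (lad A a \<otimes> c)" by (simp add: m_assoc)
      also have "\<dots> \<preceq> rad A c \<otimes> a \<otimes> (\<one> \<^bold>\<squnion> lad A a \<otimes> c)" by (simp add: mult_mono_right L.join_right)
      finally show "\<one> \<preceq> rad A c \<otimes> a \<otimes> (\<one> \<^bold>\<squnion> lad A a \<otimes> c)"
        by (intro le_trans[OF rad_mult[of c]]) simp_all
    qed (simp_all add: L.join_left)
    also have "\<dots> \<preceq> w \<otimes> (\<one> \<^bold>\<squnion> lad A a \<otimes> c)" by (simp add: sw mult_mono_left)
    also have "\<dots> \<preceq> lad A a \<otimes> c \<^bold>\<squnion> w"
    proof (rule mult_join_le)
      have "w \<otimes> (lad A a \<otimes> c) \<preceq> lad A a \<otimes> c" by (simp add: \<open>w \<preceq> \<one>\<close> mult_le_right)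
      then show "w \<otimes> (lad A a \<otimes> c) \<preceq> lad A a \<otimes> c \<^bold>\<squnion> w"
        by (rule le_trans) (simp_all add: L.join_left)
    qed (simp_all add: L.join_right)
    finally show "\<one> \<preceq> lad A a \<otimes> c \<^bold>\<squnion> w" by simp
  qed
  then have "\<one> \<preceq> w" by (rule one_le_of_complements_at_one) simp_all
  also have "w \<preceq> rad A c \<otimes> b" by (simp add: w_def L.meet_right)
  finally show ?thesis using mult_le_iff_rad[of c \<one> b] by simp
qed

text \<open>An ideal that is maximal among those containing \<open>b\<close> and avoiding
  \<open>a\<close> is prime; distributivity enters as the cut rule.\<close>

lemma prime_ideal_separation:
  assumes ab: "\<not> a \<preceq> b" and [simp]: "a \<in> carrier A" "b \<in> carrier A"
  obtains I where "prime_ideal I" "b \<in> I" "a \<notin> I"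
proof -
  define ideal where "ideal I \<longleftrightarrow> I \<subseteq> carrier A \<and> (\<forall>x\<in>I. \<forall>y\<in>carrier A. y \<preceq> x \<longrightarrow> y \<in> I) \<and>
     (\<forall>x\<in>I. \<forall>y\<in>I. x \<^bold>\<squnion> y \<in> I)" for I
  define \<A> where "\<A> = {I. ideal I \<and> b \<in> I \<and> a \<notin> I}"
  have down: "y \<in> I" if "ideal I" "x \<in> I" "y \<in> carrier A" "y \<preceq> x" for I x y
    using that by (auto simp: ideal_def)
  have join: "x \<^bold>\<squnion> y \<in> I" if "ideal I" "x \<in> I" "y \<in> I" for I x y
    using that by (auto simp: ideal_def)
  have "{x \<in> carrier A. x \<preceq> b} \<in> \<A>"
    using ab by (auto simp: \<A>_def ideal_def L.join_le intro: le_trans)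
  then have "\<A> \<noteq> {}" by blast
  moreover have "\<Union>C \<in> \<A>" if C: "C \<noteq> {}" "subset.chain \<A> C" for C
  proof -
    have 1: "ideal I" "b \<in> I" "a \<notin> I" if "I \<in> C" for I
      using C that by (auto simp: subset_chain_def \<A>_def)
    have "x \<^bold>\<squnion> y \<in> \<Union>C" if xy: "x \<in> I" "I \<in> C" "y \<in> K" "K \<in> C" for x y I K
    proof -
      have "I \<subseteq> K \<or> K \<subseteq> I" using C xy by (auto simp: subset_chain_def)
      then show ?thesis using join 1 xy by blast
    qed
    moreover have "\<Union>C \<subseteq> carrier A" using 1(1) unfolding ideal_def by blast
    ultimately have "ideal (\<Union>C)" using down 1 unfolding ideal_def[of "\<Union>C"] by blast
    then show ?thesis using 1 C by (auto simp: \<A>_def)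
  qed
  ultimately obtain M where M: "M \<in> \<A>" and max: "\<And>X. X \<in> \<A> \<Longrightarrow> M \<subseteq> X \<Longrightarrow> X = M"
    using subset_Zorn_nonempty[of \<A>] by blast
  have iM: "ideal M" and bM: "b \<in> M" and aM: "a \<notin> M" using M by (auto simp: \<A>_def)
  have MA: "x \<in> carrier A" if "x \<in> M" for x using iM that by (auto simp: ideal_def)
  \<comment> \<open>By maximality, the ideal generated by \<open>M\<close> and an outside element
    must capture \<open>a\<close>.\<close>
  have ext: "\<exists>i\<in>M. a \<preceq> i \<^bold>\<squnion> x" if [simp]: "x \<in> carrier A" and "x \<notin> M" for x
  proof (rule ccontr)
    assume no: "\<not> (\<exists>i\<in>M. a \<preceq> i \<^bold>\<squnion> x)"
    let ?X = "{z \<in> carrier A. \<exists>i\<in>M. z \<preceq> i \<^bold>\<squnion> x}"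
    have "M \<subseteq> ?X" using MA L.join_left[of _ x] that(1) by blast
    moreover have "ideal ?X" unfolding ideal_def
    proof (intro conjI ballI impI)
      fix y z assume "y \<in> ?X" "z \<in> carrier A" "z \<preceq> y"
      then obtain i where "i \<in> M" "y \<preceq> i \<^bold>\<squnion> x" "y \<in> carrier A" by auto
      then have "z \<preceq> i \<^bold>\<squnion> x" using le_trans[of z y "i \<^bold>\<squnion> x"] \<open>z \<preceq> y\<close> \<open>z \<in> carrier A\<close> MA by simp
      then show "z \<in> ?X" using \<open>i \<in> M\<close> \<open>z \<in> carrier A\<close> by auto
    next
      fix y z assume "y \<in> ?X" "z \<in> ?X"
      then obtain i j where ij: "i \<in> M" "j \<in> M" "y \<preceq> i \<^bold>\<squnion> x" "z \<preceq> j \<^bold>\<squnion> x"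
        and [simp]: "y \<in> carrier A" "z \<in> carrier A" by auto
      have [simp]: "i \<in> carrier A" "j \<in> carrier A" using ij MA by auto
      have "i \<^bold>\<squnion> x \<preceq> (i \<^bold>\<squnion> j) \<^bold>\<squnion> x" "j \<^bold>\<squnion> x \<preceq> (i \<^bold>\<squnion> j) \<^bold>\<squnion> x"
        by (auto intro!: L.join_le L.join_right
            intro: le_trans[OF L.join_left L.join_left] le_trans[OF L.join_right L.join_left])
      then have "y \<^bold>\<squnion> z \<preceq> (i \<^bold>\<squnion> j) \<^bold>\<squnion> x"
        using ij le_trans[of y "i \<^bold>\<squnion> x" "(i \<^bold>\<squnion> j) \<^bold>\<squnion> x"] le_trans[of z "j \<^bold>\<squnion> x" "(i \<^bold>\<squnion> j) \<^bold>\<squnion> x"]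
        by (simp add: L.join_le)
      then show "y \<^bold>\<squnion> z \<in> ?X" using join[OF iM ij(1,2)] by auto
    qed auto
    ultimately have "?X = M" using max[of ?X] no bM by (auto simp: \<A>_def)
    moreover have "x \<in> ?X" using bM MA L.join_right[of b x] that(1) by blast
    ultimately show False using that by blast
  qed
  have "x \<in> M \<or> y \<in> M"
    if [simp]: "x \<in> carrier A" "y \<in> carrier A" and xyM: "x \<^bold>\<sqinter> y \<in> M" for x y
  proof (rule ccontr)
    assume "\<not> (x \<in> M \<or> y \<in> M)"
    then obtain i j where ij: "i \<in> M" "j \<in> M" "a \<preceq> i \<^bold>\<squnion> x" "a \<preceq> j \<^bold>\<squnion> y"
      using ext[of x] ext[of y] \<open>x \<in> carrier A\<close> \<open>y \<in> carrier A\<close> by blast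
    have [simp]: "i \<in> carrier A" "j \<in> carrier A" using ij MA by auto
    define d where "d = (i \<^bold>\<squnion> j) \<^bold>\<squnion> (x \<^bold>\<sqinter> y)"
    have dM: "d \<in> M" using ij xyM by (simp add: d_def join iM)
    have [simp]: "d \<in> carrier A" by (simp add: d_def)
    have id: "i \<preceq> d" "j \<preceq> d" "x \<^bold>\<sqinter> y \<preceq> d" unfolding d_def
      by (rule le_trans[OF L.join_left L.join_left] le_trans[OF L.join_right L.join_left] L.join_right, simp_all)+
    have 1: "a \<preceq> z \<^bold>\<squnion> d" if "a \<preceq> k \<^bold>\<squnion> z" "k \<preceq> d" "z \<in> carrier A" "k \<in> carrier A" for k z
    proof -
      have "k \<^bold>\<squnion> z \<preceq> z \<^bold>\<squnion> d"
        using that le_trans[of k d "z \<^bold>\<squnion> d"] by (simp add: L.join_le L.join_left L.join_right)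
      then show ?thesis using that le_trans[of a "k \<^bold>\<squnion> z"] by simp
    qed
    \<comment> \<open>Two cuts: here \<open>y\<close> is removed from a bound for x \<sqinter> a,
      and afterwards \<open>x\<close> is removed from a \<le> x \<squnion> d. The element
      \<open>d\<close> absorbs everything that lies in \<open>M\<close>.\<close>
    have "x \<^bold>\<sqinter> a \<preceq> d"
    proof (rule distributive_cut)
      have "y \<^bold>\<sqinter> (x \<^bold>\<sqinter> a) \<preceq> x \<^bold>\<sqinter> y"
        by (rule L.meet_le) (auto intro: L.meet_left le_trans[OF L.meet_right L.meet_left])
      then show "y \<^bold>\<sqinter> (x \<^bold>\<sqinter> a) \<preceq> d" by (rule le_trans) (simp_all add: id)
      show "x \<^bold>\<sqinter> a \<preceq> y \<^bold>\<squnion> d" by (rule le_trans[OF L.meet_right 1[of j y]]) (simp_all add: ij id)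
    qed simp_all
    then have "a \<preceq> d" using 1[of i x] ij id by (intro distributive_cut[of x a d]) simp_all
    then show False using down[OF iM dM] aM by simp
  qed
  then have "prime_ideal M" using iM by (auto simp: prime_ideal_def ideal_def)
  then show thesis using that bM aM by blast
qed

end

section \<open>The l-pregroup of periodic maps on a chain\<close>

lemma lat_sel: "carrier (lat A) = carrier A" "le (lat A) = leq A" "eq (lat A) = (=)"
  by (simp_all add: lat_def)

lemma F_lpg_sel [simp]:
  "mult (F_lpg \<Omega>) = compose (carrier \<Omega>)" "one (F_lpg \<Omega>) = (\<lambda>x\<in>carrier \<Omega>. x)"
  "leq (F_lpg \<Omega>) = (\<lambda>f g. \<forall>x\<in>carrier \<Omega>. f x \<sqsubseteq>\<^bsub>\<Omega>\<^esub> g x)"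
  "lad (F_lpg \<Omega>) = dual_residual \<Omega>" "rad (F_lpg \<Omega>) = residual \<Omega>"
  by (simp_all add: F_lpg_def)

lemma Fn_lpg_sel [simp]:
  "mult (Fn_lpg n \<Omega>) = compose (carrier \<Omega>)" "one (Fn_lpg n \<Omega>) = (\<lambda>x\<in>carrier \<Omega>. x)"
  "leq (Fn_lpg n \<Omega>) = (\<lambda>f g. \<forall>x\<in>carrier \<Omega>. f x \<sqsubseteq>\<^bsub>\<Omega>\<^esub> g x)"
  "lad (Fn_lpg n \<Omega>) = dual_residual \<Omega>" "rad (Fn_lpg n \<Omega>) = residual \<Omega>"
  by (simp_all add: Fn_lpg_def)

text \<open>Extensionality on both sides makes each map determine the other as a function, so that
  residuals can be identified by equations.\<close>

definition adjoint_pair :: "'a gorder \<Rightarrow> ('a \<Rightarrow> 'a) \<Rightarrow> ('a \<Rightarrow> 'a) \<Rightarrow> bool" where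
  "adjoint_pair \<Omega> f g \<longleftrightarrow> f \<in> carrier \<Omega> \<rightarrow>\<^sub>E carrier \<Omega> \<and> g \<in> carrier \<Omega> \<rightarrow>\<^sub>E carrier \<Omega> \<and>
     (\<forall>x\<in>carrier \<Omega>. \<forall>y\<in>carrier \<Omega>. f x \<sqsubseteq>\<^bsub>\<Omega>\<^esub> y \<longleftrightarrow> x \<sqsubseteq>\<^bsub>\<Omega>\<^esub> g y)"

text \<open>
  A map belongs to \<^const>\<open>F_lpg\<close> iff it is \<open>s 0\<close> for such a sequence: the residuals of higher order are
  the \<open>s i\<close> with \<open>i > 0\<close>, the dual ones those with \<open>i < 0\<close>.
\<close>

definition adjoint_seq :: "'a gorder \<Rightarrow> (int \<Rightarrow> 'a \<Rightarrow> 'a) \<Rightarrow> bool" where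
  "adjoint_seq \<Omega> s \<longleftrightarrow> (\<forall>i. adjoint_pair \<Omega> (s i) (s (i + 1)))"

lemma adjoint_pairD:
  assumes "adjoint_pair \<Omega> f g"
  shows "f \<in> carrier \<Omega> \<rightarrow>\<^sub>E carrier \<Omega>" "g \<in> carrier \<Omega> \<rightarrow>\<^sub>E carrier \<Omega>"
    "\<And>x. x \<in> carrier \<Omega> \<Longrightarrow> f x \<in> carrier \<Omega>" "\<And>x. x \<in> carrier \<Omega> \<Longrightarrow> g x \<in> carrier \<Omega>"
    "\<And>x y. x \<in> carrier \<Omega> \<Longrightarrow> y \<in> carrier \<Omega> \<Longrightarrow> f x \<sqsubseteq>\<^bsub>\<Omega>\<^esub> y \<longleftrightarrow> x \<sqsubseteq>\<^bsub>\<Omega>\<^esub> g y"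
  using assms by (auto simp: adjoint_pair_def)

locale chain = total_order L for L :: "'a gorder" (structure)
begin

lemma antisym: "\<lbrakk>x \<sqsubseteq> y; y \<sqsubseteq> x; x \<in> carrier L; y \<in> carrier L\<rbrakk> \<Longrightarrow> x = y"
  using weak_le_antisym eq_is_equal by auto

lemma not_le_imp_le: "\<lbrakk>\<not> x \<sqsubseteq> y; x \<in> carrier L; y \<in> carrier L\<rbrakk> \<Longrightarrow> y \<sqsubseteq> x"
  using total_order_total by blast

lemma adjoint_pair_galois:
  assumes "adjoint_pair L f g"
  shows "galois_connection \<lparr>orderA = L, orderB = L, lower = f, upper = g\<rparr>"
  using adjoint_pairD[OF assms]
  by (auto simp: galois_connection_def connection_def galois_connection_axioms_def partial_order_axioms)

lemma adjoint_pair_mono: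
  assumes "adjoint_pair L f g" "x \<sqsubseteq> y" "x \<in> carrier L" "y \<in> carrier L"
  shows "f x \<sqsubseteq> f y" "g x \<sqsubseteq> g y"
  using adjoint_pairD[OF assms(1)] assms(2-) le_refl le_trans by meson+

lemma adjoint_pair_counit_unit:
  assumes "adjoint_pair L f g" "x \<in> carrier L"
  shows "f (g x) \<sqsubseteq> x" "x \<sqsubseteq> g (f x)"
  using adjoint_pairD(3-5)[OF assms(1)] assms(2) le_refl by metis+

lemma residual_eq:
  assumes "adjoint_pair L f g"
  shows "residual L f = g"
proof
  note * = adjoint_pairD[OF assms]
  fix b
  show "residual L f b = g b"
  proof (cases "b \<in> carrier L")
    case True
    then have "greatest L (g b) {a \<in> carrier L. f a \<sqsubseteq> b}" using * by (auto simp: greatest_def)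
    then have "(THE m. greatest L m {a \<in> carrier L. f a \<sqsubseteq> b}) = g b"
      using greatest_unique by blast
    with True show ?thesis by (simp add: residual_def)
  qed (use * in \<open>auto simp: residual_def\<close>)
qed

lemma dual_residual_eq:
  assumes "adjoint_pair L f g"
  shows "dual_residual L g = f"
proof
  note * = adjoint_pairD[OF assms]
  fix a
  show "dual_residual L g a = f a"
  proof (cases "a \<in> carrier L")
    case True
    then have "least L (f a) {b \<in> carrier L. a \<sqsubseteq> g b}" using * *(5)[of a "f a"] by (auto simp: least_def)
    then have "(THE m. least L m {b \<in> carrier L. a \<sqsubseteq> g b}) = f a"
      using least_unique by blast
    with True show ?thesis by (simp add: dual_residual_def)
  qed (use * in \<open>auto simp: dual_residual_def\<close>)
qed

lemma lower_adjoint_residual: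
  assumes "f \<in> carrier L \<rightarrow>\<^sub>E carrier L" "lower_adjoint L L f"
  shows "adjoint_pair L f (residual L f)"
proof -
  from assms(2) obtain g where "galois_connection \<lparr>orderA = L, orderB = L, lower = f, upper = g\<rparr>"
    by (auto simp: lower_adjoint_def)
  then interpret galois_connection "\<lparr>orderA = L, orderB = L, lower = f, upper = g\<rparr>" .
  have "adjoint_pair L f (restrict g (carrier L))"
    using assms(1) upper_closed galois_property by (auto simp: adjoint_pair_def)
  with residual_eq[OF this] show ?thesis by simp
qed

lemma upper_adjoint_dual_residual:
  assumes "g \<in> carrier L \<rightarrow>\<^sub>E carrier L" "upper_adjoint L L g"
  shows "adjoint_pair L (dual_residual L g) g"
proof -
  from assms(2) obtain f where "galois_connection \<lparr>orderA = L, orderB = L, lower = f, upper = g\<rparr>"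
    by (auto simp: upper_adjoint_def)
  then interpret galois_connection "\<lparr>orderA = L, orderB = L, lower = f, upper = g\<rparr>" .
  have "adjoint_pair L (restrict f (carrier L)) g"
    using assms(1) lower_closed galois_property by (auto simp: adjoint_pair_def)
  with dual_residual_eq[OF this] show ?thesis by simp
qed

lemma adjoint_seq_residual_funpow:
  assumes "adjoint_seq L s"
  shows "(residual L ^^ k) (s i) = s (i + int k)"
proof (induction k)
  case (Suc k)
  have "adjoint_pair L (s (i + int k)) (s (i + int k + 1))"
    using assms by (simp only: adjoint_seq_def)
  with Suc show ?case by (simp add: residual_eq algebra_simps)
qed simp

lemma adjoint_seq_dual_residual_funpow:
  assumes "adjoint_seq L s"
  shows "(dual_residual L ^^ k) (s i) = s (i - int k)"
proof (induction k)
  case (Suc k)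
  have "adjoint_pair L (s (i - int (Suc k))) (s (i - int (Suc k) + 1))"
    using assms by (simp only: adjoint_seq_def)
  with Suc show ?case by (simp add: dual_residual_eq algebra_simps)
qed simp

lemma F_lpg_iff: "f \<in> carrier (F_lpg L) \<longleftrightarrow> (\<exists>s. adjoint_seq L s \<and> s 0 = f)"
proof
  assume "\<exists>s. adjoint_seq L s \<and> s 0 = f"
  then obtain s where s: "adjoint_seq L s" and f: "s 0 = f" by blast
  then have p: "adjoint_pair L (s i) (s (i + 1))" for i by (simp add: adjoint_seq_def)
  have "lower_adjoint L L (s i)" for i
    using adjoint_pair_galois[OF p[of i]] by (auto simp: lower_adjoint_def)
  moreover have "upper_adjoint L L (s i)" for i
    using adjoint_pair_galois[OF p[of "i - 1"]] by (auto simp: upper_adjoint_def)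
  ultimately show "f \<in> carrier (F_lpg L)" unfolding F_lpg_def
    using adjoint_seq_residual_funpow[OF s] adjoint_seq_dual_residual_funpow[OF s] f
      adjoint_pairD(1)[OF p[of 0]] by auto
next
  assume f: "f \<in> carrier (F_lpg L)"
  let ?s = "\<lambda>i::int. if i \<ge> 0 then (residual L ^^ nat i) f else (dual_residual L ^^ nat (- i)) f"
  have f': "f \<in> carrier L \<rightarrow>\<^sub>E carrier L" "lower_adjoint L L ((residual L ^^ k) f)"
    "upper_adjoint L L ((dual_residual L ^^ k) f)" for k
    using f by (auto simp: F_lpg_def)
  have up: "adjoint_pair L ((residual L ^^ k) f) ((residual L ^^ Suc k) f)" for k
  proof (induction k)
    case 0
    then show ?case using lower_adjoint_residual[OF f'(1) f'(2)[of 0, simplified]] by simp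
  next
    case (Suc k)
    then show ?case using lower_adjoint_residual[OF adjoint_pairD(2)[OF Suc] f'(2)] by simp
  qed
  have down: "adjoint_pair L ((dual_residual L ^^ Suc k) f) ((dual_residual L ^^ k) f)" for k
  proof (induction k)
    case 0
    then show ?case using upper_adjoint_dual_residual[OF f'(1) f'(3)[of 0, simplified]] by simp
  next
    case (Suc k)
    then show ?case using upper_adjoint_dual_residual[OF adjoint_pairD(1)[OF Suc] f'(3)] by simp
  qed
  have "adjoint_pair L (?s i) (?s (i + 1))" for i
  proof (cases "i \<ge> 0")
    case True
    then have "nat (i + 1) = Suc (nat i)" by simp
    with True show ?thesis using up[of "nat i"] by simp
  next
    case False
    then have "nat (- i) = Suc (nat (- (i + 1)))" by simp
    with False show ?thesis using down[of "nat (- (i + 1))"] by (cases "i = -1") auto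
  qed
  then have "adjoint_seq L ?s" by (simp add: adjoint_seq_def)
  then show "\<exists>s. adjoint_seq L s \<and> s 0 = f" by (intro exI[of _ ?s]) simp
qed

lemma Fn_lpg_iff:
  "f \<in> carrier (Fn_lpg n L) \<longleftrightarrow> (\<exists>s. adjoint_seq L s \<and> s 0 = f \<and> s (- int n) = s (int n))"
proof -
  have "periodic_elem n (F_lpg L) (s 0) \<longleftrightarrow> s (- int n) = s (int n)" if "adjoint_seq L s" for s
    using adjoint_seq_residual_funpow[OF that, of n 0] adjoint_seq_dual_residual_funpow[OF that, of n 0]
    by (simp add: periodic_elem_def)
  moreover have "f \<in> carrier (Fn_lpg n L) \<longleftrightarrow> f \<in> carrier (F_lpg L) \<and> periodic_elem n (F_lpg L) f"
    by (simp add: Fn_lpg_def)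
  ultimately show ?thesis using F_lpg_iff[of f] by metis
qed

text \<open>Every entry of an adjoint sequence determines its neighbours, so the single coincidence
  \<open>s (- int n) = s (int n)\<close> spreads to all indices.\<close>

lemma Fn_lpgE:
  assumes "f \<in> carrier (Fn_lpg n L)"
  obtains s where "adjoint_seq L s" "s 0 = f" "\<And>i. s (i + 2 * int n) = s i"
proof -
  obtain s where s: "adjoint_seq L s" "s 0 = f" "s (- int n) = s (int n)"
    using assms Fn_lpg_iff by blast
  have "s (i + 2 * int n) = s i" for i
  proof (cases "i \<ge> - int n")
    case True
    then show ?thesis
      using adjoint_seq_residual_funpow[OF s(1), of "nat (i + int n)" "- int n"]
        adjoint_seq_residual_funpow[OF s(1), of "nat (i + int n)" "int n"] s(3)
      by (simp add: algebra_simps)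
  next
    case False
    then show ?thesis
      using adjoint_seq_dual_residual_funpow[OF s(1), of "nat (- i - int n)" "- int n"]
        adjoint_seq_dual_residual_funpow[OF s(1), of "nat (- i - int n)" "int n"] s(3)
      by (simp add: algebra_simps)
  qed
  with s that show thesis by blast
qed

lemma Fn_lpg_shift:
  assumes "adjoint_seq L s" "\<And>i. s (i + 2 * int n) = s i"
  shows "s j \<in> carrier (Fn_lpg n L)"
  unfolding Fn_lpg_iff
proof (intro exI conjI)
  show "adjoint_seq L (\<lambda>i. s (i + j))"
    using assms(1) unfolding adjoint_seq_def by (metis add.commute add.left_commute)
  show "s (0 + j) = s j" by simp
  show "s (- int n + j) = s (int n + j)" using assms(2)[of "j - int n"] by (simp add: algebra_simps)
qed

lemma Fn_lpg_maps: "f \<in> carrier (Fn_lpg n L) \<Longrightarrow> f \<in> carrier L \<rightarrow>\<^sub>E carrier L"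
  by (auto simp: Fn_lpg_def F_lpg_def)

lemma Fn_lpg_residual:
  assumes "f \<in> carrier (Fn_lpg n L)"
  shows "residual L f \<in> carrier (Fn_lpg n L)" "dual_residual L f \<in> carrier (Fn_lpg n L)"
    "adjoint_pair L f (residual L f)" "adjoint_pair L (dual_residual L f) f"
proof -
  obtain s where s: "adjoint_seq L s" "s 0 = f" "\<And>i. s (i + 2 * int n) = s i"
    using Fn_lpgE[OF assms] by blast
  have "residual L f = s 1" "dual_residual L f = s (- 1)"
    using adjoint_seq_residual_funpow[OF s(1), of 1 0] adjoint_seq_dual_residual_funpow[OF s(1), of 1 0] s(2)
    by simp_all
  moreover have "adjoint_pair L (s 0) (s 1)" "adjoint_pair L (s (- 1)) (s 0)"
    using s(1) unfolding adjoint_seq_def by (metis add_0, metis add.left_inverse)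
  ultimately show "residual L f \<in> carrier (Fn_lpg n L)" "dual_residual L f \<in> carrier (Fn_lpg n L)"
    "adjoint_pair L f (residual L f)" "adjoint_pair L (dual_residual L f) f"
    using Fn_lpg_shift[of s n] s by simp_all
qed

lemma Fn_lpg_mono:
  assumes "f \<in> carrier (Fn_lpg n L)" "x \<sqsubseteq> y" "x \<in> carrier L" "y \<in> carrier L"
  shows "f x \<sqsubseteq> f y"
  using adjoint_pair_mono(1)[OF Fn_lpg_residual(3)] assms by blast

lemma adjoint_pair_compose:
  assumes "adjoint_pair L f f'" "adjoint_pair L g g'"
  shows "adjoint_pair L (compose (carrier L) f g) (compose (carrier L) g' f')"
  using adjoint_pairD[OF assms(1)] adjoint_pairD[OF assms(2)]
  by (auto simp: adjoint_pair_def compose_def)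

lemma Fn_lpg_compose:
  assumes "f \<in> carrier (Fn_lpg n L)" "g \<in> carrier (Fn_lpg n L)"
  shows "compose (carrier L) f g \<in> carrier (Fn_lpg n L)"
proof -
  obtain s where s: "adjoint_seq L s" "s 0 = f" "s (- int n) = s (int n)"
    using assms(1) Fn_lpg_iff by blast
  obtain t where t: "adjoint_seq L t" "t 0 = g" "t (- int n) = t (int n)"
    using assms(2) Fn_lpg_iff by blast
  \<comment> \<open>Passing to adjoints reverses a composition, hence the alternation. The indices
    \<open>- int n\<close> and \<open>int n\<close> have the same parity, so the closing condition
    survives.\<close>
  let ?u = "\<lambda>i. if even i then compose (carrier L) (s i) (t i) else compose (carrier L) (t i) (s i)"
  have "adjoint_seq L ?u" using s(1) t(1) by (simp add: adjoint_seq_def adjoint_pair_compose)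
  then show ?thesis unfolding Fn_lpg_iff using s t by (intro exI[of _ ?u]) simp
qed

lemma Fn_lpg_id: "(\<lambda>x\<in>carrier L. x) \<in> carrier (Fn_lpg n L)"
  unfolding Fn_lpg_iff
  by (rule exI[of _ "\<lambda>i. \<lambda>x\<in>carrier L. x"]) (simp add: adjoint_seq_def adjoint_pair_def)

section \<open>Pointwise maxima and minima as lattice operations\<close>

definition max_map :: "('a \<Rightarrow> 'a) \<Rightarrow> ('a \<Rightarrow> 'a) \<Rightarrow> 'a \<Rightarrow> 'a" where
  "max_map f g = (\<lambda>x\<in>carrier L. if f x \<sqsubseteq> g x then g x else f x)"

definition min_map :: "('a \<Rightarrow> 'a) \<Rightarrow> ('a \<Rightarrow> 'a) \<Rightarrow> 'a \<Rightarrow> 'a" where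
  "min_map f g = (\<lambda>x\<in>carrier L. if f x \<sqsubseteq> g x then f x else g x)"

lemma max_map_le_iff:
  assumes "x \<in> carrier L" "f x \<in> carrier L" "g x \<in> carrier L" "y \<in> carrier L"
  shows "max_map f g x \<sqsubseteq> y \<longleftrightarrow> f x \<sqsubseteq> y \<and> g x \<sqsubseteq> y"
  using assms le_trans[of "f x" "g x" y] le_trans[of "g x" "f x" y] not_le_imp_le[of "f x" "g x"]
  by (auto simp: max_map_def)

lemma le_min_map_iff:
  assumes "x \<in> carrier L" "f x \<in> carrier L" "g x \<in> carrier L" "y \<in> carrier L"
  shows "y \<sqsubseteq> min_map f g x \<longleftrightarrow> y \<sqsubseteq> f x \<and> y \<sqsubseteq> g x"
  using assms le_trans[of y "f x" "g x"] le_trans[of y "g x" "f x"] not_le_imp_le[of "f x" "g x"]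
  by (auto simp: min_map_def)

lemma le_max_map_iff:
  assumes "x \<in> carrier L" "f x \<in> carrier L" "g x \<in> carrier L" "y \<in> carrier L"
  shows "y \<sqsubseteq> max_map f g x \<longleftrightarrow> y \<sqsubseteq> f x \<or> y \<sqsubseteq> g x"
  using assms le_trans[of y "f x" "g x"] le_trans[of y "g x" "f x"] not_le_imp_le[of "f x" "g x"]
  by (auto simp: max_map_def)

lemma min_map_le_iff:
  assumes "x \<in> carrier L" "f x \<in> carrier L" "g x \<in> carrier L" "y \<in> carrier L"
  shows "min_map f g x \<sqsubseteq> y \<longleftrightarrow> f x \<sqsubseteq> y \<or> g x \<sqsubseteq> y"
  using assms le_trans[of "f x" "g x" y] le_trans[of "g x" "f x" y] not_le_imp_le[of "f x" "g x"]
  by (auto simp: min_map_def)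

lemma max_min_map_maps:
  assumes "f \<in> carrier L \<rightarrow>\<^sub>E carrier L" "g \<in> carrier L \<rightarrow>\<^sub>E carrier L"
  shows "max_map f g \<in> carrier L \<rightarrow>\<^sub>E carrier L" "min_map f g \<in> carrier L \<rightarrow>\<^sub>E carrier L"
  using assms by (auto simp: max_map_def min_map_def)

lemma adjoint_pair_max_min:
  assumes "adjoint_pair L f f'" "adjoint_pair L g g'"
  shows "adjoint_pair L (max_map f g) (min_map f' g')" "adjoint_pair L (min_map f g) (max_map f' g')"
  using adjoint_pairD[OF assms(1)] adjoint_pairD[OF assms(2)]
  by (auto simp: adjoint_pair_def max_min_map_maps max_map_le_iff min_map_le_iff le_max_map_iff le_min_map_iff)

lemma Fn_lpg_max_min:
  assumes "f \<in> carrier (Fn_lpg n L)" "g \<in> carrier (Fn_lpg n L)"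
  shows "max_map f g \<in> carrier (Fn_lpg n L)" "min_map f g \<in> carrier (Fn_lpg n L)"
proof -
  obtain s where s: "adjoint_seq L s" "s 0 = f" "s (- int n) = s (int n)"
    using assms(1) Fn_lpg_iff by blast
  obtain t where t: "adjoint_seq L t" "t 0 = g" "t (- int n) = t (int n)"
    using assms(2) Fn_lpg_iff by blast
  \<comment> \<open>The adjoint of a pointwise maximum is the minimum of the adjoints and vice
    versa, so the two alternate with parity.\<close>
  let ?u = "\<lambda>i. if even i then max_map (s i) (t i) else min_map (s i) (t i)"
  let ?v = "\<lambda>i. if odd i then max_map (s i) (t i) else min_map (s i) (t i)"
  have "adjoint_seq L ?u" "adjoint_seq L ?v"
    using s(1) t(1) by (simp_all add: adjoint_seq_def adjoint_pair_max_min)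
  then show "max_map f g \<in> carrier (Fn_lpg n L)" "min_map f g \<in> carrier (Fn_lpg n L)"
    unfolding Fn_lpg_iff using s t by (intro exI[of _ ?u] exI[of _ ?v]; simp)+
qed

lemma lat_Fn_lpg:
  assumes "f \<in> carrier (Fn_lpg n L)" "g \<in> carrier (Fn_lpg n L)"
  shows "least (lat (Fn_lpg n L)) (max_map f g) (Upper (lat (Fn_lpg n L)) {f, g})"
    and "greatest (lat (Fn_lpg n L)) (min_map f g) (Lower (lat (Fn_lpg n L)) {f, g})"
proof -
  have m: "f x \<in> carrier L" if "x \<in> carrier L" "f \<in> carrier (Fn_lpg n L)" for f x
    using Fn_lpg_maps that by blast
  show "least (lat (Fn_lpg n L)) (max_map f g) (Upper (lat (Fn_lpg n L)) {f, g})"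
    using assms m Fn_lpg_max_min[OF assms]
    by (auto simp: least_def Upper_def lat_def max_map_le_iff le_max_map_iff)
  show "greatest (lat (Fn_lpg n L)) (min_map f g) (Lower (lat (Fn_lpg n L)) {f, g})"
    using assms m Fn_lpg_max_min[OF assms]
    by (auto simp: greatest_def Lower_def lat_def min_map_le_iff le_min_map_iff)
qed

lemma lpregroup_Fn_lpg: "lpregroup (Fn_lpg n L)"
proof -
  have m: "f x \<in> carrier L" if "x \<in> carrier L" "f \<in> carrier (Fn_lpg n L)" for f x
    using Fn_lpg_maps that by blast
  have "partial_order (lat (Fn_lpg n L))"
  proof
    fix f g
    assume "f \<sqsubseteq>\<^bsub>lat (Fn_lpg n L)\<^esub> g" "g \<sqsubseteq>\<^bsub>lat (Fn_lpg n L)\<^esub> f" "f \<in> carrier (lat (Fn_lpg n L))"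
      "g \<in> carrier (lat (Fn_lpg n L))"
    then have "f = g"
      using m by (intro PiE_ext[of f "carrier L" "\<lambda>_. carrier L" g])
        (auto simp: lat_def Fn_lpg_maps intro!: antisym)
    then show "f .=\<^bsub>lat (Fn_lpg n L)\<^esub> g" by (simp add: lat_def)
  next
    fix f g h
    assume "f \<sqsubseteq>\<^bsub>lat (Fn_lpg n L)\<^esub> g" "g \<sqsubseteq>\<^bsub>lat (Fn_lpg n L)\<^esub> h" "f \<in> carrier (lat (Fn_lpg n L))"
      "g \<in> carrier (lat (Fn_lpg n L))" "h \<in> carrier (lat (Fn_lpg n L))"
    then show "f \<sqsubseteq>\<^bsub>lat (Fn_lpg n L)\<^esub> h" using m by (auto simp: lat_def intro: le_trans)
  qed (auto simp: lat_def m)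
  then have lattice: "lattice (lat (Fn_lpg n L))"
    using lat_Fn_lpg[of _ n]
    unfolding lattice_def upper_semilattice_def lower_semilattice_def
      upper_semilattice_axioms_def lower_semilattice_axioms_def lat_sel by metis
  have "monoid (Fn_lpg n L)"
  proof (rule monoidI)
    fix f g h
    assume "f \<in> carrier (Fn_lpg n L)" "g \<in> carrier (Fn_lpg n L)" "h \<in> carrier (Fn_lpg n L)"
    then show "f \<otimes>\<^bsub>Fn_lpg n L\<^esub> g \<otimes>\<^bsub>Fn_lpg n L\<^esub> h = f \<otimes>\<^bsub>Fn_lpg n L\<^esub> (g \<otimes>\<^bsub>Fn_lpg n L\<^esub> h)"
      using m by (auto simp: compose_def fun_eq_iff)
  next
    fix f assume "f \<in> carrier (Fn_lpg n L)"
    then have "f \<in> carrier L \<rightarrow> carrier L" "f \<in> extensional (carrier L)"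
      using Fn_lpg_maps by (auto simp: PiE_def)
    then show "\<one>\<^bsub>Fn_lpg n L\<^esub> \<otimes>\<^bsub>Fn_lpg n L\<^esub> f = f" "f \<otimes>\<^bsub>Fn_lpg n L\<^esub> \<one>\<^bsub>Fn_lpg n L\<^esub> = f"
      by (simp_all add: Id_compose compose_Id)
  qed (simp_all add: Fn_lpg_compose Fn_lpg_id)
  moreover have "lpregroup_axioms (Fn_lpg n L)"
  proof (rule lpregroup_axioms.intro)
    fix f f' g g'
    assume fg: "f \<in> carrier (Fn_lpg n L)" "f' \<in> carrier (Fn_lpg n L)" "g \<in> carrier (Fn_lpg n L)"
      "g' \<in> carrier (Fn_lpg n L)" "leq (Fn_lpg n L) f f'" "leq (Fn_lpg n L) g g'"
    have "f (g x) \<sqsubseteq> f' (g' x)" if "x \<in> carrier L" for x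
    proof (rule le_trans)
      show "f (g x) \<sqsubseteq> f (g' x)" using fg that m by (simp add: Fn_lpg_mono)
      show "f (g' x) \<sqsubseteq> f' (g' x)" using fg that m by simp
    qed (use fg that m in simp_all)
    then show "leq (Fn_lpg n L) (f \<otimes>\<^bsub>Fn_lpg n L\<^esub> g) (f' \<otimes>\<^bsub>Fn_lpg n L\<^esub> g')"
      by (simp add: compose_eq)
  next
    fix f assume f: "f \<in> carrier (Fn_lpg n L)"
    show "leq (Fn_lpg n L) (lad (Fn_lpg n L) f \<otimes>\<^bsub>Fn_lpg n L\<^esub> f) \<one>\<^bsub>Fn_lpg n L\<^esub>"
      "leq (Fn_lpg n L) \<one>\<^bsub>Fn_lpg n L\<^esub> (f \<otimes>\<^bsub>Fn_lpg n L\<^esub> lad (Fn_lpg n L) f)"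
      "leq (Fn_lpg n L) (f \<otimes>\<^bsub>Fn_lpg n L\<^esub> rad (Fn_lpg n L) f) \<one>\<^bsub>Fn_lpg n L\<^esub>"
      "leq (Fn_lpg n L) \<one>\<^bsub>Fn_lpg n L\<^esub> (rad (Fn_lpg n L) f \<otimes>\<^bsub>Fn_lpg n L\<^esub> f)"
      using adjoint_pair_counit_unit[OF Fn_lpg_residual(3)[OF f]]
        adjoint_pair_counit_unit[OF Fn_lpg_residual(4)[OF f]]
      by (simp_all add: compose_eq)
  qed (simp_all add: lattice Fn_lpg_residual)
  ultimately show ?thesis by (simp add: lpregroup_def)
qed

lemma periodic_lpregroup_Fn_lpg: "periodic_lpregroup n (Fn_lpg n L)"
  unfolding periodic_lpregroup_def
  using lpregroup_Fn_lpg by (auto simp: Fn_lpg_def periodic_elem_def)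

lemma Fn_lpg_join:
  assumes "f \<in> carrier (Fn_lpg n L)" "g \<in> carrier (Fn_lpg n L)"
  shows "f \<squnion>\<^bsub>lat (Fn_lpg n L)\<^esub> g = max_map f g" "f \<sqinter>\<^bsub>lat (Fn_lpg n L)\<^esub> g = min_map f g"
proof -
  have "lattice (lat (Fn_lpg n L))" using lpregroup_Fn_lpg lpregroup.lattice_reduct by blast
  then interpret X: lattice "lat (Fn_lpg n L)" .
  have c: "carrier (lat (Fn_lpg n L)) = carrier (Fn_lpg n L)" by (simp add: lat_def)
  show "f \<squnion>\<^bsub>lat (Fn_lpg n L)\<^esub> g = max_map f g"
    using X.least_unique[OF X.sup_of_two_least lat_Fn_lpg(1)] assms by (simp add: join_def c)
  show "f \<sqinter>\<^bsub>lat (Fn_lpg n L)\<^esub> g = min_map f g"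
    using X.greatest_unique[OF X.inf_of_two_greatest lat_Fn_lpg(2)] assms by (simp add: meet_def c)
qed

end

section \<open>Homomorphisms and transport of structure\<close>

lemma lpregroup_transport:
  assumes A: "lpregroup A" and bij: "bij_betw \<phi> (carrier A) (carrier B)"
    and mult: "\<And>x y. \<lbrakk>x \<in> carrier A; y \<in> carrier A\<rbrakk> \<Longrightarrow> \<phi> (x \<otimes>\<^bsub>A\<^esub> y) = \<phi> x \<otimes>\<^bsub>B\<^esub> \<phi> y"
    and one: "\<phi> \<one>\<^bsub>A\<^esub> = \<one>\<^bsub>B\<^esub>"
    and leq: "\<And>x y. \<lbrakk>x \<in> carrier A; y \<in> carrier A\<rbrakk> \<Longrightarrow> leq A x y \<longleftrightarrow> leq B (\<phi> x) (\<phi> y)"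
    and lad: "\<And>x. x \<in> carrier A \<Longrightarrow> \<phi> (lad A x) = lad B (\<phi> x)"
    and rad: "\<And>x. x \<in> carrier A \<Longrightarrow> \<phi> (rad A x) = rad B (\<phi> x)"
  shows "lpregroup B" "\<phi> \<in> lpg_hom A B"
proof -
  interpret A: lpregroup A by fact
  have B: "carrier B = \<phi> ` carrier A" using bij by (simp add: bij_betw_def)
  have inj: "\<phi> x = \<phi> y \<longleftrightarrow> x = y" if "x \<in> carrier A" "y \<in> carrier A" for x y
    using bij that by (auto simp: bij_betw_def dest: inj_onD)
  note [simp] = mult[symmetric] one[symmetric] leq[symmetric] lad[symmetric] rad[symmetric] inj
  have po: "partial_order (lat B)"
    by unfold_locales (auto simp: lat_sel B intro: A.le_antisym A.le_trans)
  have lub: "least (lat B) (\<phi> (x \<squnion>\<^bsub>lat A\<^esub> y)) (Upper (lat B) {\<phi> x, \<phi> y})"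
    if "x \<in> carrier A" "y \<in> carrier A" for x y
    using that by (auto simp: least_def Upper_def lat_sel B A.L.join_left A.L.join_right A.L.join_le)
  have glb: "greatest (lat B) (\<phi> (x \<sqinter>\<^bsub>lat A\<^esub> y)) (Lower (lat B) {\<phi> x, \<phi> y})"
    if "x \<in> carrier A" "y \<in> carrier A" for x y
    using that by (auto simp: greatest_def Lower_def lat_sel B A.L.meet_left A.L.meet_right A.L.meet_le)
  have "upper_semilattice (lat B)"
    by (intro upper_semilattice.intro po upper_semilattice_axioms.intro)
      (use lub in \<open>auto simp: lat_sel B\<close>)
  moreover have "lower_semilattice (lat B)"
    by (intro lower_semilattice.intro po lower_semilattice_axioms.intro)
      (use glb in \<open>auto simp: lat_sel B\<close>)
  ultimately have lattice: "lattice (lat B)" by (simp add: lattice_def)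
  then interpret LB: lattice "lat B" .
  have "monoid B" by (rule monoidI) (auto simp: B A.m_assoc)
  moreover have "lpregroup_axioms B"
    by (rule lpregroup_axioms.intro)
      (auto simp: B lattice A.lad_mult A.mult_lad A.mult_rad A.rad_mult intro: A.mult_mono)
  ultimately show "lpregroup B" by (simp add: lpregroup_def)
  have "\<phi> (x \<squnion>\<^bsub>lat A\<^esub> y) = \<phi> x \<squnion>\<^bsub>lat B\<^esub> \<phi> y" "\<phi> (x \<sqinter>\<^bsub>lat A\<^esub> y) = \<phi> x \<sqinter>\<^bsub>lat B\<^esub> \<phi> y"
    if "x \<in> carrier A" "y \<in> carrier A" for x y
    using LB.least_unique[OF lub LB.sup_of_two_least] LB.greatest_unique[OF glb LB.inf_of_two_greatest]
      that by (simp_all add: lat_sel B join_def meet_def)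
  then show "\<phi> \<in> lpg_hom A B"
    using lattice A.lattice_reduct
    by (auto simp: lpg_hom_def hom_def B join_pres_def meet_pres_def lat_sel)
qed

text \<open>Intended for \<open>B\<close> a wreath product, about which nothing is known beforehand:
  its laws are obtained from \<open>A\<close>. The map runs from \<open>B\<close> to
  \<open>A\<close> because in this direction it has an explicit formula.\<close>

lemma lpg_isomorphic_transport:
  assumes A: "lpregroup A" and bij: "bij_betw \<psi> (carrier B) (carrier A)"
    and mult: "\<And>x y. \<lbrakk>x \<in> carrier B; y \<in> carrier B\<rbrakk> \<Longrightarrow>
      x \<otimes>\<^bsub>B\<^esub> y \<in> carrier B \<and> \<psi> (x \<otimes>\<^bsub>B\<^esub> y) = \<psi> x \<otimes>\<^bsub>A\<^esub> \<psi> y"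
    and one: "\<one>\<^bsub>B\<^esub> \<in> carrier B" "\<psi> \<one>\<^bsub>B\<^esub> = \<one>\<^bsub>A\<^esub>"
    and leq: "\<And>x y. \<lbrakk>x \<in> carrier B; y \<in> carrier B\<rbrakk> \<Longrightarrow> leq B x y \<longleftrightarrow> leq A (\<psi> x) (\<psi> y)"
    and lad: "\<And>x. x \<in> carrier B \<Longrightarrow> lad B x \<in> carrier B \<and> \<psi> (lad B x) = lad A (\<psi> x)"
    and rad: "\<And>x. x \<in> carrier B \<Longrightarrow> rad B x \<in> carrier B \<and> \<psi> (rad B x) = rad A (\<psi> x)"
  shows "lpg_isomorphic A B"
proof -
  let ?\<phi> = "inv_into (carrier B) \<psi>"
  have A_eq: "carrier A = \<psi> ` carrier B" and inj: "inj_on \<psi> (carrier B)"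
    using bij by (auto simp: bij_betw_def)
  have inv: "?\<phi> (\<psi> x) = x" if "x \<in> carrier B" for x using inj that by simp
  have bij': "bij_betw ?\<phi> (carrier A) (carrier B)" by (rule bij_betw_inv_into[OF bij])
  have 1: "?\<phi> (x \<otimes>\<^bsub>A\<^esub> y) = ?\<phi> x \<otimes>\<^bsub>B\<^esub> ?\<phi> y" "leq A x y \<longleftrightarrow> leq B (?\<phi> x) (?\<phi> y)"
    if xy: "x \<in> carrier A" "y \<in> carrier A" for x y
  proof -
    obtain a b where ab: "x = \<psi> a" "y = \<psi> b" "a \<in> carrier B" "b \<in> carrier B"
      using xy A_eq by auto
    show "?\<phi> (x \<otimes>\<^bsub>A\<^esub> y) = ?\<phi> x \<otimes>\<^bsub>B\<^esub> ?\<phi> y" "leq A x y \<longleftrightarrow> leq B (?\<phi> x) (?\<phi> y)"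
      using ab mult[of a b] leq[of a b] by (metis inv)+
  qed
  have 2: "?\<phi> (lad A x) = lad B (?\<phi> x)" "?\<phi> (rad A x) = rad B (?\<phi> x)" if x: "x \<in> carrier A" for x
  proof -
    obtain a where a: "x = \<psi> a" "a \<in> carrier B" using x A_eq by auto
    show "?\<phi> (lad A x) = lad B (?\<phi> x)" "?\<phi> (rad A x) = rad B (?\<phi> x)"
      using a lad[of a] rad[of a] by (metis inv)+
  qed
  have 3: "?\<phi> \<one>\<^bsub>A\<^esub> = \<one>\<^bsub>B\<^esub>" using one inv by metis
  have "lpregroup B" by (rule lpregroup_transport(1)[OF A bij']) (use 1 2 3 in blast)+
  moreover have "?\<phi> \<in> lpg_hom A B" by (rule lpregroup_transport(2)[OF A bij']) (use 1 2 3 in blast)+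
  ultimately show ?thesis using A bij' by (auto simp: lpg_isomorphic_def)
qed

text \<open>Preserving joins gives monotonicity, and a monotone monoid homomorphism carries the
  inequalities that characterize the adjoints.\<close>

lemma lpg_homI:
  assumes "lpregroup A" "lpregroup B"
    and cl: "\<And>x. x \<in> carrier A \<Longrightarrow> f x \<in> carrier B"
    and mult: "\<And>x y. \<lbrakk>x \<in> carrier A; y \<in> carrier A\<rbrakk> \<Longrightarrow> f (x \<otimes>\<^bsub>A\<^esub> y) = f x \<otimes>\<^bsub>B\<^esub> f y"
    and one: "f \<one>\<^bsub>A\<^esub> = \<one>\<^bsub>B\<^esub>"
    and join: "\<And>x y. \<lbrakk>x \<in> carrier A; y \<in> carrier A\<rbrakk> \<Longrightarrow>
      f (x \<squnion>\<^bsub>lat A\<^esub> y) = f x \<squnion>\<^bsub>lat B\<^esub> f y"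
    and meet: "\<And>x y. \<lbrakk>x \<in> carrier A; y \<in> carrier A\<rbrakk> \<Longrightarrow>
      f (x \<sqinter>\<^bsub>lat A\<^esub> y) = f x \<sqinter>\<^bsub>lat B\<^esub> f y"
  shows "f \<in> lpg_hom A B"
proof -
  interpret A: lpregroup A by fact
  interpret B: lpregroup B by fact
  have mono: "leq B (f x) (f y)" if "leq A x y" "x \<in> carrier A" "y \<in> carrier A" for x y
    using that join[of x y] A.L.le_iff_meet[of x y] B.L.join_left[of "f x" "f y"] cl by simp
  have "f (lad A x) = lad B (f x)" "f (rad A x) = rad B (f x)" if x: "x \<in> carrier A" for x
    using x cl mult[of x "lad A x"] mult[of x "rad A x"] mult[of "lad A x" x] mult[of "rad A x" x]
      mono[OF A.lad_mult[OF x]] mono[OF A.mult_lad[OF x]] mono[OF A.rad_mult[OF x]] mono[OF A.mult_rad[OF x]]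
      B.lad_unique[of "f x" "f (lad A x)"] B.rad_unique[of "f x" "f (rad A x)"]
    by (simp_all add: one)
  then show ?thesis
    using assms A.lattice_reduct B.lattice_reduct
    by (auto simp: lpg_hom_def hom_def join_pres_def meet_pres_def lat_sel)
qed

section \<open>Integral chains\<close>

text \<open>The second assumption says that \<open>\<sigma> x\<close> is the least point strictly
  above \<open>x\<close>; bijectivity adds immediate predecessors. The chain may consist of many
  copies of \<int>.\<close>

locale integral_chain = chain +
  fixes \<sigma> :: "'a \<Rightarrow> 'a"
  assumes bij: "bij_betw \<sigma> (carrier L) (carrier L)"
    and cover: "\<lbrakk>x \<in> carrier L; y \<in> carrier L\<rbrakk> \<Longrightarrow> \<sigma> x \<sqsubseteq> y \<longleftrightarrow> \<not> y \<sqsubseteq> x"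
begin

lemma \<sigma>_closed: "x \<in> carrier L \<Longrightarrow> \<sigma> x \<in> carrier L"
  using bij by (auto simp: bij_betw_def)

lemma \<sigma>_funpow_closed: "x \<in> carrier L \<Longrightarrow> (\<sigma> ^^ k) x \<in> carrier L"
  by (induction k) (auto simp: \<sigma>_closed)

lemma bij_\<sigma>_funpow: "bij_betw (\<sigma> ^^ k) (carrier L) (carrier L)"
  using bij by (induction k) (auto intro: bij_betw_trans)

text \<open>A cover turns an inequality into a negated one, so two adjunctions can be chained:
  \<open>s (i - 2) (\<sigma> x) \<sqsubseteq> y\<close> iff
  \<open>\<sigma> x \<sqsubseteq> s (i - 1) y\<close> iff not
  \<open>s (i - 1) y \<sqsubseteq> x\<close> iff not \<open>y \<sqsubseteq> s i x\<close> iff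
  \<open>\<sigma> (s i x) \<sqsubseteq> y\<close>.\<close>

lemma adjoint_seq_cover:
  assumes s: "adjoint_seq L s" and x: "x \<in> carrier L"
  shows "s (i - 2) (\<sigma> x) = \<sigma> (s i x)"
proof -
  have p: "adjoint_pair L (s (i - 1)) (s i)" "adjoint_pair L (s (i - 2)) (s (i - 1))"
    using s[unfolded adjoint_seq_def, rule_format, of "i - 1"]
      s[unfolded adjoint_seq_def, rule_format, of "i - 2"] by simp_all
  note p1 = adjoint_pairD[OF p(1)] and p2 = adjoint_pairD[OF p(2)]
  have iff: "s (i - 2) (\<sigma> x) \<sqsubseteq> y \<longleftrightarrow> \<sigma> (s i x) \<sqsubseteq> y" if "y \<in> carrier L" for y
    using that x by (simp add: p1 p2 \<sigma>_closed cover)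
  have "s (i - 2) (\<sigma> x) \<in> carrier L" "\<sigma> (s i x) \<in> carrier L" using x by (simp_all add: p1 p2 \<sigma>_closed)
  then show ?thesis using iff by (metis antisym le_refl)
qed

lemma adjoint_seq_cover_funpow:
  assumes s: "adjoint_seq L s" and x: "x \<in> carrier L"
  shows "s (i - 2 * int k) ((\<sigma> ^^ k) x) = (\<sigma> ^^ k) (s i x)"
proof (induction k)
  case (Suc k)
  have "s (i - 2 * int k - 2) (\<sigma> ((\<sigma> ^^ k) x)) = \<sigma> (s (i - 2 * int k) ((\<sigma> ^^ k) x))"
    by (rule adjoint_seq_cover[OF s]) (simp add: x \<sigma>_funpow_closed)
  moreover have "i - 2 * int (Suc k) = i - 2 * int k - 2" by simp
  ultimately show ?case by (simp only: funpow.simps comp_apply Suc)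
qed simp

lemma Fn_lpg_commute:
  assumes "f \<in> carrier (Fn_lpg n L)" "x \<in> carrier L"
  shows "f ((\<sigma> ^^ n) x) = (\<sigma> ^^ n) (f x)"
proof -
  obtain s where s: "adjoint_seq L s" "s 0 = f" "\<And>i. s (i + 2 * int n) = s i"
    using Fn_lpgE[OF assms(1)] by blast
  have "s (- 2 * int n) = s 0" using s(3)[of "- 2 * int n"] by simp
  then show ?thesis using adjoint_seq_cover_funpow[OF s(1) assms(2), of 0 n] s(2) by simp
qed

text \<open>Membership concerns residuals of all orders, so it is proved for a whole class
  \<open>S\<close> closed under both adjoints at once.\<close>

lemma Fn_lpgI:
  assumes f: "f \<in> S" and maps: "S \<subseteq> carrier L \<rightarrow>\<^sub>E carrier L"
    and up: "\<And>f. f \<in> S \<Longrightarrow> \<exists>g\<in>S. adjoint_pair L f g"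
    and down: "\<And>f. f \<in> S \<Longrightarrow> \<exists>g\<in>S. adjoint_pair L g f"
    and comm: "\<And>f x. f \<in> S \<Longrightarrow> x \<in> carrier L \<Longrightarrow> f ((\<sigma> ^^ n) x) = (\<sigma> ^^ n) (f x)"
  shows "f \<in> carrier (Fn_lpg n L)"
proof -
  have r: "(residual L ^^ k) f \<in> S" for k
    using f up residual_eq by (induction k) (simp, fastforce)
  have d: "(dual_residual L ^^ k) f \<in> S" for k
    using f down dual_residual_eq by (induction k) (simp, fastforce)
  have "lower_adjoint L L g" "upper_adjoint L L g" if "g \<in> S" for g
    using up[OF that] down[OF that] adjoint_pair_galois
    by (auto simp: lower_adjoint_def upper_adjoint_def)
  then have "f \<in> carrier (F_lpg L)" using f maps r d by (auto simp: F_lpg_def)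
  then obtain s where s: "adjoint_seq L s" "s 0 = f" using F_lpg_iff by blast
  have p: "adjoint_pair L (s i) (s (i + 1))" for i using s(1) by (simp add: adjoint_seq_def)
  have sn: "s (int n) \<in> S"
    using r[of n] adjoint_seq_residual_funpow[OF s(1), of n 0] s(2) by simp
  \<comment> \<open>Going \<open>2 * n\<close> indices down conjugates by
    \<open>\<sigma> ^^ n\<close>, and \<open>s (int n)\<close> commutes with this bijection.\<close>
  have "s (- int n) = s (int n)"
  proof (rule PiE_ext[OF adjoint_pairD(1)[OF p] adjoint_pairD(1)[OF p]])
    fix y assume "y \<in> carrier L"
    then obtain x where x: "y = (\<sigma> ^^ n) x" "x \<in> carrier L"
      using bij_\<sigma>_funpow[of n] by (auto simp: bij_betw_def)
    then show "s (- int n) y = s (int n) y"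
      using adjoint_seq_cover_funpow[OF s(1) x(2), of "int n" n] comm[OF sn x(2)] by simp
  qed
  then show ?thesis using s Fn_lpg_iff by blast
qed

end

lemma Z_chain_sel [simp]: "carrier Z_chain = UNIV" "le Z_chain = (\<le>)" "eq Z_chain = (=)"
  by (simp_all add: Z_chain_def)

lemma total_orderI_eq:
  assumes "eq X = (=)" "\<And>x. x \<in> carrier X \<Longrightarrow> x \<sqsubseteq>\<^bsub>X\<^esub> x"
    "\<And>x y. \<lbrakk>x \<in> carrier X; y \<in> carrier X; x \<sqsubseteq>\<^bsub>X\<^esub> y; y \<sqsubseteq>\<^bsub>X\<^esub> x\<rbrakk> \<Longrightarrow> x = y"
    "\<And>x y z. \<lbrakk>x \<in> carrier X; y \<in> carrier X; z \<in> carrier X; x \<sqsubseteq>\<^bsub>X\<^esub> y; y \<sqsubseteq>\<^bsub>X\<^esub> z\<rbrakk> \<Longrightarrow> x \<sqsubseteq>\<^bsub>X\<^esub> z"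
    "\<And>x y. \<lbrakk>x \<in> carrier X; y \<in> carrier X\<rbrakk> \<Longrightarrow> x \<sqsubseteq>\<^bsub>X\<^esub> y \<or> y \<sqsubseteq>\<^bsub>X\<^esub> x"
  shows "total_order X"
proof -
  have "equivalence X" by (rule equivalence.intro) (simp_all add: assms(1))
  moreover have "weak_partial_order_axioms X"
    unfolding weak_partial_order_axioms_def assms(1) using assms(2-4) by blast
  ultimately have "weak_partial_order X" by (rule weak_partial_order.intro)
  then have "partial_order X" by (rule partial_order.intro) (simp add: partial_order_axioms_def assms(1))
  then show ?thesis by (rule total_order.intro) (simp add: total_order_axioms_def assms(5))
qed

interpretation Z: integral_chain Z_chain "\<lambda>x. x + 1"
proof -
  have "bij_betw (\<lambda>x::int. x + 1) UNIV UNIV"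
    by (rule bij_betwI[of _ _ _ "\<lambda>x. x - 1"]) auto
  moreover have "total_order Z_chain" by (rule total_orderI_eq) auto
  ultimately show "integral_chain Z_chain (\<lambda>x. x + 1)"
    by (simp add: integral_chain_def integral_chain_axioms_def chain_def) presburger
qed

lemma int_downset_has_max:
  fixes P :: "int \<Rightarrow> bool"
  assumes "P a" "\<not> P b" and down: "\<And>x y. P y \<Longrightarrow> x \<le> y \<Longrightarrow> P x"
  obtains z where "\<And>x. P x \<longleftrightarrow> x \<le> z"
proof -
  define k where "k = (LEAST k::nat. \<not> P (a + int k))"
  have "\<not> P (a + int (nat (b - a)))" using assms(2) down[of "a + int (nat (b - a))" b] by auto
  then have k: "\<not> P (a + int k)" unfolding k_def by (rule LeastI)
  have "k \<noteq> 0" using k assms(1) by (intro notI) simp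
  then have "P (a + int (k - 1))" using not_less_Least[of "k - 1" "\<lambda>k. \<not> P (a + int k)"] by (simp flip: k_def)
  then have "P x \<longleftrightarrow> x \<le> a + int (k - 1)" for x
    using down[of "a + int (k - 1)" x] down[of x "a + int k"] k \<open>k \<noteq> 0\<close> by (cases "x \<le> a + int (k - 1)") auto
  then show thesis by (rule that)
qed

section \<open>Periodic monotone maps of the integers\<close>

definition periodic_mono :: "nat \<Rightarrow> (int \<Rightarrow> int) \<Rightarrow> bool" where
  "periodic_mono n f \<longleftrightarrow> mono f \<and> (\<forall>x. f (x + int n) = f x + int n)"

lemma periodic_mono_mult:
  assumes "periodic_mono n f"
  shows "f (x + int n * k) = f x + int n * k"
proof -
  have 1: "f (x + int n * int m) = f x + int n * int m" for x m
  proof (induction m)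
    case (Suc m)
    have "f (x + int n * int m + int n) = f (x + int n * int m) + int n"
      using assms by (simp add: periodic_mono_def)
    with Suc show ?case by (simp add: algebra_simps)
  qed simp
  show ?thesis
  proof (cases "k \<ge> 0")
    case True
    then show ?thesis using 1[of x "nat k"] by simp
  next
    case False
    then show ?thesis using 1[of "x + int n * k" "nat (- k)"] by simp
  qed
qed

lemma periodic_mono_unbounded:
  assumes "periodic_mono n f" "n \<ge> 1"
  shows "\<exists>x. f x \<le> y" "\<exists>x. f x > y"
proof -
  have n: "int n * \<bar>z\<bar> \<ge> \<bar>z\<bar>" for z using assms(2) by (simp add: mult_le_cancel_right1)
  have "f (0 + int n * (- \<bar>y - f 0\<bar>)) \<le> y" "f (0 + int n * \<bar>y - f 0 + 1\<bar>) > y"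
    using n[of "y - f 0"] n[of "y - f 0 + 1"]
    unfolding periodic_mono_mult[OF assms(1)] by linarith+
  then show "\<exists>x. f x \<le> y" "\<exists>x. f x > y" by blast+
qed

text \<open>Periodicity with \<open>n\<close> positive makes \<open>f\<close> unbounded in both
  directions, so each set of all x with f x \<le> y is a proper nonempty initial segment of \<int>
  and has a maximum; this maximum inherits the translation rule.\<close>

lemma periodic_mono_adjoints:
  assumes f: "periodic_mono n f" and n: "n \<ge> 1"
  shows "\<exists>g. periodic_mono n g \<and> adjoint_pair Z_chain f g"
    and "\<exists>g. periodic_mono n g \<and> adjoint_pair Z_chain g f"
proof -
  have mono: "f x \<le> f y" if "x \<le> y" for x y using f that by (auto simp: periodic_mono_def mono_def)
  have per: "f (x + int n) = f x + int n" for x using f by (simp add: periodic_mono_def)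
  have "\<exists>z. \<forall>x. f x \<le> y \<longleftrightarrow> x \<le> z" for y
  proof -
    obtain a b where "f a \<le> y" "\<not> f b \<le> y" using periodic_mono_unbounded[OF f n] by (meson not_le)
    then show ?thesis using int_downset_has_max[of "\<lambda>x. f x \<le> y" a b] mono order_trans by metis
  qed
  then obtain g where g: "\<And>x y. f x \<le> y \<longleftrightarrow> x \<le> g y" by metis
  have "g x \<le> g y" if "x \<le> y" for x y using that g by (meson order_refl order_trans)
  moreover have "g (y + int n) = g y + int n" for y
  proof -
    have "x \<le> g (y + int n) \<longleftrightarrow> x \<le> g y + int n" for x
      using g[of x "y + int n"] g[of "x - int n" y] per[of "x - int n"] by auto
    then show ?thesis by (meson antisym order_refl)
  qed
  ultimately show "\<exists>g. periodic_mono n g \<and> adjoint_pair Z_chain f g"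
    using g by (intro exI[of _ g]) (auto simp: periodic_mono_def mono_def adjoint_pair_def)
  \<comment> \<open>For the lower adjoint one finds the last point \<open>e y\<close> whose value is
    still below \<open>y\<close>; the least point reaching \<open>y\<close> is then
    \<open>e y + 1\<close>.\<close>
  have "\<exists>z. \<forall>x. x \<le> z \<longleftrightarrow> \<not> y \<le> f x" for y
  proof -
    obtain a b where "\<not> y \<le> f a" "y \<le> f b"
      using periodic_mono_unbounded(1)[OF f n, of "y - 1"] periodic_mono_unbounded(2)[OF f n, of y]
      by (metis less_le not_le zle_diff1_eq)
    then show ?thesis using int_downset_has_max[of "\<lambda>x. \<not> y \<le> f x" a b] mono order_trans by metis
  qed
  then obtain e where e: "\<And>x y. x \<le> e y \<longleftrightarrow> \<not> y \<le> f x" by metis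
  have e': "e y + 1 \<le> x \<longleftrightarrow> y \<le> f x" for x y using e[of x y] by linarith
  have "e x \<le> e y" if "x \<le> y" for x y using that e by (meson order_refl order_trans)
  moreover have "e (y + int n) = e y + int n" for y
  proof -
    have "x \<le> e (y + int n) \<longleftrightarrow> x \<le> e y + int n" for x
      using e[of x "y + int n"] e[of "x - int n" y] per[of "x - int n"] by auto
    then show ?thesis by (meson antisym order_refl)
  qed
  ultimately show "\<exists>g. periodic_mono n g \<and> adjoint_pair Z_chain g f"
    using e' by (intro exI[of _ "\<lambda>y. e y + 1"]) (auto simp: periodic_mono_def mono_def adjoint_pair_def)
qed

lemma succ_funpow: "((\<lambda>x::int. x + 1) ^^ n) x = x + int n"
  by (induction n) auto

lemma Fn_Z_iff:
  assumes n: "n \<ge> 1"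
  shows "f \<in> carrier (Fn_lpg n Z_chain) \<longleftrightarrow> periodic_mono n f"
proof
  assume f: "f \<in> carrier (Fn_lpg n Z_chain)"
  then have "f (x + int n) = f x + int n" for x
    using Z.Fn_lpg_commute[of f n x] by (simp add: succ_funpow)
  then show "periodic_mono n f" using f Z.Fn_lpg_mono by (auto simp: periodic_mono_def mono_def)
next
  assume "periodic_mono n f"
  then show "f \<in> carrier (Fn_lpg n Z_chain)"
  proof (intro Z.Fn_lpgI[of f "Collect (periodic_mono n)"])
    fix g x assume "g \<in> Collect (periodic_mono n)"
    then show "\<exists>h\<in>Collect (periodic_mono n). adjoint_pair Z_chain g h"
      "\<exists>h\<in>Collect (periodic_mono n). adjoint_pair Z_chain h g"
      "g (((\<lambda>x. x + 1) ^^ n) x) = ((\<lambda>x. x + 1) ^^ n) (g x)"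
      using periodic_mono_adjoints[of n g] n by (auto simp: succ_funpow periodic_mono_def)
  qed auto
qed

section \<open>Periodic maps on a lexicographic product\<close>

lemma Aut_sel [simp]:
  "mult (Aut J) = compose (carrier J)" "one (Aut J) = (\<lambda>x\<in>carrier J. x)"
  "leq (Aut J) = (\<lambda>f g. \<forall>x\<in>carrier J. f x \<sqsubseteq>\<^bsub>J\<^esub> g x)"
  "lad (Aut J) = (\<lambda>f. \<lambda>x\<in>carrier J. inv_into (carrier J) f x)"
  "rad (Aut J) = (\<lambda>f. \<lambda>x\<in>carrier J. inv_into (carrier J) f x)"
  by (simp_all add: Aut_def)

context chain
begin

lemma Aut_iff:
  "h \<in> carrier (Aut L) \<longleftrightarrow> h \<in> carrier L \<rightarrow>\<^sub>E carrier L \<and> bij_betw h (carrier L) (carrier L) \<and>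
     (\<forall>x\<in>carrier L. \<forall>y\<in>carrier L. h x \<sqsubseteq> h y \<longleftrightarrow> x \<sqsubseteq> y)"
  by (auto simp: Aut_def Bij_def PiE_def dest: bij_betwE)

lemma Aut_closed: "h \<in> carrier (Aut L) \<Longrightarrow> x \<in> carrier L \<Longrightarrow> h x \<in> carrier L"
  by (auto simp: Aut_iff PiE_mem)

lemma lad_Aut:
  assumes h: "h \<in> carrier (Aut L)"
  shows "x \<in> carrier L \<Longrightarrow> h (lad (Aut L) h x) = x" "x \<in> carrier L \<Longrightarrow> lad (Aut L) h (h x) = x"
    and "adjoint_pair L h (lad (Aut L) h)" "adjoint_pair L (lad (Aut L) h) h"
    and "lad (Aut L) h \<in> carrier (Aut L)"
proof -
  let ?g = "lad (Aut L) h"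
  have b: "bij_betw h (carrier L) (carrier L)" and m: "h \<in> carrier L \<rightarrow>\<^sub>E carrier L"
    and le: "\<And>x y. x \<in> carrier L \<Longrightarrow> y \<in> carrier L \<Longrightarrow> h x \<sqsubseteq> h y \<longleftrightarrow> x \<sqsubseteq> y"
    using h by (auto simp: Aut_iff)
  have hg: "h (?g x) = x" and gh: "?g (h x) = x" and cl: "?g x \<in> carrier L" "h x \<in> carrier L"
    if "x \<in> carrier L" for x
    using b that m by (auto simp: bij_betw_inv_into_right bij_betw_inv_into_left inv_into_into
        bij_betw_imp_surj_on PiE_mem)
  show "x \<in> carrier L \<Longrightarrow> h (?g x) = x" "x \<in> carrier L \<Longrightarrow> ?g (h x) = x" by (fact hg, fact gh)
  have g: "?g \<in> carrier L \<rightarrow>\<^sub>E carrier L" using cl by (simp add: PiE_def Pi_def)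
  show "adjoint_pair L h ?g" "adjoint_pair L ?g h"
    unfolding adjoint_pair_def using m g le hg gh cl by metis+
  have "bij_betw ?g (carrier L) (carrier L)"
    by (rule bij_betw_byWitness[of _ h]) (use hg gh cl in auto)
  then show "?g \<in> carrier (Aut L)"
    unfolding Aut_iff using g le hg gh cl by metis
qed

text \<open>A map whose two adjoints coincide has them as a two-sided inverse. Thus the l-group of
  automorphisms inherits its structure from the case of period 1.\<close>

lemma carrier_Aut: "carrier (Aut L) = carrier (Fn_lpg 1 L)"
proof
  show "carrier (Aut L) \<subseteq> carrier (Fn_lpg 1 L)"
  proof
    fix h assume h: "h \<in> carrier (Aut L)"
    have "adjoint_seq L (\<lambda>i. if even i then h else lad (Aut L) h)"
      using lad_Aut(3,4)[OF h] by (simp add: adjoint_seq_def)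
    then show "h \<in> carrier (Fn_lpg 1 L)" unfolding Fn_lpg_iff
      by (rule_tac exI[of _ "\<lambda>i. if even i then h else lad (Aut L) h"]) simp
  qed
  show "carrier (Fn_lpg 1 L) \<subseteq> carrier (Aut L)"
  proof
    fix f assume f: "f \<in> carrier (Fn_lpg 1 L)"
    define g where "g = residual L f"
    have "dual_residual L f = g" using f by (simp add: g_def Fn_lpg_def periodic_elem_def)
    then have 1: "adjoint_pair L f g" "adjoint_pair L g f"
      using Fn_lpg_residual(3,4)[OF f] by (simp_all add: g_def)
    note p = adjoint_pairD[OF 1(1)]
    have "f (g x) = x" "g (f x) = x" if "x \<in> carrier L" for x
      using adjoint_pair_counit_unit[OF 1(1) that] adjoint_pair_counit_unit[OF 1(2) that] p that
      by (auto intro: antisym)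
    then show "f \<in> carrier (Aut L)" unfolding Aut_iff
      using p by (auto intro!: bij_betw_byWitness[of _ g])
  qed
qed

lemma lpregroup_Aut: "lpregroup (Aut L)"
proof (rule lpregroup_transport(1)[OF lpregroup_Fn_lpg[of 1], where \<phi> = id])
  fix f assume "f \<in> carrier (Fn_lpg 1 L)"
  then have "f \<in> carrier (Aut L)" by (simp add: carrier_Aut)
  then show "id (lad (Fn_lpg 1 L) f) = lad (Aut L) (id f)" "id (rad (Fn_lpg 1 L) f) = rad (Aut L) (id f)"
    using residual_eq[OF lad_Aut(3)] dual_residual_eq[OF lad_Aut(4)] by simp_all
qed (simp_all add: carrier_Aut)

lemma lgroup_Aut: "lgroup (Aut L)"
  using lpregroup_Aut by (simp add: lgroup_def)

lemma Aut_inv: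
  assumes h: "h \<in> carrier (Aut L)"
  shows "h \<otimes>\<^bsub>Aut L\<^esub> lad (Aut L) h = \<one>\<^bsub>Aut L\<^esub>" "lad (Aut L) h \<otimes>\<^bsub>Aut L\<^esub> h = \<one>\<^bsub>Aut L\<^esub>"
  using lad_Aut(1,2)[OF h] by (auto simp: compose_def fun_eq_iff simp del: Aut_sel(4,5))

lemma group_Aut: "group (Aut L)"
proof -
  interpret A: lpregroup "Aut L" by (rule lpregroup_Aut)
  show ?thesis by (rule A.group_l_invI) (use Aut_inv A.lad_closed in blast)
qed

lemma m_inv_Aut: "h \<in> carrier (Aut L) \<Longrightarrow> inv\<^bsub>Aut L\<^esub> h = lad (Aut L) h"
  using group.inv_equality[OF group_Aut Aut_inv(2) _ lad_Aut(5)] by blast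

lemma monotone_action_Aut: "monotone_action (Aut L) L (\<lambda>h j. h j)"
proof -
  have "carrier (Aut L) \<subseteq> Bij (carrier L)" by (auto simp: Aut_def)
  then have "(\<lambda>h. h) \<in> hom (Aut L) (BijGroup (carrier L))"
    by (auto simp: hom_def BijGroup_def subset_iff)
  then have "group_action (Aut L) (carrier L) (\<lambda>h. h)"
    by (simp add: group_action_def group_hom_def group_hom_axioms_def group_Aut group_BijGroup)
  moreover have "h j \<sqsubseteq> h' j'"
    if "h \<in> carrier (Aut L)" "h' \<in> carrier (Aut L)" "j \<in> carrier L" "j' \<in> carrier L"
      "leq (Aut L) h h'" "j \<sqsubseteq> j'" for h h' j j'
    using that le_trans[of "h j" "h j'" "h' j'"] Aut_closed by (auto simp: Aut_iff)
  ultimately show ?thesis by (auto simp: monotone_action_def)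
qed

end

lemma lex_product_Z_sel [simp]:
  "carrier (lex_product J Z_chain) = carrier J \<times> UNIV" "eq (lex_product J Z_chain) = (=)"
  "le (lex_product J Z_chain) (i, x) (j, y) \<longleftrightarrow> i \<noteq> j \<and> i \<sqsubseteq>\<^bsub>J\<^esub> j \<or> i = j \<and> x \<le> y"
  by (simp_all add: lex_product_def)

section \<open>Elements of the wreath product as maps on the lexicographic product\<close>

definition wreath_map :: "'j gorder \<Rightarrow> ('j \<Rightarrow> 'j) \<times> ('j \<Rightarrow> int \<Rightarrow> int) \<Rightarrow> 'j \<times> int \<Rightarrow> 'j \<times> int" where
  "wreath_map J w = (\<lambda>p\<in>carrier J \<times> UNIV. (fst w (fst p), snd w (fst p) (snd p)))"

abbreviation lex_shift :: "'j \<times> int \<Rightarrow> 'j \<times> int" where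
  "lex_shift \<equiv> map_prod id (\<lambda>k. k + 1)"

lemma lex_shift_funpow: "(lex_shift ^^ n) (j, k) = (j, k + int n)"
  by (induction n) auto

lemma Aut_wreath_sel [simp]:
  "carrier (Aut_wreath J N) = carrier (Aut J) \<times> (carrier J \<rightarrow>\<^sub>E carrier N)"
  "(h1, n1) \<otimes>\<^bsub>Aut_wreath J N\<^esub> (h2, n2) =
     (compose (carrier J) h1 h2, \<lambda>j\<in>carrier J. n1 (h2 j) \<otimes>\<^bsub>N\<^esub> n2 j)"
  "\<one>\<^bsub>Aut_wreath J N\<^esub> = (\<lambda>x\<in>carrier J. x, \<lambda>j\<in>carrier J. \<one>\<^bsub>N\<^esub>)"
  "leq (Aut_wreath J N) (h1, n1) (h2, n2) \<longleftrightarrow> (\<forall>j\<in>carrier J. h1 j \<sqsubseteq>\<^bsub>J\<^esub> h2 j) \<and>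
     (\<forall>j\<in>carrier J. h1 j = h2 j \<longrightarrow> leq N (n1 j) (n2 j))"
  "lad (Aut_wreath J N) (h, m) =
     (inv\<^bsub>Aut J\<^esub> h, \<lambda>j\<in>carrier J. lad N (m ((inv\<^bsub>Aut J\<^esub> h) j)))"
  "rad (Aut_wreath J N) (h, m) =
     (inv\<^bsub>Aut J\<^esub> h, \<lambda>j\<in>carrier J. rad N (m ((inv\<^bsub>Aut J\<^esub> h) j)))"
  by (simp_all add: Aut_wreath_def wreath_def)

abbreviation "FZ n \<equiv> Fn_lpg n Z_chain"

abbreviation "AW n J \<equiv> Aut_wreath J (FZ n)"

context chain
begin

lemma lex_product_Z_integral: "integral_chain (lex_product L Z_chain) lex_shift"
proof -
  have "total_order (lex_product L Z_chain)"
  proof (rule total_orderI_eq)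
    fix x y z
    assume xyz: "x \<in> carrier (lex_product L Z_chain)" "y \<in> carrier (lex_product L Z_chain)"
      "z \<in> carrier (lex_product L Z_chain)"
      "x \<sqsubseteq>\<^bsub>lex_product L Z_chain\<^esub> y" "y \<sqsubseteq>\<^bsub>lex_product L Z_chain\<^esub> z"
    show "x \<sqsubseteq>\<^bsub>lex_product L Z_chain\<^esub> z"
      using xyz le_trans[of "fst x" "fst y" "fst z"] antisym[of "fst x" "fst y"]
      by (cases x; cases y; cases z) auto
  next
    fix x y
    assume "x \<in> carrier (lex_product L Z_chain)" "y \<in> carrier (lex_product L Z_chain)"
    then show "x \<sqsubseteq>\<^bsub>lex_product L Z_chain\<^esub> y \<or> y \<sqsubseteq>\<^bsub>lex_product L Z_chain\<^esub> x"
      using total_order_total[of "fst x" "fst y"] by (cases x; cases y) auto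
  qed (auto intro: antisym)
  moreover have "bij_betw lex_shift (carrier L \<times> UNIV) (carrier L \<times> UNIV)"
    by (rule bij_betw_byWitness[of _ "map_prod id (\<lambda>k. k - 1)"]) auto
  moreover have "lex_shift x \<sqsubseteq>\<^bsub>lex_product L Z_chain\<^esub> y \<longleftrightarrow> \<not> y \<sqsubseteq>\<^bsub>lex_product L Z_chain\<^esub> x"
    if "x \<in> carrier L \<times> UNIV" "y \<in> carrier L \<times> UNIV" for x y
    using that antisym[of "fst x" "fst y"] not_le_imp_le[of "fst x" "fst y"] by (cases x; cases y) auto
  ultimately show ?thesis
    by (simp add: integral_chain_def integral_chain_axioms_def chain_def)
qed

interpretation lex: integral_chain "lex_product L Z_chain" lex_shift
  by (rule lex_product_Z_integral)

context
  fixes n :: nat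
  assumes n: "n \<ge> 1"
begin

lemma wreath_map_apply [simp]: "j \<in> carrier L \<Longrightarrow> wreath_map L (h, m) (j, k) = (h j, m j k)"
  by (simp add: wreath_map_def)

lemma AW_closed:
  assumes "w \<in> carrier (AW n L)"
  shows "lad (AW n L) w \<in> carrier (AW n L)" "rad (AW n L) w \<in> carrier (AW n L)"
proof -
  obtain h m where w: "w = (h, m)" "h \<in> carrier (Aut L)" "m \<in> carrier L \<rightarrow>\<^sub>E carrier (FZ n)"
    using assms by auto
  have "m (lad (Aut L) h j) \<in> carrier (FZ n)" if "j \<in> carrier L" for j
    using w that Aut_closed[OF lad_Aut(5)] by (blast intro: PiE_mem)
  then show "lad (AW n L) w \<in> carrier (AW n L)" "rad (AW n L) w \<in> carrier (AW n L)"
    using w lad_Aut(5)[OF w(2)] Z.Fn_lpg_residual(1,2) by (auto simp: m_inv_Aut simp del: Aut_sel)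
qed

lemma rad_lad_AW:
  assumes "w \<in> carrier (AW n L)"
  shows "rad (AW n L) (lad (AW n L) w) = w"
proof -
  obtain h m where w: "w = (h, m)" "h \<in> carrier (Aut L)" "m \<in> carrier L \<rightarrow>\<^sub>E carrier (FZ n)"
    using assms by auto
  let ?g = "lad (Aut L) h"
  have g: "?g \<in> carrier (Aut L)" by (rule lad_Aut(5)[OF w(2)])
  have "lad (Aut L) ?g = h"
  proof (rule PiE_ext)
    show "lad (Aut L) ?g \<in> carrier L \<rightarrow>\<^sub>E carrier L" "h \<in> carrier L \<rightarrow>\<^sub>E carrier L"
      using lad_Aut(5)[OF g] w(2) by (simp_all add: Aut_iff)
    fix x assume x: "x \<in> carrier L"
    show "lad (Aut L) ?g x = h x"
      using lad_Aut(2)[OF w(2) x] lad_Aut(2)[OF g Aut_closed[OF w(2) x]] by simp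
  qed
  moreover have "residual Z_chain (dual_residual Z_chain (m (?g (h x)))) = m x" if "x \<in> carrier L" for x
    using lad_Aut(2)[OF w(2) that] Z.residual_eq[OF Z.Fn_lpg_residual(4)[OF PiE_mem[OF w(3) that]]]
    by (simp del: Aut_sel)
  ultimately show ?thesis
    using w g Aut_closed[OF w(2)] by (auto simp: m_inv_Aut fun_eq_iff PiE_def extensional_def simp del: Aut_sel)
qed

text \<open>The integer coordinate matters only when \<open>h j = i\<close>, that is, when
  \<open>j\<close> is the preimage of \<open>i\<close>. Hence the fibre over \<open>i\<close> must
  carry the residual of the component at that preimage, which is the formula for \<open>rad\<close>
  in the wreath product.\<close>

lemma adjoint_pair_wreath_map:
  assumes "w \<in> carrier (AW n L)"
  shows "adjoint_pair (lex_product L Z_chain) (wreath_map L w) (wreath_map L (rad (AW n L) w))"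
proof -
  obtain h m where w: "w = (h, m)" "h \<in> carrier (Aut L)" "m \<in> carrier L \<rightarrow>\<^sub>E carrier (FZ n)"
    using assms by auto
  let ?g = "lad (Aut L) h"
  have g: "?g \<in> carrier (Aut L)" by (rule lad_Aut(5)[OF w(2)])
  have le: "h j \<sqsubseteq> i \<longleftrightarrow> j \<sqsubseteq> ?g i" if "i \<in> carrier L" "j \<in> carrier L" for i j
    using adjoint_pairD(5)[OF lad_Aut(3)[OF w(2)]] that by blast
  have eq: "h j = i \<longleftrightarrow> j = ?g i" if "i \<in> carrier L" "j \<in> carrier L" for i j
    using lad_Aut(1,2)[OF w(2)] that by metis
  have m: "m j k \<le> l \<longleftrightarrow> k \<le> residual Z_chain (m j) l" if "j \<in> carrier L" for j k l
    using adjoint_pairD(5)[OF Z.Fn_lpg_residual(3)[OF PiE_mem[OF w(3) that]]] by simp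
  have "wreath_map L w \<in> carrier L \<times> UNIV \<rightarrow>\<^sub>E carrier L \<times> UNIV"
    "wreath_map L (rad (AW n L) w) \<in> carrier L \<times> UNIV \<rightarrow>\<^sub>E carrier L \<times> UNIV"
    using w g by (auto simp: wreath_map_def Aut_closed m_inv_Aut simp del: Aut_sel)
  moreover have "(h j, m j k) \<sqsubseteq>\<^bsub>lex_product L Z_chain\<^esub> (i, l) \<longleftrightarrow>
     (j, k) \<sqsubseteq>\<^bsub>lex_product L Z_chain\<^esub> (?g i, residual Z_chain (m (?g i)) l)"
    if "i \<in> carrier L" "j \<in> carrier L" for i j k l
    using le[OF that] eq[OF that] m[of j k l] that by (cases "h j = i") (auto simp del: Aut_sel)
  ultimately show ?thesis
    using w by (auto simp: adjoint_pair_def m_inv_Aut simp del: Aut_sel lex_product_Z_sel(3))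
qed

lemma wreath_map_in_Fn_lpg:
  assumes "w \<in> carrier (AW n L)"
  shows "wreath_map L w \<in> carrier (Fn_lpg n (lex_product L Z_chain))"
proof (rule lex.Fn_lpgI[of _ "wreath_map L ` carrier (AW n L)"])
  fix f assume "f \<in> wreath_map L ` carrier (AW n L)"
  then obtain w where f: "f = wreath_map L w" and w: "w \<in> carrier (AW n L)" by blast
  show "\<exists>g\<in>wreath_map L ` carrier (AW n L). adjoint_pair (lex_product L Z_chain) f g"
    using adjoint_pair_wreath_map[OF w] AW_closed[OF w] f by blast
  show "\<exists>g\<in>wreath_map L ` carrier (AW n L). adjoint_pair (lex_product L Z_chain) g f"
    using adjoint_pair_wreath_map[OF AW_closed(1)[OF w]] AW_closed(1)[OF w]
    unfolding f rad_lad_AW[OF w] by blast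
  fix x :: "'a \<times> int" assume "x \<in> carrier (lex_product L Z_chain)"
  then obtain j k where x: "x = (j, k)" "j \<in> carrier L" by auto
  obtain h m where hm: "w = (h, m)" "m \<in> carrier L \<rightarrow>\<^sub>E carrier (FZ n)" using w by auto
  have "m j \<in> carrier (FZ n)" using PiE_mem[OF hm(2) x(2)] .
  then have "m j (k + int n) = m j k + int n" using n by (simp add: Fn_Z_iff periodic_mono_def)
  then show "f ((lex_shift ^^ n) x) = (lex_shift ^^ n) (f x)"
    using x f hm by (simp add: lex_shift_funpow)
next
  show "wreath_map L ` carrier (AW n L) \<subseteq>
      carrier (lex_product L Z_chain) \<rightarrow>\<^sub>E carrier (lex_product L Z_chain)"
    using adjoint_pairD(1)[OF adjoint_pair_wreath_map] by blast
qed (rule imageI[OF assms])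

lemma inj_on_wreath_map: "inj_on (wreath_map L) (carrier (AW n L))"
proof (rule inj_onI)
  fix w w' assume *: "w \<in> carrier (AW n L)" "w' \<in> carrier (AW n L)" and eq: "wreath_map L w = wreath_map L w'"
  obtain h m h' m' where w: "w = (h, m)" "w' = (h', m')" by (cases w; cases w')
  have "h j = h' j" "m j k = m' j k" if "j \<in> carrier L" for j k
    using fun_cong[OF eq, of "(j, k)"] that w by simp_all
  then have "h = h'" "m = m'"
    using * w by (auto simp: Aut_iff intro!: PiE_ext[of h "carrier L" _ h'] PiE_ext[of m "carrier L" _ m'])
  then show "w = w'" by (simp add: w)
qed

text \<open>Shifting by \<open>n\<close> leaves the first coordinate of the value unchanged, and
  that coordinate is monotone in \<open>k\<close>; any two points of a fibre are caught between
  shifts of each other.\<close>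

lemma fst_Fn_lpg_lex:
  assumes f: "f \<in> carrier (Fn_lpg n (lex_product L Z_chain))" and j: "j \<in> carrier L"
  shows "fst (f (j, k)) = fst (f (j, 0))"
proof -
  let ?\<Omega> = "lex_product L Z_chain"
  have cl: "f (i, l) \<in> carrier L \<times> UNIV" if "i \<in> carrier L" for i l
    using lex.Fn_lpg_maps[OF f] that by auto
  have step: "fst (f (j, l + int n)) = fst (f (j, l))" for l
    using lex.Fn_lpg_commute[OF f, of "(j, l)"] j by (cases "f (j, l)") (simp add: lex_shift_funpow)
  then have steps: "fst (f (j, l + int n * int m)) = fst (f (j, l))" for l m
  proof (induction m)
    case (Suc m)
    then show ?case using step[of "l + int n * int m"] by (simp add: algebra_simps)
  qed simp
  have mono: "fst (f (j, l)) \<sqsubseteq> fst (f (j, l'))" if "l \<le> l'" for l l'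
    using lex.Fn_lpg_mono[OF f, of "(j, l)" "(j, l')"] j that cl[of j l] cl[of j l']
    by (cases "f (j, l)"; cases "f (j, l')") auto
  have "int n * int (nat \<bar>k\<bar>) \<ge> \<bar>k\<bar>" using n by (simp add: mult_le_cancel_right1)
  then have "0 \<le> k + int n * int (nat \<bar>k\<bar>)" "k \<le> 0 + int n * int (nat \<bar>k\<bar>)" by linarith+
  then have "fst (f (j, 0)) \<sqsubseteq> fst (f (j, k))" "fst (f (j, k)) \<sqsubseteq> fst (f (j, 0))"
    using mono steps by metis+
  then show ?thesis using cl[OF j] by (intro antisym) (auto simp: mem_Times_iff)
qed

lemma Fn_lpg_lex_eq_wreath_map:
  assumes f: "f \<in> carrier (Fn_lpg n (lex_product L Z_chain))"
  shows "f \<in> wreath_map L ` carrier (AW n L)"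
proof -
  let ?\<Omega> = "lex_product L Z_chain"
  define fib where "fib f = (\<lambda>j\<in>carrier L. fst (f (j, 0::int)))" for f :: "'a \<times> int \<Rightarrow> 'a \<times> int"
  define h where "h = fib f"
  define m where "m = (\<lambda>j\<in>carrier L. \<lambda>k. snd (f (j, k)))"
  define g where "g = residual ?\<Omega> f"
  define h' where "h' = fib g"
  have g: "g \<in> carrier (Fn_lpg n ?\<Omega>)" and adj: "adjoint_pair ?\<Omega> f g"
    using lex.Fn_lpg_residual[OF f] by (simp_all add: g_def)
  have f_eq: "f (j, k) = (h j, m j k)" if "j \<in> carrier L" for j k
    using fst_Fn_lpg_lex[OF f that, of k] that by (simp add: h_def m_def fib_def prod_eq_iff)
  have g_eq: "g (j, k) = (h' j, snd (g (j, k)))" if "j \<in> carrier L" for j k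
    using fst_Fn_lpg_lex[OF g that, of k] that by (simp add: h'_def fib_def prod_eq_iff)
  have h: "h j \<in> carrier L" "h' j \<in> carrier L" if "j \<in> carrier L" for j
    using lex.Fn_lpg_maps[OF f] lex.Fn_lpg_maps[OF g] that
    by (auto simp: h_def h'_def fib_def PiE_def Pi_def mem_Times_iff)
  have mper: "periodic_mono n (m j)" if "j \<in> carrier L" for j
    unfolding periodic_mono_def
  proof (intro conjI monoI allI)
    fix k l :: int assume "k \<le> l"
    then show "m j k \<le> m j l"
      using lex.Fn_lpg_mono[OF f, of "(j, k)" "(j, l)"] that by (simp add: f_eq)
  next
    fix k show "m j (k + int n) = m j k + int n"
      using lex.Fn_lpg_commute[OF f, of "(j, k)"] that by (simp add: lex_shift_funpow f_eq)
  qed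
  \<comment> \<open>varying \<open>k\<close> and \<open>l\<close> here shows that \<open>h'\<close> is inverse to \<open>h\<close>\<close>
  have gal: "h j \<noteq> i \<and> h j \<sqsubseteq> i \<or> h j = i \<and> m j k \<le> l \<longleftrightarrow>
      j \<noteq> h' i \<and> j \<sqsubseteq> h' i \<or> j = h' i \<and> k \<le> snd (g (i, l))"
    if "i \<in> carrier L" "j \<in> carrier L" for i j k l
    using adjoint_pairD(5)[OF adj, of "(j, k)" "(i, l)"] that f_eq[of j k] g_eq[of i l]
    by (metis lex_product_Z_sel(1,3) SigmaI UNIV_I)
  have eq: "h j = i \<longleftrightarrow> j = h' i" if ij: "i \<in> carrier L" "j \<in> carrier L" for i j
  proof
    assume *: "h j = i"
    \<comment> \<open>The left side of \<open>gal\<close> holds for l = \<open>m j 0\<close> and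
      fails for l = \<open>m j 0 - 1\<close>, whereas the right side would not depend on
      \<open>l\<close> if \<open>j\<close> differed from \<open>h' i\<close>.\<close>
    show "j = h' i"
      using gal[OF ij, of 0 "m j 0"] gal[OF ij, of 0 "m j 0 - 1"] * by auto
  next
    assume *: "j = h' i"
    \<comment> \<open>The same argument with \<open>k\<close> varied at the threshold
      \<open>snd (g (i, 0))\<close>.\<close>
    show "h j = i"
      using gal[OF ij, of "snd (g (i, 0))" 0] gal[OF ij, of "snd (g (i, 0)) + 1" 0] * by auto
  qed
  have le: "h j \<sqsubseteq> i \<longleftrightarrow> j \<sqsubseteq> h' i" if "i \<in> carrier L" "j \<in> carrier L" for i j
    using gal[OF that] eq[OF that] le_refl that h by metis
  have "h \<in> carrier (Aut L)" unfolding Aut_iff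
  proof (intro conjI ballI)
    show "h \<in> carrier L \<rightarrow>\<^sub>E carrier L" using h by (auto simp: h_def fib_def)
    show "bij_betw h (carrier L) (carrier L)"
    proof (rule bij_betw_byWitness[of _ h'])
      show "\<forall>j\<in>carrier L. h' (h j) = j" using eq[OF h(1)] by metis
      show "\<forall>j\<in>carrier L. h (h' j) = j" using eq h(2) by metis
    qed (use h in auto)
    fix x y assume xy: "x \<in> carrier L" "y \<in> carrier L"
    show "h x \<sqsubseteq> h y \<longleftrightarrow> x \<sqsubseteq> y" using le[of "h y" x] eq[of "h y" y] xy h by simp
  qed
  moreover have "m \<in> carrier L \<rightarrow>\<^sub>E carrier (FZ n)"
    using mper n by (auto simp: Fn_Z_iff m_def)
  moreover have "f = wreath_map L (h, m)"
  proof (rule PiE_ext)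
    show "f \<in> carrier ?\<Omega> \<rightarrow>\<^sub>E carrier ?\<Omega>" by (rule lex.Fn_lpg_maps[OF f])
    show "wreath_map L (h, m) \<in> carrier ?\<Omega> \<rightarrow>\<^sub>E carrier ?\<Omega>"
      using h by (auto simp: wreath_map_def)
    fix x assume "x \<in> carrier ?\<Omega>"
    then show "f x = wreath_map L (h, m) x" by (cases x) (simp add: f_eq)
  qed
  ultimately show ?thesis by auto
qed

theorem Fn_lpg_lex_isomorphic: "lpg_isomorphic (Fn_lpg n (lex_product L Z_chain)) (AW n L)"
proof (rule lpg_isomorphic_transport[where \<psi> = "wreath_map L"])
  let ?\<Omega> = "lex_product L Z_chain"
  show "lpregroup (Fn_lpg n ?\<Omega>)" by (rule lex.lpregroup_Fn_lpg)
  show "bij_betw (wreath_map L) (carrier (AW n L)) (carrier (Fn_lpg n ?\<Omega>))"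
    using inj_on_wreath_map wreath_map_in_Fn_lpg Fn_lpg_lex_eq_wreath_map
    by (auto simp: bij_betw_def)
  interpret AL: lpregroup "Aut L" by (rule lpregroup_Aut)
  interpret FZL: lpregroup "FZ n" by (rule Z.lpregroup_Fn_lpg)
  show "\<one>\<^bsub>(AW n L)\<^esub> \<in> carrier (AW n L)" using AL.one_closed FZL.one_closed by simp
  show "wreath_map L \<one>\<^bsub>(AW n L)\<^esub> = \<one>\<^bsub>Fn_lpg n ?\<Omega>\<^esub>"
    by (auto simp: wreath_map_def fun_eq_iff)
  fix x y assume x: "x \<in> carrier (AW n L)" and y: "y \<in> carrier (AW n L)"
  obtain h m h' m' where xy: "x = (h, m)" "y = (h', m')" by (cases x; cases y)
  have c: "h \<in> carrier (Aut L)" "h' \<in> carrier (Aut L)" "\<And>j. j \<in> carrier L \<Longrightarrow> m j \<in> carrier (FZ n)"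
    "\<And>j. j \<in> carrier L \<Longrightarrow> m' j \<in> carrier (FZ n)"
    using x y xy by auto
  show "x \<otimes>\<^bsub>(AW n L)\<^esub> y \<in> carrier (AW n L) \<and> wreath_map L (x \<otimes>\<^bsub>(AW n L)\<^esub> y) = wreath_map L x \<otimes>\<^bsub>Fn_lpg n ?\<Omega>\<^esub> wreath_map L y"
    using xy c AL.m_closed[of h h'] FZL.m_closed Aut_closed[of h']
    by (auto simp: wreath_map_def compose_def fun_eq_iff)
  show "leq (AW n L) x y \<longleftrightarrow> leq (Fn_lpg n ?\<Omega>) (wreath_map L x) (wreath_map L y)"
  proof -
    \<comment> \<open>A strict inequality in the base decides the lexicographic comparison on the
      whole fibre; only ties look at the integer components, as in the wreath order.\<close>
    have "h j \<sqsubseteq> h' j \<and> (h j = h' j \<longrightarrow> (\<forall>k. m j k \<le> m' j k)) \<longleftrightarrow>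
        (\<forall>k. (h j, m j k) \<sqsubseteq>\<^bsub>?\<Omega>\<^esub> (h' j, m' j k))" if "j \<in> carrier L" for j
      using Aut_closed[OF c(2) that] by (cases "h j = h' j") (auto simp: le_refl)
    then show ?thesis using xy by (auto simp del: lex_product_Z_sel(3))
  qed
  show "lad (AW n L) x \<in> carrier (AW n L) \<and> wreath_map L (lad (AW n L) x) = lad (Fn_lpg n ?\<Omega>) (wreath_map L x)"
    using lex.dual_residual_eq[OF adjoint_pair_wreath_map[OF AW_closed(1)[OF x]]] rad_lad_AW[OF x] AW_closed[OF x]
    by simp
  show "rad (AW n L) x \<in> carrier (AW n L) \<and> wreath_map L (rad (AW n L) x) = rad (Fn_lpg n ?\<Omega>) (wreath_map L x)"
    using lex.residual_eq[OF adjoint_pair_wreath_map[OF x]] AW_closed[OF x] by simp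
qed

end
end

section \<open>Simplicity\<close>

lemma Z_max_map [simp]: "Z.max_map f g = (\<lambda>x. max (f x) (g x))"
  by (auto simp: Z.max_map_def max_def)

lemma Z_min_map [simp]: "Z.min_map f g = (\<lambda>x. min (f x) (g x))"
  by (auto simp: Z.min_map_def min_def)

lemma periodic_mono_translation [simp]: "periodic_mono n (\<lambda>x. x + c)"
  by (auto simp: periodic_mono_def mono_def)

text \<open>\<open>x\<close> lies between consecutive multiples of \<open>n\<close>, where the
  displacement of \<open>f\<close> is exactly \<open>f 0\<close>; rounding costs at most
  \<open>n\<close>.\<close>

lemma periodic_mono_translation_bound:
  assumes f: "periodic_mono n f" and n: "n \<ge> 1"
  obtains c where "\<And>x. x - c \<le> f x" "\<And>x. f x \<le> x + c"
proof (rule that[of "\<bar>f 0\<bar> + int n"])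
  fix x
  define k where "k = x div int n"
  have k: "int n * k \<le> x" "x \<le> int n * (k + 1)" "int n * (k + 1) = int n * k + int n"
    using n pos_mod_bound[of "int n" x] pos_mod_sign[of "int n" x] mult_div_mod_eq[of "int n" x]
    unfolding k_def[symmetric] distrib_left by linarith+
  have "mono f" using f by (simp add: periodic_mono_def)
  then have "f (0 + int n * k) \<le> f x" "f x \<le> f (0 + int n * (k + 1))"
    unfolding add_0 using k(1,2) by (blast dest: monoD)+
  then show "x - (\<bar>f 0\<bar> + int n) \<le> f x" "f x \<le> x + (\<bar>f 0\<bar> + int n)"
    unfolding periodic_mono_mult[OF f] using k by linarith+
qed

lemma lpg_congruence_Id_on:
  assumes "lpregroup A"
  shows "lpg_congruence A (Id_on (carrier A))"
proof -
  interpret lpregroup A by fact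
  have "equiv (carrier A) (Id_on (carrier A))"
    by (auto simp: equiv_def refl_on_def sym_def trans_def)
  then show ?thesis by (auto simp: lpg_congruence_def)
qed

lemma lpg_congruence_full:
  assumes "lpregroup A"
  shows "lpg_congruence A (carrier A \<times> carrier A)"
proof -
  interpret lpregroup A by fact
  have "equiv (carrier A) (carrier A \<times> carrier A)"
    by (auto simp: equiv_def refl_on_def sym_def trans_def)
  then show ?thesis by (auto simp: lpg_congruence_def)
qed

lemma lpg_congruenceD:
  assumes "lpg_congruence A \<theta>"
  shows "(x, y) \<in> \<theta> \<Longrightarrow> x \<in> carrier A" "(x, y) \<in> \<theta> \<Longrightarrow> y \<in> carrier A" "x \<in> carrier A \<Longrightarrow> (x, x) \<in> \<theta>"
    "(x, y) \<in> \<theta> \<Longrightarrow> (y, x) \<in> \<theta>" "(x, y) \<in> \<theta> \<Longrightarrow> (y, z) \<in> \<theta> \<Longrightarrow> (x, z) \<in> \<theta>"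
    "(x, y) \<in> \<theta> \<Longrightarrow> (x', y') \<in> \<theta> \<Longrightarrow> (x \<otimes>\<^bsub>A\<^esub> x', y \<otimes>\<^bsub>A\<^esub> y') \<in> \<theta>"
    "(x, y) \<in> \<theta> \<Longrightarrow> (x', y') \<in> \<theta> \<Longrightarrow> (x \<sqinter>\<^bsub>lat A\<^esub> x', y \<sqinter>\<^bsub>lat A\<^esub> y') \<in> \<theta>"
    "(x, y) \<in> \<theta> \<Longrightarrow> (x', y') \<in> \<theta> \<Longrightarrow> (x \<squnion>\<^bsub>lat A\<^esub> x', y \<squnion>\<^bsub>lat A\<^esub> y') \<in> \<theta>"
proof -
  have e: "equiv (carrier A) \<theta>" using assms by (simp add: lpg_congruence_def)
  show "(x, y) \<in> \<theta> \<Longrightarrow> x \<in> carrier A" "(x, y) \<in> \<theta> \<Longrightarrow> y \<in> carrier A"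
    using equiv_type[OF e] by auto
  show "x \<in> carrier A \<Longrightarrow> (x, x) \<in> \<theta>" using e by (auto simp: equiv_def refl_on_def)
  show "(x, y) \<in> \<theta> \<Longrightarrow> (y, x) \<in> \<theta>" using e by (auto simp: equiv_def sym_def)
  show "(x, y) \<in> \<theta> \<Longrightarrow> (y, z) \<in> \<theta> \<Longrightarrow> (x, z) \<in> \<theta>" using e by (meson equiv_def transD)
  show "(x, y) \<in> \<theta> \<Longrightarrow> (x', y') \<in> \<theta> \<Longrightarrow> (x \<otimes>\<^bsub>A\<^esub> x', y \<otimes>\<^bsub>A\<^esub> y') \<in> \<theta>"
    "(x, y) \<in> \<theta> \<Longrightarrow> (x', y') \<in> \<theta> \<Longrightarrow> (x \<sqinter>\<^bsub>lat A\<^esub> x', y \<sqinter>\<^bsub>lat A\<^esub> y') \<in> \<theta>"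
    "(x, y) \<in> \<theta> \<Longrightarrow> (x', y') \<in> \<theta> \<Longrightarrow> (x \<squnion>\<^bsub>lat A\<^esub> x', y \<squnion>\<^bsub>lat A\<^esub> y') \<in> \<theta>"
    using assms by (auto simp: lpg_congruence_def)
qed

text \<open>One strict inequality at a point is amplified by composition on both sides until the
  identity is congruent to the translation by 1. Then all translations are congruent to it, and
  every map lies between two translations.\<close>

lemma Fn_Z_congruence_full:
  assumes n: "n \<ge> 1" and cong: "lpg_congruence (FZ n) \<theta>" and fg: "(f, g) \<in> \<theta>" "f \<noteq> g"
  shows "\<theta> = carrier (FZ n) \<times> carrier (FZ n)"
proof -
  note cl = lpg_congruenceD(1,2)[OF cong] and refl = lpg_congruenceD(3)[OF cong]
    and sym = lpg_congruenceD(4)[OF cong] and trans = lpg_congruenceD(5)[OF cong]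
  note mem = Fn_Z_iff[OF n]
  have mult: "(\<lambda>x. f (f' x), \<lambda>x. g (g' x)) \<in> \<theta>" if "(f, g) \<in> \<theta>" "(f', g') \<in> \<theta>" for f g f' g'
    using lpg_congruenceD(6)[OF cong that] by (simp add: compose_def restrict_UNIV)
  have join: "(\<lambda>x. max (f x) (f' x), \<lambda>x. max (g x) (g' x)) \<in> \<theta>"
    if "(f, g) \<in> \<theta>" "(f', g') \<in> \<theta>" for f g f' g'
    using lpg_congruenceD(8)[OF cong that] cl that by (simp add: Z.Fn_lpg_join)
  have meet: "(\<lambda>x. min (f x) (f' x), \<lambda>x. min (g x) (g' x)) \<in> \<theta>"
    if "(f, g) \<in> \<theta>" "(f', g') \<in> \<theta>" for f g f' g'
    using lpg_congruenceD(7)[OF cong that] cl that by (simp add: Z.Fn_lpg_join)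
  define p q where "p = (\<lambda>x. min (f x) (g x))" and "q = (\<lambda>x. max (f x) (g x))"
  have gg: "(g, g) \<in> \<theta>" using refl cl(2)[OF fg(1)] by blast
  have "(p, g) \<in> \<theta>" "(q, g) \<in> \<theta>"
    using meet[OF fg(1) gg] join[OF fg(1) gg] by (simp_all add: p_def q_def)
  then have pq: "(p, q) \<in> \<theta>" by (rule trans[OF _ sym])
  obtain a where a: "p a < q a"
    using fg(2) by (auto simp: p_def q_def fun_eq_iff min_def max_def) (metis linorder_not_le order_le_less)
  have pper: "p (x + int n * k) = p x + int n * k" and qper: "q (x + int n * k) = q x + int n * k" for x k
    using cl[OF pq] by (simp_all add: mem periodic_mono_mult)
  \<comment> \<open>\<open>v\<close> and \<open>u\<close> round down and up, so that \<open>u p v \<le> 1\<close> while \<open>u q v\<close> moves every point up\<close>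
  define v where "v = (\<lambda>x. a + int n * (x div int n))"
  define u where "u = (\<lambda>y. - (int n * ((p a - y) div int n)))"
  have div: "(x + int n) div int n = x div int n + 1" for x
    using n by (subst div_add_self2) simp_all
  have v: "periodic_mono n v" using n
    by (auto simp: periodic_mono_def mono_def v_def zdiv_mono1 div distrib_left)
  have u: "periodic_mono n u"
  proof -
    have "(p a - (x + int n)) div int n = (p a - x) div int n - 1" for x
      using div[of "p a - (x + int n)"] by simp
    then show ?thesis using n by (auto simp: periodic_mono_def mono_def u_def zdiv_mono1 right_diff_distrib)
  qed
  have upv: "(\<lambda>x. u (p (v x)), \<lambda>x. u (q (v x))) \<in> \<theta>"
    using mult[OF refl[of u] mult[OF pq refl[of v]]] u v by (simp add: mem)
  have low: "u (p (v x)) \<le> x" for x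
  proof -
    have "u (p (v x)) = int n * (x div int n)" using n by (simp add: u_def v_def pper)
    then show ?thesis using n pos_mod_sign[of "int n" x] mult_div_mod_eq[of "int n" x] by linarith
  qed
  \<comment> \<open>\<open>u\<close> is n times the ceiling of (y - p a) / n, so it sends
    \<open>p a\<close> to 0 but \<open>p a + 1\<close> already to n: exceeding \<open>p\<close> by
    one unit gains a whole period.\<close>
  have high: "x + 1 \<le> u (q (v x))" for x
  proof -
    have "p a + int n * (x div int n) + 1 \<le> q (v x)" using a by (simp add: v_def qper)
    then have "u (p a + int n * (x div int n) + 1) \<le> u (q (v x))"
      using u by (auto simp: periodic_mono_def mono_def)
    moreover have div1: "(- 1 - int n * (x div int n)) div int n = - 1 - x div int n"
      by (rule int_div_pos_eq[where r = "int n - 1"]) (use n in \<open>simp_all add: algebra_simps\<close>)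
    have "p a - (p a + int n * (x div int n) + 1) = - 1 - int n * (x div int n)" by simp
    then have "u (p a + int n * (x div int n) + 1) = int n * (x div int n) + int n"
      unfolding u_def using div1 by (simp only:) (simp add: right_diff_distrib)
    moreover have "x + 1 \<le> int n * (x div int n) + int n"
      using n pos_mod_bound[of "int n" x] mult_div_mod_eq[of "int n" x] by linarith
    ultimately show ?thesis by linarith
  qed
  have tr: "(\<lambda>x. x + c) \<in> carrier (FZ n)" for c by (simp add: mem)
  have id: "(\<lambda>x. x) \<in> carrier (FZ n)" using tr[of 0] by simp
  \<comment> \<open>Joining with the identity and then meeting with the translation by 1 cuts the
    congruent pair down to exactly these two maps.\<close>
  have "(\<lambda>x. x, \<lambda>x. max (u (q (v x))) x) \<in> \<theta>"
    using join[OF upv refl[OF id]] low by (simp add: max_def)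
  note meet[OF this refl[OF tr[of 1]]]
  moreover have "min x (x + 1) = x" "min (max (u (q (v x))) x) (x + 1) = x + 1" for x
    using high[of x] by auto
  ultimately have one: "(\<lambda>x. x, \<lambda>x. x + 1) \<in> \<theta>" by simp
  have pos: "(\<lambda>x. x, \<lambda>x. x + int k) \<in> \<theta>" for k
  proof (induction k)
    case (Suc k)
    have "(\<lambda>x. x + int k, \<lambda>x. x + int k + 1) \<in> \<theta>"
      using mult[OF one refl[OF tr[of "int k"]]] by simp
    from trans[OF Suc this] show ?case by (simp add: ac_simps)
  qed (simp add: refl id)
  have neg: "(\<lambda>x. x - int k, \<lambda>x. x) \<in> \<theta>" for k
    using mult[OF refl[OF tr[of "- int k"]] pos[of k]] by simp
  have "(\<lambda>x. x, h) \<in> \<theta>" if h: "h \<in> carrier (FZ n)" for h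
  proof -
    obtain c where c: "\<And>x. x - c \<le> h x" "\<And>x. h x \<le> x + c"
      using periodic_mono_translation_bound[OF _ n] h mem by blast
    define k where "k = nat \<bar>c\<bar>"
    have k: "x - int k \<le> h x" "h x \<le> x + int k" for x
      using c(1)[of x] c(2)[of x] by (auto simp: k_def)
    \<comment> \<open>Congruence classes are convex: joining this pair with \<open>h\<close> turns
      the lower translation into \<open>h\<close> and leaves the upper one.\<close>
    have "(\<lambda>x. x - int k, \<lambda>x. x + int k) \<in> \<theta>" using trans[OF neg pos] .
    from join[OF this refl[OF h]] have "(h, \<lambda>x. x + int k) \<in> \<theta>"
      using k by (simp add: max_absorb1 max_absorb2)
    then show ?thesis using pos[of k] sym trans by blast
  qed
  then have "(f, g) \<in> \<theta>" if "f \<in> carrier (FZ n)" "g \<in> carrier (FZ n)" for f g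
    using trans[OF sym] that by blast
  moreover have "\<theta> \<subseteq> carrier (FZ n) \<times> carrier (FZ n)"
    by (rule subrelI) (use cl in blast)
  ultimately show ?thesis by blast
qed

lemma lpg_simple_Fn_Z:
  assumes n: "n \<ge> 1"
  shows "lpg_simple (FZ n)"
proof -
  have L: "lpregroup (FZ n)" by (rule Z.lpregroup_Fn_lpg)
  have "(\<lambda>x. x + 0) \<in> carrier (FZ n)" "(\<lambda>x. x + 1) \<in> carrier (FZ n)"
    unfolding Fn_Z_iff[OF n] by (rule periodic_mono_translation)+
  moreover have "(\<lambda>x::int. x + 0) \<noteq> (\<lambda>x. x + 1)" by (auto simp: fun_eq_iff)
  ultimately have ne: "Id_on (carrier (FZ n)) \<noteq> carrier (FZ n) \<times> carrier (FZ n)" by blast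
  have "\<theta> = Id_on (carrier (FZ n)) \<or> \<theta> = carrier (FZ n) \<times> carrier (FZ n)"
    if cong: "lpg_congruence (FZ n) \<theta>" for \<theta>
  proof (cases "\<exists>f g. (f, g) \<in> \<theta> \<and> f \<noteq> g")
    case True
    then show ?thesis using Fn_Z_congruence_full[OF n cong] by blast
  next
    case False
    then show ?thesis using lpg_congruenceD(1,3)[OF cong] by auto
  qed
  then show ?thesis
    unfolding lpg_simple_def using ne lpg_congruence_Id_on[OF L] lpg_congruence_full[OF L] by blast
qed

section \<open>Actions on chains\<close>

text \<open>Indexed like \<open>adjoint_seq\<close>: right adjoints upwards, left adjoints
  downwards.\<close>

definition (in lpregroup) iter :: "int \<Rightarrow> 'a \<Rightarrow> 'a" where
  "iter i x = (if i \<ge> 0 then (rad A ^^ nat i) x else (lad A ^^ nat (- i)) x)"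

context lpregroup
begin

lemma iter_closed [simp]: "x \<in> carrier A \<Longrightarrow> iter i x \<in> carrier A"
  by (simp add: iter_def)

lemma iter_0 [simp]: "iter 0 x = x"
  by (simp add: iter_def)

lemma rad_iter: "x \<in> carrier A \<Longrightarrow> rad A (iter i x) = iter (i + 1) x"
proof (cases "i \<ge> 0")
  case True
  then have "nat (i + 1) = Suc (nat i)" by simp
  with True show ?thesis by (simp add: iter_def)
next
  case False
  assume x: "x \<in> carrier A"
  have "nat (- i) = Suc (nat (- (i + 1)))" using False by simp
  then have "rad A (iter i x) = (lad A ^^ nat (- (i + 1))) x" using False x by (simp add: iter_def)
  then show ?thesis using False by (cases "i = - 1") (auto simp: iter_def)
qed

lemma lad_iter: "x \<in> carrier A \<Longrightarrow> lad A (iter i x) = iter (i - 1) x"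
  using rad_iter[of x "i - 1"] lad_rad[of "iter (i - 1) x"] by simp

end

text \<open>As points are linearly ordered, monotonicity in the element together with the two
  alternatives says that joins and meets act as pointwise maxima and minima.\<close>

locale chain_action = A: lpregroup A + C: chain C
  for A :: "('a, 'm) lpg_scheme" and C :: "'c gorder" +
  fixes act :: "'a \<Rightarrow> 'c \<Rightarrow> 'c"
  assumes act_closed: "\<lbrakk>x \<in> carrier A; p \<in> carrier C\<rbrakk> \<Longrightarrow> act x p \<in> carrier C"
    and act_mult: "\<lbrakk>x \<in> carrier A; y \<in> carrier A; p \<in> carrier C\<rbrakk> \<Longrightarrow> act (x \<otimes>\<^bsub>A\<^esub> y) p = act x (act y p)"
    and act_one: "p \<in> carrier C \<Longrightarrow> act \<one>\<^bsub>A\<^esub> p = p"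
    and act_mono: "\<lbrakk>x \<in> carrier A; p \<in> carrier C; q \<in> carrier C; p \<sqsubseteq>\<^bsub>C\<^esub> q\<rbrakk> \<Longrightarrow> act x p \<sqsubseteq>\<^bsub>C\<^esub> act x q"
    and act_leq: "\<lbrakk>x \<in> carrier A; y \<in> carrier A; p \<in> carrier C; leq A x y\<rbrakk> \<Longrightarrow> act x p \<sqsubseteq>\<^bsub>C\<^esub> act y p"
    and act_join: "\<lbrakk>x \<in> carrier A; y \<in> carrier A; p \<in> carrier C\<rbrakk> \<Longrightarrow>
      act (x \<squnion>\<^bsub>lat A\<^esub> y) p = act x p \<or> act (x \<squnion>\<^bsub>lat A\<^esub> y) p = act y p"
    and act_meet: "\<lbrakk>x \<in> carrier A; y \<in> carrier A; p \<in> carrier C\<rbrakk> \<Longrightarrow>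
      act (x \<sqinter>\<^bsub>lat A\<^esub> y) p = act x p \<or> act (x \<sqinter>\<^bsub>lat A\<^esub> y) p = act y p"
begin

declare act_closed [simp]

abbreviation le_C (infix \<open>\<sqsubseteq>\<^sub>C\<close> 50) where "p \<sqsubseteq>\<^sub>C q \<equiv> p \<sqsubseteq>\<^bsub>C\<^esub> q"

lemma act_units:
  assumes "x \<in> carrier A" "p \<in> carrier C"
  shows "p \<sqsubseteq>\<^sub>C act (rad A x) (act x p)" "act x (act (rad A x) p) \<sqsubseteq>\<^sub>C p"
    "p \<sqsubseteq>\<^sub>C act x (act (lad A x) p)" "act (lad A x) (act x p) \<sqsubseteq>\<^sub>C p"
  using assms act_leq[OF _ _ _ A.rad_mult[of x], of p] act_leq[OF _ _ _ A.mult_rad[of x], of p]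
    act_leq[OF _ _ _ A.mult_lad[of x], of p] act_leq[OF _ _ _ A.lad_mult[of x], of p]
  by (simp_all add: act_mult act_one)

lemma act_le_iff_rad:
  assumes "x \<in> carrier A" "p \<in> carrier C" "q \<in> carrier C"
  shows "act x p \<sqsubseteq>\<^sub>C q \<longleftrightarrow> p \<sqsubseteq>\<^sub>C act (rad A x) q"
proof
  assume "act x p \<sqsubseteq>\<^sub>C q"
  then have "act (rad A x) (act x p) \<sqsubseteq>\<^sub>C act (rad A x) q" using assms by (simp add: act_mono)
  then show "p \<sqsubseteq>\<^sub>C act (rad A x) q"
    using C.le_trans[OF act_units(1)[OF assms(1,2)]] assms by simp
next
  assume "p \<sqsubseteq>\<^sub>C act (rad A x) q"
  then have "act x p \<sqsubseteq>\<^sub>C act x (act (rad A x) q)" using assms by (simp add: act_mono)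
  then show "act x p \<sqsubseteq>\<^sub>C q"
    using C.le_trans[OF _ act_units(2)[OF assms(1,3)]] assms by simp
qed

lemma act_lad_le_iff:
  assumes "x \<in> carrier A" "p \<in> carrier C" "q \<in> carrier C"
  shows "act (lad A x) p \<sqsubseteq>\<^sub>C q \<longleftrightarrow> p \<sqsubseteq>\<^sub>C act x q"
  using act_le_iff_rad[of "lad A x" p q] assms by simp

lemma adjoint_pair_act:
  assumes "x \<in> carrier A"
  shows "adjoint_pair C (restrict (act x) (carrier C)) (restrict (act (rad A x)) (carrier C))"
  using assms by (auto simp: adjoint_pair_def act_le_iff_rad)

lemma act_max_min:
  assumes "x \<in> carrier A" "y \<in> carrier A"
  shows "restrict (act (x \<squnion>\<^bsub>lat A\<^esub> y)) (carrier C) =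
      C.max_map (restrict (act x) (carrier C)) (restrict (act y) (carrier C))"
    and "restrict (act (x \<sqinter>\<^bsub>lat A\<^esub> y)) (carrier C) =
      C.min_map (restrict (act x) (carrier C)) (restrict (act y) (carrier C))"
proof -
  have "act (x \<squnion>\<^bsub>lat A\<^esub> y) p = (if act x p \<sqsubseteq>\<^sub>C act y p then act y p else act x p)"
    "act (x \<sqinter>\<^bsub>lat A\<^esub> y) p = (if act x p \<sqsubseteq>\<^sub>C act y p then act x p else act y p)"
    if p: "p \<in> carrier C" for p
  proof -
    have "act x p \<sqsubseteq>\<^sub>C act (x \<squnion>\<^bsub>lat A\<^esub> y) p" "act y p \<sqsubseteq>\<^sub>C act (x \<squnion>\<^bsub>lat A\<^esub> y) p"
      "act (x \<sqinter>\<^bsub>lat A\<^esub> y) p \<sqsubseteq>\<^sub>C act x p" "act (x \<sqinter>\<^bsub>lat A\<^esub> y) p \<sqsubseteq>\<^sub>C act y p"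
      using assms p by (simp_all add: act_leq A.L.join_left A.L.join_right A.L.meet_left A.L.meet_right)
    then show "act (x \<squnion>\<^bsub>lat A\<^esub> y) p = (if act x p \<sqsubseteq>\<^sub>C act y p then act y p else act x p)"
      "act (x \<sqinter>\<^bsub>lat A\<^esub> y) p = (if act x p \<sqsubseteq>\<^sub>C act y p then act x p else act y p)"
      using act_join[OF assms p] act_meet[OF assms p] C.antisym[of "act x p" "act y p"]
        C.not_le_imp_le[of "act x p" "act y p"] assms p by auto
  qed
  then show "restrict (act (x \<squnion>\<^bsub>lat A\<^esub> y)) (carrier C) =
      C.max_map (restrict (act x) (carrier C)) (restrict (act y) (carrier C))"
    "restrict (act (x \<sqinter>\<^bsub>lat A\<^esub> y)) (carrier C) =
      C.min_map (restrict (act x) (carrier C)) (restrict (act y) (carrier C))"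
    by (auto simp: C.max_map_def C.min_map_def fun_eq_iff)
qed

definition faithful :: bool where
  "faithful \<longleftrightarrow> (\<forall>x\<in>carrier A. \<forall>y\<in>carrier A. \<not> leq A x y \<longrightarrow> (\<exists>p\<in>carrier C. \<not> act x p \<sqsubseteq>\<^sub>C act y p))"

end

locale periodic_chain_action = chain_action A C act + A: n_periodic A n
  for A :: "('a, 'm) lpg_scheme" and n and C :: "'c gorder" and act
begin

text \<open>The map of \<open>rad A x\<close> is the residual of the map of \<open>x\<close>, so the
  iterated adjoints of \<open>x\<close> supply the whole adjoint sequence.\<close>

lemma act_in_Fn_lpg:
  assumes x: "x \<in> carrier A"
  shows "restrict (act x) (carrier C) \<in> carrier (Fn_lpg n C)"
  unfolding C.Fn_lpg_iff
proof (intro exI conjI)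
  let ?s = "\<lambda>i. restrict (act (A.iter i x)) (carrier C)"
  show "adjoint_seq C ?s"
    unfolding adjoint_seq_def using adjoint_pair_act[of "A.iter _ x"] x by (simp add: A.rad_iter)
  have "A.iter (- int n) x = A.iter (int n) x"
    using A.periodic[OF x] by (simp add: periodic_elem_def A.iter_def)
  then show "?s (- int n) = ?s (int n)" by simp
qed simp

lemma lpg_embeds_Fn_lpg:
  assumes faithful
  shows "lpg_embeds A (Fn_lpg n C)"
proof -
  let ?f = "\<lambda>x. restrict (act x) (carrier C)"
  have "?f \<in> lpg_hom A (Fn_lpg n C)"
    by (rule lpg_homI[OF A.lpregroup_axioms C.lpregroup_Fn_lpg])
      (auto simp: act_in_Fn_lpg act_mult act_one act_max_min C.Fn_lpg_join compose_def fun_eq_iff)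
  moreover have "inj_on ?f (carrier A)"
  proof (rule inj_onI)
    fix x y assume xy: "x \<in> carrier A" "y \<in> carrier A" and eq: "?f x = ?f y"
    have "act x p = act y p" if "p \<in> carrier C" for p using fun_cong[OF eq, of p] that by simp
    then have "leq A x y" "leq A y x"
      using assms xy C.le_refl act_closed unfolding faithful_def by metis+
    then show "x = y" using xy by (simp add: A.le_antisym)
  qed
  ultimately show ?thesis
    using A.lpregroup_axioms C.lpregroup_Fn_lpg by (auto simp: lpg_embeds_def)
qed

section \<open>Threads of successive covers\<close>

definition cov :: "'c \<Rightarrow> 'c \<Rightarrow> bool" where
  "cov p q \<longleftrightarrow> p \<in> carrier C \<and> q \<in> carrier C \<and> (\<forall>y\<in>carrier C. q \<sqsubseteq>\<^sub>C y \<longleftrightarrow> \<not> y \<sqsubseteq>\<^sub>C p)"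

definition cov_thread :: "(int \<Rightarrow> 'c) \<Rightarrow> bool" where
  "cov_thread \<zeta> \<longleftrightarrow> (\<forall>i. cov (\<zeta> i) (\<zeta> (i + 1)))"

text \<open>The points from which successive covers lead on without end both upwards and
  downwards.\<close>

definition discrete :: "'c set" where
  "discrete = {\<zeta> 0 | \<zeta>. cov_thread \<zeta>}"

lemma cov_closed: "cov p q \<Longrightarrow> p \<in> carrier C" "cov p q \<Longrightarrow> q \<in> carrier C"
  by (auto simp: cov_def)

lemma cov_less: "cov p q \<Longrightarrow> p \<sqsubseteq>\<^sub>C q" "cov p q \<Longrightarrow> \<not> q \<sqsubseteq>\<^sub>C p"
  unfolding cov_def using C.le_refl C.not_le_imp_le by blast+

lemma cov_le_iff: "cov p q \<Longrightarrow> y \<in> carrier C \<Longrightarrow> q \<sqsubseteq>\<^sub>C y \<longleftrightarrow> \<not> y \<sqsubseteq>\<^sub>C p"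
  by (auto simp: cov_def)

lemma cov_unique: "cov p q \<Longrightarrow> cov p q' \<Longrightarrow> q = q'"
  unfolding cov_def by (metis C.antisym C.le_refl)

text \<open>Same chain of equivalences as in \<open>adjoint_seq_cover\<close>, but for a single
  cover in a chain that may lack others.\<close>

lemma cov_act:
  assumes x: "x \<in> carrier A" and pq: "cov p q"
  shows "cov (act x p) (act (lad A (lad A x)) q)"
  unfolding cov_def
proof (intro conjI ballI)
  note cl = cov_closed[OF pq]
  show "act x p \<in> carrier C" "act (lad A (lad A x)) q \<in> carrier C" using x cl by simp_all
  fix y assume y: "y \<in> carrier C"
  show "act (lad A (lad A x)) q \<sqsubseteq>\<^sub>C y \<longleftrightarrow> \<not> y \<sqsubseteq>\<^sub>C act x p"
    using x y cl cov_le_iff[OF pq, of "act (lad A x) y"] by (simp add: act_lad_le_iff)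
qed

text \<open>Each step to a cover costs a double left adjoint, so the i-th point of the thread has to
  be moved by the 2i-th iterate of \<open>x\<close> rather than by \<open>x\<close> itself.\<close>

lemma cov_thread_act:
  assumes x: "x \<in> carrier A" and \<zeta>: "cov_thread \<zeta>"
  shows "cov_thread (\<lambda>i. act (A.iter (- 2 * i) x) (\<zeta> i))"
  unfolding cov_thread_def
proof
  fix i :: int
  have "- 2 * (i + 1) = - 2 * i - 1 - 1" by simp
  then have "A.iter (- 2 * (i + 1)) x = lad A (lad A (A.iter (- 2 * i) x))"
    using x by (simp only: A.lad_iter)
  then show "cov (act (A.iter (- 2 * i) x) (\<zeta> i)) (act (A.iter (- 2 * (i + 1)) x) (\<zeta> (i + 1)))"
    using cov_act[of "A.iter (- 2 * i) x"] x \<zeta> by (simp only: cov_thread_def A.iter_closed)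
qed

lemma cov_thread_closed: "cov_thread \<zeta> \<Longrightarrow> \<zeta> i \<in> carrier C"
  using cov_closed by (auto simp: cov_thread_def)

lemma cov_thread_shift: "cov_thread \<zeta> \<Longrightarrow> cov_thread (\<lambda>i. \<zeta> (i + k))"
  unfolding cov_thread_def by (metis add.commute add.left_commute)

lemma cov_thread_discrete: "cov_thread \<zeta> \<Longrightarrow> \<zeta> i \<in> discrete"
  unfolding discrete_def using cov_thread_shift[of \<zeta> i] by (force intro: exI[of _ "\<lambda>k. \<zeta> (k + i)"])

lemma discreteE:
  assumes "p \<in> discrete"
  obtains \<zeta> where "cov_thread \<zeta>" "\<zeta> 0 = p"
  using assms by (auto simp: discrete_def)

lemma discrete_closed: "p \<in> discrete \<Longrightarrow> p \<in> carrier C"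
  using cov_thread_closed by (auto simp: discrete_def)

lemma discrete_act:
  assumes "x \<in> carrier A" "p \<in> discrete"
  shows "act x p \<in> discrete"
proof -
  obtain \<zeta> where "cov_thread \<zeta>" "\<zeta> 0 = p" using assms(2) by (rule discreteE)
  then show ?thesis using cov_thread_discrete[OF cov_thread_act[OF assms(1)], of \<zeta> 0] by simp
qed

lemma cov_thread_less: "cov_thread \<zeta> \<Longrightarrow> 0 < k \<Longrightarrow> \<not> \<zeta> (i + int k) \<sqsubseteq>\<^sub>C \<zeta> i"
proof (induction k)
  case (Suc k)
  have c: "cov (\<zeta> (i + int k)) (\<zeta> (i + int k + 1))" using Suc.prems by (simp add: cov_thread_def)
  have le: "\<zeta> i \<sqsubseteq>\<^sub>C \<zeta> (i + int k)"
    using Suc C.not_le_imp_le[of "\<zeta> (i + int k)" "\<zeta> i"] cov_thread_closed[of \<zeta>] by (cases "k = 0") auto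
  show ?case
  proof
    assume "\<zeta> (i + int (Suc k)) \<sqsubseteq>\<^sub>C \<zeta> i"
    then have "\<zeta> (i + int k + 1) \<sqsubseteq>\<^sub>C \<zeta> (i + int k)"
      using C.le_trans[OF _ le] cov_thread_closed[OF Suc.prems(1)] by (simp add: algebra_simps)
    then show False using cov_less(2)[OF c] by blast
  qed
qed simp

lemma cov_thread_convex:
  assumes "cov_thread \<zeta>" "a \<in> carrier C" "\<zeta> 0 \<sqsubseteq>\<^sub>C a" "a \<sqsubseteq>\<^sub>C \<zeta> (int m)"
  shows "a \<in> discrete"
  using assms(4)
proof (induction m)
  case 0
  then have "a = \<zeta> 0" using assms cov_thread_closed C.antisym by simp
  then show ?case using cov_thread_discrete[OF assms(1)] by simp
next
  case (Suc m)
  have c: "cov (\<zeta> (int m)) (\<zeta> (int m + 1))" using assms(1) by (simp add: cov_thread_def)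
  show ?case
  proof (cases "a \<sqsubseteq>\<^sub>C \<zeta> (int m)")
    case False
    then have "\<zeta> (int m + 1) \<sqsubseteq>\<^sub>C a" using cov_le_iff[OF c assms(2)] by simp
    then have "a = \<zeta> (int m + 1)"
      using Suc.prems assms(2) cov_thread_closed[OF assms(1)] C.antisym by (simp add: add.commute)
    then show ?thesis using cov_thread_discrete[OF assms(1)] by simp
  qed (rule Suc.IH)
qed

text \<open>The point \<open>d\<close> lies on a thread and below \<open>a\<close>, and
  \<open>x\<close> sends \<open>a\<close> no higher than \<open>d\<close>. After \<open>n\<close>
  steps up the thread, the twisted action is that of \<open>x\<close> again, so \<open>x\<close>
  sends \<open>\<zeta> (int n)\<close> strictly above its value at \<open>d\<close>. Hence
  \<open>a\<close> is caught between \<open>d\<close> and \<open>\<zeta> (int n)\<close>, where only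
  thread points exist.\<close>

lemma discrete_act_reflect:
  assumes x: "x \<in> carrier A" and a: "a \<in> carrier C" and e: "act x a \<in> discrete"
  shows "a \<in> discrete"
proof -
  define d where "d = act (lad A x) (act x a)"
  have d: "d \<in> discrete" unfolding d_def by (rule discrete_act[OF _ e]) (simp add: x)
  then obtain \<zeta> where \<zeta>: "cov_thread \<zeta>" "\<zeta> 0 = d" by (rule discreteE)
  have da: "d \<sqsubseteq>\<^sub>C a" using act_units(4)[OF x a] by (simp add: d_def)
  let ?\<eta> = "\<lambda>i. act (A.iter (- 2 * i) x) (\<zeta> i)"
  have \<eta>: "cov_thread ?\<eta>" by (rule cov_thread_act[OF x \<zeta>(1)])
  have "nat (2 * int n) = 2 * n" by simp
  then have "A.iter (- 2 * int n) x = x"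
    using A.lad_funpow_period[OF x] A.n_pos by (auto simp: A.iter_def)
  then have "\<not> act x (\<zeta> (int n)) \<sqsubseteq>\<^sub>C act x d"
    using cov_thread_less[OF \<eta>, of n 0] A.n_pos \<zeta>(2) by simp
  moreover have "act x a \<sqsubseteq>\<^sub>C act x d" using act_units(3)[of x "act x a"] x a by (simp add: d_def)
  ultimately have "\<not> act x (\<zeta> (int n)) \<sqsubseteq>\<^sub>C act x a"
    using C.le_trans[of "act x (\<zeta> (int n))" "act x a" "act x d"] x a discrete_closed[OF d]
      cov_thread_closed[OF \<zeta>(1)] by auto
  then have "\<not> \<zeta> (int n) \<sqsubseteq>\<^sub>C a" using act_mono[OF x cov_thread_closed[OF \<zeta>(1)] a] by blast
  then have "a \<sqsubseteq>\<^sub>C \<zeta> (int n)" using C.not_le_imp_le[OF _ cov_thread_closed[OF \<zeta>(1)] a] by blast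
  then show ?thesis using cov_thread_convex[OF \<zeta>(1) a] da \<zeta>(2) by simp
qed

section \<open>Collapsed intervals force covers\<close>

definition collapse_value :: "'c \<Rightarrow> bool" where
  "collapse_value e \<longleftrightarrow> (\<exists>x\<in>carrier A. \<exists>a\<in>carrier C. \<exists>b\<in>carrier C. \<not> b \<sqsubseteq>\<^sub>C a \<and> act x a = e \<and> act x b = e)"

text \<open>
  If \<open>x\<close> collapses the interval from \<open>d\<close> to \<open>c\<close> to the point \<open>e\<close>, then the cover \<open>e'\<close> of \<open>e\<close> is the image
  under the second left adjoint of \<open>x\<close> both of \<open>c\<close> and of the cover of \<open>c\<close>.
\<close>

lemma collapse_value_up:
  assumes "collapse_value e"
  shows "\<exists>e'. cov e e' \<and> collapse_value e'"
proof -
  obtain x a b where x [simp]: "x \<in> carrier A" and [simp]: "a \<in> carrier C" "b \<in> carrier C"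
    and ab: "\<not> b \<sqsubseteq>\<^sub>C a" "act x a = e" "act x b = e"
    using assms by (auto simp: collapse_value_def)
  have [simp]: "e \<in> carrier C" using ab(2) by force
  define c where "c = act (rad A x) e"
  define d where "d = act (lad A x) e"
  define e' where "e' = act (lad A (lad A x)) c"
  define c' where "c' = act (lad A x) e'"
  have [simp]: "c \<in> carrier C" "d \<in> carrier C" "e' \<in> carrier C" "c' \<in> carrier C"
    by (simp_all add: c_def d_def e'_def c'_def)
  have da: "d \<sqsubseteq>\<^sub>C a" using act_units(4)[of x a] ab by (simp add: d_def)
  have bc: "b \<sqsubseteq>\<^sub>C c" using act_units(1)[of x b] ab by (simp add: c_def)
  have xc: "act x c \<sqsubseteq>\<^sub>C e" using act_units(2)[of x e] by (simp add: c_def)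
  have cov: "cov e e'" unfolding cov_def
  proof (intro conjI ballI)
    fix y assume y [simp]: "y \<in> carrier C"
    have iff: "e' \<sqsubseteq>\<^sub>C y \<longleftrightarrow> c \<sqsubseteq>\<^sub>C act (lad A x) y" by (simp add: e'_def act_lad_le_iff)
    show "e' \<sqsubseteq>\<^sub>C y \<longleftrightarrow> \<not> y \<sqsubseteq>\<^sub>C e"
    proof
      assume "e' \<sqsubseteq>\<^sub>C y"
      show "\<not> y \<sqsubseteq>\<^sub>C e"
      proof
        assume "y \<sqsubseteq>\<^sub>C e"
        then have "act (lad A x) y \<sqsubseteq>\<^sub>C d" by (simp add: d_def act_mono)
        then have "c \<sqsubseteq>\<^sub>C d" using iff \<open>e' \<sqsubseteq>\<^sub>C y\<close> C.le_trans[of c "act (lad A x) y" d] by simp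
        then have "b \<sqsubseteq>\<^sub>C a" using bc da C.le_trans[of b c d] C.le_trans[of b d a] by simp
        with ab(1) show False by simp
      qed
    next
      assume y_e: "\<not> y \<sqsubseteq>\<^sub>C e"
      show "e' \<sqsubseteq>\<^sub>C y"
      proof (rule ccontr)
        assume "\<not> e' \<sqsubseteq>\<^sub>C y"
        then have "act (lad A x) y \<sqsubseteq>\<^sub>C c" using iff C.not_le_imp_le by simp
        then have "y \<sqsubseteq>\<^sub>C act x c" by (simp add: act_lad_le_iff)
        then show False using y_e xc C.le_trans[of y "act x c" e] by simp
      qed
    qed
  qed simp_all
  have cc': "c \<sqsubseteq>\<^sub>C c'" using act_lad_le_iff[of "lad A x" c e'] by (simp add: c'_def e'_def C.le_refl)
  have "\<not> c' \<sqsubseteq>\<^sub>C c"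
  proof
    assume "c' \<sqsubseteq>\<^sub>C c"
    then have "e' \<sqsubseteq>\<^sub>C act x c" by (simp add: c'_def act_lad_le_iff)
    then have "e' \<sqsubseteq>\<^sub>C e" using xc C.le_trans[of e' "act x c" e] by simp
    with cov_less(2)[OF cov] show False by simp
  qed
  moreover have "act (lad A (lad A x)) c' = e'"
  proof (rule C.antisym)
    show "act (lad A (lad A x)) c' \<sqsubseteq>\<^sub>C e'" using act_units(4)[of "lad A x" e'] by (simp add: c'_def)
    show "e' \<sqsubseteq>\<^sub>C act (lad A (lad A x)) c'" using cc' by (simp add: e'_def act_mono)
  qed simp_all
  ultimately have "collapse_value e'"
    unfolding collapse_value_def
    by (intro bexI[of _ "lad A (lad A x)"] bexI[of _ c] bexI[of _ c']) (simp_all add: e'_def)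
  with cov show ?thesis by blast
qed

text \<open>Order dual of the previous argument: the second right adjoint of \<open>x\<close> sends
  both the lower end \<open>d\<close> and the smaller point \<open>d'\<close> to the predecessor of
  \<open>e\<close>.\<close>

lemma collapse_value_down:
  assumes "collapse_value e"
  shows "\<exists>e'. cov e' e \<and> collapse_value e'"
proof -
  obtain x a b where x [simp]: "x \<in> carrier A" and [simp]: "a \<in> carrier C" "b \<in> carrier C"
    and ab: "\<not> b \<sqsubseteq>\<^sub>C a" "act x a = e" "act x b = e"
    using assms by (auto simp: collapse_value_def)
  have [simp]: "e \<in> carrier C" using ab(2) by force
  define c where "c = act (rad A x) e"
  define d where "d = act (lad A x) e"
  define e' where "e' = act (rad A (rad A x)) d"
  define d' where "d' = act (rad A x) e'"
  have [simp]: "c \<in> carrier C" "d \<in> carrier C" "e' \<in> carrier C" "d' \<in> carrier C"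
    by (simp_all add: c_def d_def e'_def d'_def)
  have da: "d \<sqsubseteq>\<^sub>C a" using act_units(4)[of x a] ab by (simp add: d_def)
  have bc: "b \<sqsubseteq>\<^sub>C c" using act_units(1)[of x b] ab by (simp add: c_def)
  have xd: "e \<sqsubseteq>\<^sub>C act x d" using act_units(3)[of x e] by (simp add: d_def)
  have cov: "cov e' e" unfolding cov_def
  proof (intro conjI ballI)
    fix y assume y [simp]: "y \<in> carrier C"
    have iff: "y \<sqsubseteq>\<^sub>C e' \<longleftrightarrow> act (rad A x) y \<sqsubseteq>\<^sub>C d" by (simp add: e'_def act_le_iff_rad)
    show "e \<sqsubseteq>\<^sub>C y \<longleftrightarrow> \<not> y \<sqsubseteq>\<^sub>C e'"
    proof
      assume "e \<sqsubseteq>\<^sub>C y"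
      show "\<not> y \<sqsubseteq>\<^sub>C e'"
      proof
        assume "y \<sqsubseteq>\<^sub>C e'"
        have "c \<sqsubseteq>\<^sub>C act (rad A x) y" using \<open>e \<sqsubseteq>\<^sub>C y\<close> by (simp add: c_def act_mono)
        then have "c \<sqsubseteq>\<^sub>C d" using iff \<open>y \<sqsubseteq>\<^sub>C e'\<close> C.le_trans[of c "act (rad A x) y" d] by simp
        then have "b \<sqsubseteq>\<^sub>C a" using bc da C.le_trans[of b c d] C.le_trans[of b d a] by simp
        with ab(1) show False by simp
      qed
    next
      assume y_e: "\<not> y \<sqsubseteq>\<^sub>C e'"
      then have "d \<sqsubseteq>\<^sub>C act (rad A x) y" using iff C.not_le_imp_le by simp
      then have "act x d \<sqsubseteq>\<^sub>C y" by (simp add: act_le_iff_rad)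
      then show "e \<sqsubseteq>\<^sub>C y" using xd C.le_trans[of e "act x d" y] by simp
    qed
  qed simp_all
  have dd': "d' \<sqsubseteq>\<^sub>C d" using act_le_iff_rad[of "rad A x" e' d] by (simp add: d'_def e'_def C.le_refl)
  have "\<not> d \<sqsubseteq>\<^sub>C d'"
  proof
    assume "d \<sqsubseteq>\<^sub>C d'"
    then have "act x d \<sqsubseteq>\<^sub>C e'" by (simp add: d'_def act_le_iff_rad)
    then have "e \<sqsubseteq>\<^sub>C e'" using xd C.le_trans[of e "act x d" e'] by simp
    with cov_less(2)[OF cov] show False by simp
  qed
  moreover have "act (rad A (rad A x)) d' = e'"
  proof (rule C.antisym)
    show "e' \<sqsubseteq>\<^sub>C act (rad A (rad A x)) d'" using act_units(1)[of "rad A x" e'] by (simp add: d'_def)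
    show "act (rad A (rad A x)) d' \<sqsubseteq>\<^sub>C e'" using dd' by (simp add: e'_def act_mono)
  qed simp_all
  ultimately have "collapse_value e'"
    unfolding collapse_value_def
    by (intro bexI[of _ "rad A (rad A x)"] bexI[of _ d'] bexI[of _ d]) (simp_all add: e'_def)
  with cov show ?thesis by blast
qed

lemma collapse_value_discrete:
  assumes e: "collapse_value e"
  shows "e \<in> discrete"
proof -
  obtain up where up: "\<And>e. collapse_value e \<Longrightarrow> cov e (up e) \<and> collapse_value (up e)"
    using collapse_value_up by metis
  obtain down where down: "\<And>e. collapse_value e \<Longrightarrow> cov (down e) e \<and> collapse_value (down e)"
    using collapse_value_down by metis
  have cv: "collapse_value ((up ^^ k) e)" "collapse_value ((down ^^ k) e)" for k
    using e up down by (induction k) auto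
  define \<zeta> where "\<zeta> i = (if i \<ge> 0 then (up ^^ nat i) e else (down ^^ nat (- i)) e)" for i :: int
  have "cov (\<zeta> i) (\<zeta> (i + 1))" for i
  proof (cases "i \<ge> 0")
    case True
    then have "nat (i + 1) = Suc (nat i)" by simp
    with True show ?thesis using up[OF cv(1)[of "nat i"]] by (simp add: \<zeta>_def)
  next
    case False
    then have "nat (- i) = Suc (nat (- (i + 1)))" by simp
    with False show ?thesis using down[OF cv(2)[of "nat (- (i + 1))"]] by (cases "i = - 1") (auto simp: \<zeta>_def)
  qed
  then have "cov_thread \<zeta>" by (simp add: cov_thread_def)
  moreover have "\<zeta> 0 = e" by (simp add: \<zeta>_def)
  ultimately show ?thesis by (auto simp: discrete_def)
qed

text \<open>The values of collapses lie on threads, and by reflection so do the points that were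
  identified. This is what keeps the lexicographic comparison intact after refinement: identified
  points both carry the coordinate 0.\<close>

lemma act_strict:
  assumes "x \<in> carrier A" "p \<in> carrier C" "q \<in> carrier C" "p \<noteq> q" "act x p = act x q"
  shows "p \<in> discrete \<and> q \<in> discrete"
proof -
  have "\<not> p \<sqsubseteq>\<^sub>C q \<or> \<not> q \<sqsubseteq>\<^sub>C p" using assms C.antisym by blast
  then have "collapse_value (act x p)" unfolding collapse_value_def using assms by metis
  then show ?thesis using collapse_value_discrete discrete_act_reflect assms by metis
qed

end

section \<open>Refinement to an integral chain\<close>

context periodic_chain_action
begin

text \<open>Every point outside the copies of \<open>\<int>\<close> is replaced by a copy of \<open>\<int>\<close>.\<close>

definition refined :: "('c \<times> int) gorder" where
  "refined = (lex_product C Z_chain)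
     \<lparr>carrier := {(p, k). p \<in> carrier C \<and> (p \<in> discrete \<longrightarrow> k = 0)}\<rparr>"

definition refined_act :: "'a \<Rightarrow> 'c \<times> int \<Rightarrow> 'c \<times> int" where
  "refined_act x = map_prod (act x) id"

definition refined_shift :: "'c \<times> int \<Rightarrow> 'c \<times> int" where
  "refined_shift = (\<lambda>(p, k). if p \<in> discrete then (THE q. cov p q, 0) else (p, k + 1))"

lemma refined_sel [simp]:
  "carrier refined = {(p, k). p \<in> carrier C \<and> (p \<in> discrete \<longrightarrow> k = 0)}" "eq refined = (=)"
  "le refined (p, k) (q, l) \<longleftrightarrow> p \<noteq> q \<and> p \<sqsubseteq>\<^sub>C q \<or> p = q \<and> k \<le> l"
  by (simp_all add: refined_def lex_product_def)

lemma discrete_cov: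
  assumes "p \<in> discrete"
  obtains q r where "q \<in> discrete" "r \<in> discrete" "cov p q" "cov r p"
proof -
  obtain \<zeta> where \<zeta>: "cov_thread \<zeta>" "\<zeta> 0 = p" using assms by (rule discreteE)
  have "cov (\<zeta> 0) (\<zeta> 1)" "cov (\<zeta> (- 1)) (\<zeta> 0)"
    using \<zeta>(1) unfolding cov_thread_def by (metis add_0, metis add.left_inverse)
  then show thesis using that[of "\<zeta> 1" "\<zeta> (- 1)"] \<zeta> cov_thread_discrete by simp
qed

lemma total_order_refined: "total_order refined"
proof (rule total_orderI_eq)
  fix x y z
  assume xyz: "x \<in> carrier refined" "y \<in> carrier refined" "z \<in> carrier refined"
    "x \<sqsubseteq>\<^bsub>refined\<^esub> y" "y \<sqsubseteq>\<^bsub>refined\<^esub> z"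
  show "x \<sqsubseteq>\<^bsub>refined\<^esub> z"
    using xyz C.le_trans[of "fst x" "fst y" "fst z"] C.antisym[of "fst x" "fst y"]
    by (cases x; cases y; cases z) auto
next
  fix x y
  assume "x \<in> carrier refined" "y \<in> carrier refined"
  then show "x \<sqsubseteq>\<^bsub>refined\<^esub> y \<or> y \<sqsubseteq>\<^bsub>refined\<^esub> x"
    using C.total_order_total[of "fst x" "fst y"] by (cases x; cases y) auto
qed (auto intro: C.antisym)

lemma refined_shift_discrete:
  assumes "cov p q" "p \<in> discrete"
  shows "refined_shift (p, k) = (q, 0)"
proof -
  have "(THE q. cov p q) = q" using assms(1) cov_unique by blast
  then show ?thesis using assms(2) by (simp add: refined_shift_def)
qed

text \<open>A point of \<open>discrete\<close> keeps its cover from \<open>C\<close>, which is in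
  \<open>discrete\<close> again and has 0 as its only coordinate; any other point is followed by the
  next integer in its own copy.\<close>

lemma integral_chain_refined: "integral_chain refined refined_shift"
proof -
  have cover: "refined_shift x \<sqsubseteq>\<^bsub>refined\<^esub> y \<longleftrightarrow> \<not> y \<sqsubseteq>\<^bsub>refined\<^esub> x"
    if "x \<in> carrier refined" "y \<in> carrier refined" for x y
  proof -
    obtain p k q l where xy: "x = (p, k)" "y = (q, l)" by (cases x; cases y)
    have pq: "p \<in> carrier C" "q \<in> carrier C" "q \<in> discrete \<Longrightarrow> l = 0" "p \<in> discrete \<Longrightarrow> k = 0"
      using that xy by auto
    show ?thesis
    proof (cases "p \<in> discrete")
      case True
      then obtain r where r: "r \<in> discrete" "cov p r" by (meson discrete_cov)
      have "r = q \<Longrightarrow> l = 0" "p = q \<Longrightarrow> l = 0" using pq(3) r True by auto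
      then show ?thesis using xy True r pq cov_le_iff[OF r(2), of q] C.le_refl[of q]
        by (auto simp: refined_shift_discrete[OF r(2)])
    next
      case False
      then show ?thesis using xy pq C.antisym[of p q] C.not_le_imp_le[of p q]
        by (auto simp: refined_shift_def)
    qed
  qed
  have "bij_betw refined_shift (carrier refined) (carrier refined)"
    unfolding bij_betw_def
  proof
    show "inj_on refined_shift (carrier refined)"
    proof (rule inj_onI)
      fix x y assume xy: "x \<in> carrier refined" "y \<in> carrier refined" "refined_shift x = refined_shift y"
      interpret R: chain refined by (simp add: chain_def total_order_refined)
      have "x \<sqsubseteq>\<^bsub>refined\<^esub> y" "y \<sqsubseteq>\<^bsub>refined\<^esub> x"
        using cover[of x x] cover[of y x] cover[of y y] cover[of x y] xy R.le_refl by metis+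
      then show "x = y" using R.antisym xy by blast
    qed
    show "refined_shift ` carrier refined = carrier refined"
    proof (intro equalityI subsetI)
      fix y assume "y \<in> refined_shift ` carrier refined"
      then obtain p k where pk: "y = refined_shift (p, k)" "(p, k) \<in> carrier refined" by auto
      show "y \<in> carrier refined"
      proof (cases "p \<in> discrete")
        case True
        then obtain r where r: "r \<in> discrete" "cov p r" by (meson discrete_cov)
        then show ?thesis using pk refined_shift_discrete[OF r(2) True] discrete_closed by simp
      next
        case False
        then show ?thesis using pk by (simp add: refined_shift_def)
      qed
    next
      fix y assume "y \<in> carrier refined"
      then obtain p k where y: "y = (p, k)" "p \<in> carrier C" "p \<in> discrete \<Longrightarrow> k = 0" by auto
      show "y \<in> refined_shift ` carrier refined"
      proof (cases "p \<in> discrete")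
        case True
        then obtain r where r: "r \<in> discrete" "cov r p" by (meson discrete_cov)
        then have "y = refined_shift (r, 0)" using y refined_shift_discrete[OF r(2,1)] True by simp
        then show ?thesis using discrete_closed[OF r(1)] by auto
      next
        case False
        then have "y = refined_shift (p, k - 1)" using y by (simp add: refined_shift_def)
        then show ?thesis using y False by auto
      qed
    qed
  qed
  with cover show ?thesis
    by (simp add: integral_chain_def integral_chain_axioms_def chain_def total_order_refined del: refined_sel)
qed

text \<open>Closure rests on reflection: if the image of a point is in \<open>discrete\<close>, then
  so is the point, and its integer coordinate is 0. Monotonicity rests on
  \<open>act_strict\<close>.\<close>

lemma chain_action_refined: "chain_action A refined refined_act"
proof -
  have discrete_iff: "act x p \<in> discrete \<longleftrightarrow> p \<in> discrete" if "x \<in> carrier A" "p \<in> carrier C" for x p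
    using that discrete_act discrete_act_reflect by blast
  have "chain_action_axioms A refined refined_act"
  proof (rule chain_action_axioms.intro)
    fix x p assume x: "x \<in> carrier A" and p: "p \<in> carrier refined"
    show "refined_act x p \<in> carrier refined"
      using x p discrete_iff by (auto simp: refined_act_def)
  next
    fix x p q assume x: "x \<in> carrier A" and pq: "p \<in> carrier refined" "q \<in> carrier refined" "p \<sqsubseteq>\<^bsub>refined\<^esub> q"
    then show "refined_act x p \<sqsubseteq>\<^bsub>refined\<^esub> refined_act x q"
      using act_strict[OF x, of "fst p" "fst q"] act_mono[OF x, of "fst p" "fst q"]
      by (cases p; cases q) (auto simp: refined_act_def)
  next
    fix x y p assume xy: "x \<in> carrier A" "y \<in> carrier A" and p: "p \<in> carrier refined"
    show "refined_act (x \<otimes>\<^bsub>A\<^esub> y) p = refined_act x (refined_act y p)"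
      using xy p by (cases p) (simp add: refined_act_def act_mult)
    show "leq A x y \<Longrightarrow> refined_act x p \<sqsubseteq>\<^bsub>refined\<^esub> refined_act y p"
      using act_leq[OF xy, of "fst p"] p by (cases p) (simp add: refined_act_def)
    show "refined_act (x \<^bold>\<squnion> y) p = refined_act x p \<or> refined_act (x \<^bold>\<squnion> y) p = refined_act y p"
      using act_join[OF xy, of "fst p"] p by (cases p) (simp add: refined_act_def)
    show "refined_act (x \<^bold>\<sqinter> y) p = refined_act x p \<or> refined_act (x \<^bold>\<sqinter> y) p = refined_act y p"
      using act_meet[OF xy, of "fst p"] p by (cases p) (simp add: refined_act_def)
  next
    fix p assume "p \<in> carrier refined"
    then show "refined_act \<one>\<^bsub>A\<^esub> p = p" by (cases p) (simp add: refined_act_def act_one)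
  qed
  then show ?thesis
    by (simp add: chain_action_def chain_def total_order_refined A.lpregroup_axioms)
qed

lemma refined_faithful:
  assumes faithful
  shows "chain_action.faithful A refined refined_act"
proof -
  interpret R: chain_action A refined refined_act by (rule chain_action_refined)
  show ?thesis unfolding R.faithful_def
  proof (intro ballI impI)
    fix x y assume xy: "x \<in> carrier A" "y \<in> carrier A" "\<not> leq A x y"
    then obtain p where p: "p \<in> carrier C" "\<not> act x p \<sqsubseteq>\<^sub>C act y p"
      using assms unfolding faithful_def by blast
    then show "\<exists>p\<in>carrier refined. \<not> refined_act x p \<sqsubseteq>\<^bsub>refined\<^esub> refined_act y p"
      using xy C.le_refl[of "act x p"] by (intro bexI[of _ "(p, 0)"]) (auto simp: refined_act_def)
  qed
qed

end

section \<open>Coordinates on an integral chain\<close>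

context integral_chain
begin

definition zshift :: "int \<Rightarrow> 'a \<Rightarrow> 'a" where
  "zshift k x = (if k \<ge> 0 then (\<sigma> ^^ nat k) x else (inv_into (carrier L) \<sigma> ^^ nat (- k)) x)"

lemma zshift_0 [simp]: "zshift 0 x = x"
  by (simp add: zshift_def)

lemma inv_\<sigma>_closed: "x \<in> carrier L \<Longrightarrow> (inv_into (carrier L) \<sigma> ^^ k) x \<in> carrier L"
  using bij by (induction k) (auto simp: bij_betw_def inv_into_into)

lemma zshift_closed [simp]: "x \<in> carrier L \<Longrightarrow> zshift k x \<in> carrier L"
  by (simp add: zshift_def \<sigma>_funpow_closed inv_\<sigma>_closed)

lemma zshift_Suc:
  assumes x: "x \<in> carrier L"
  shows "zshift (k + 1) x = \<sigma> (zshift k x)"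
proof (cases "k \<ge> 0")
  case True
  then have "nat (k + 1) = Suc (nat k)" by simp
  with True show ?thesis by (simp add: zshift_def)
next
  case False
  then have "nat (- k) = Suc (nat (- (k + 1)))" by simp
  then have "\<sigma> (zshift k x) = (inv_into (carrier L) \<sigma> ^^ nat (- (k + 1))) x"
    using False inv_\<sigma>_closed[OF x] bij_betw_inv_into_right[OF bij] by (simp add: zshift_def)
  then show ?thesis using False by (cases "k = - 1") (auto simp: zshift_def)
qed

lemma \<sigma>_le_iff:
  assumes "x \<in> carrier L" "y \<in> carrier L"
  shows "\<sigma> x \<sqsubseteq> \<sigma> y \<longleftrightarrow> x \<sqsubseteq> y"
  using assms cover[of x "\<sigma> y"] cover[of y x] by (simp add: \<sigma>_closed)

lemma \<sigma>_inj: "\<lbrakk>\<sigma> x = \<sigma> y; x \<in> carrier L; y \<in> carrier L\<rbrakk> \<Longrightarrow> x = y"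
  using bij by (auto simp: bij_betw_def dest: inj_onD)

lemma zshift_le_iff:
  assumes "x \<in> carrier L" "y \<in> carrier L"
  shows "zshift k x \<sqsubseteq> zshift k y \<longleftrightarrow> x \<sqsubseteq> y"
proof (induction k rule: int_induct[of _ 0])
  case (step1 k)
  then show ?case using assms by (simp add: zshift_Suc \<sigma>_le_iff)
next
  case (step2 k)
  then show ?case
    using zshift_Suc[of x "k - 1"] zshift_Suc[of y "k - 1"] assms \<sigma>_le_iff[of "zshift (k - 1) x" "zshift (k - 1) y"]
    by simp
qed simp

lemma zshift_add:
  assumes x: "x \<in> carrier L"
  shows "zshift (k + l) x = zshift k (zshift l x)"
proof (induction k rule: int_induct[of _ 0])
  case (step1 k)
  have "zshift (k + 1 + l) x = \<sigma> (zshift (k + l) x)"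
    using zshift_Suc[OF x, of "k + l"] by (simp add: ac_simps)
  then show ?case using step1 x by (simp add: zshift_Suc)
next
  case (step2 k)
  have "\<sigma> (zshift (k - 1 + l) x) = \<sigma> (zshift (k - 1) (zshift l x))"
    using zshift_Suc[OF x, of "k - 1 + l"] zshift_Suc[of "zshift l x" "k - 1"] step2 x
    by (simp add: algebra_simps)
  then show ?case using x by (simp add: \<sigma>_inj)
qed simp

lemma le_zshift:
  assumes x: "x \<in> carrier L"
  shows "zshift k x \<sqsubseteq> zshift l x \<longleftrightarrow> k \<le> l"
proof -
  have up: "x \<sqsubseteq> zshift (int m) x \<and> (m > 0 \<longrightarrow> \<not> zshift (int m) x \<sqsubseteq> x)" for m
  proof (induction m)
    case (Suc m)
    have "\<not> zshift (int (Suc m)) x \<sqsubseteq> x"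
      using Suc cover[of "zshift (int m) x" x] x zshift_Suc[OF x, of "int m"] by (simp add: add.commute)
    then show ?case using x not_le_imp_le by auto
  qed (simp add: x le_refl)
  have "zshift k x = zshift l (zshift (k - l) x)" using zshift_add[OF x, of l "k - l"] by simp
  then have 1: "zshift k x \<sqsubseteq> zshift l x \<longleftrightarrow> zshift (k - l) x \<sqsubseteq> x" using x by (simp add: zshift_le_iff)
  show ?thesis
  proof (cases "k \<le> l")
    case True
    have "zshift (k - l) x \<sqsubseteq> x \<longleftrightarrow> x \<sqsubseteq> zshift (l - k) x"
      using zshift_le_iff[of "zshift (k - l) x" x "l - k"] zshift_add[OF x, of "l - k" "k - l"] x by simp
    then show ?thesis using 1 up[of "nat (l - k)"] True by simp
  next
    case False
    then show ?thesis using 1 up[of "nat (k - l)"] by simp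
  qed
qed

text \<open>The predicate under \<open>SOME\<close> depends only on the orbit of \<open>x\<close>
  under integer shifts, so all points of an orbit share one representative.\<close>

definition class_rep :: "'a \<Rightarrow> 'a" where
  "class_rep x = (SOME y. \<exists>k. y = zshift k x)"

lemma class_repE:
  obtains k where "class_rep x = zshift k x"
proof -
  have "\<exists>k. class_rep x = zshift k x"
    unfolding class_rep_def by (rule someI[of _ "zshift 0 x"]) blast
  then show thesis using that by blast
qed

lemma class_rep_closed [simp]: "x \<in> carrier L \<Longrightarrow> class_rep x \<in> carrier L"
  using class_repE[of x] zshift_closed by metis

lemma class_rep_zshift:
  assumes x: "x \<in> carrier L"
  shows "class_rep (zshift l x) = class_rep x"
proof -
  have "(\<exists>k. y = zshift k (zshift l x)) \<longleftrightarrow> (\<exists>k. y = zshift k x)" for y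
    using zshift_add[OF x] by (metis diff_add_cancel)
  then show ?thesis by (simp add: class_rep_def)
qed

lemma class_rep_idem: "x \<in> carrier L \<Longrightarrow> class_rep (class_rep x) = class_rep x"
  using class_repE[of x] class_rep_zshift by metis

text \<open>Distinct representatives have disjoint orbits. If \<open>v\<close> is above
  \<open>u\<close> and outside its orbit, then so it is for the successor of \<open>u\<close>, since
  the successor of a point strictly below \<open>v\<close> is at most \<open>v\<close>. Hence orbits
  are compared as blocks.\<close>

lemma zshift_le_iff_class_rep:
  assumes x: "x \<in> carrier L" "class_rep x = x" and y: "y \<in> carrier L" "class_rep y = y"
  shows "zshift k x \<sqsubseteq> zshift l y \<longleftrightarrow> x \<noteq> y \<and> x \<sqsubseteq> y \<or> x = y \<and> k \<le> l"
proof (cases "x = y")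
  case False
  have ne: "zshift m x \<noteq> y" "zshift m y \<noteq> x" for m
    using False x y class_rep_zshift by metis+
  have up: "zshift (int m) u \<sqsubseteq> v" if "u \<sqsubseteq> v" "u \<in> carrier L" "v \<in> carrier L" "\<And>k. zshift k u \<noteq> v" for u v m
  proof (induction m)
    case (Suc m)
    then have "\<not> v \<sqsubseteq> zshift (int m) u" using that antisym zshift_closed by blast
    then show ?case using cover[of "zshift (int m) u" v] that zshift_Suc[of u "int m"] by (simp add: add.commute)
  qed (simp add: that)
  have all: "zshift m u \<sqsubseteq> v" if uv: "u \<sqsubseteq> v" "u \<in> carrier L" "v \<in> carrier L" "\<And>k. zshift k u \<noteq> v" for u v m
  proof (cases "m \<ge> 0")
    case True
    then show ?thesis using up[OF uv, of "nat m"] by simp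
  next
    case False
    then have "zshift m u \<sqsubseteq> u" using le_zshift[OF uv(2), of m 0] by simp
    then show ?thesis using uv le_trans[of "zshift m u" u v] by simp
  qed
  have "zshift k x \<sqsubseteq> zshift l y \<longleftrightarrow> zshift (k - l) x \<sqsubseteq> y"
    using zshift_add[OF x(1), of l "k - l"] x y by (simp add: zshift_le_iff)
  also have "\<dots> \<longleftrightarrow> x \<sqsubseteq> y"
  proof
    assume "x \<sqsubseteq> y"
    then show "zshift (k - l) x \<sqsubseteq> y" using all x y ne by blast
  next
    assume 1: "zshift (k - l) x \<sqsubseteq> y"
    have "zshift j (zshift (k - l) x) \<noteq> y" for j using ne zshift_add[OF x(1)] by metis
    then have "zshift (l - k) (zshift (k - l) x) \<sqsubseteq> y" using all[OF 1] x y by simp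
    then show "x \<sqsubseteq> y" using zshift_add[OF x(1), of "l - k" "k - l"] by simp
  qed
  finally show ?thesis using False by simp
qed (use x le_zshift in simp)

text \<open>The orbit representatives form the base chain; \<open>\<iota>\<close> renames them so
  that \<open>J\<close> can live in a prescribed type.\<close>

lemma lex_product_representation:
  fixes \<iota> :: "'a \<Rightarrow> 'b"
  assumes \<iota>: "inj_on \<iota> (carrier L)"
  obtains J :: "'b gorder" and \<Theta> where "total_order J"
    "bij_betw \<Theta> (carrier (lex_product J Z_chain)) (carrier L)"
    "\<forall>a\<in>carrier (lex_product J Z_chain). \<forall>b\<in>carrier (lex_product J Z_chain).
      \<Theta> a \<sqsubseteq> \<Theta> b \<longleftrightarrow> a \<sqsubseteq>\<^bsub>lex_product J Z_chain\<^esub> b"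
proof -
  let ?R = "{x \<in> carrier L. class_rep x = x}"
  let ?g = "inv_into (carrier L) \<iota>"
  define J :: "'b gorder" where "J = \<lparr>carrier = \<iota> ` ?R, eq = (=), le = (\<lambda>a b. ?g a \<sqsubseteq> ?g b)\<rparr>"
  define \<Theta> where "\<Theta> = (\<lambda>(j, k). zshift k (?g j))"
  have g: "?g (\<iota> x) = x" if "x \<in> carrier L" for x using \<iota> that by simp
  have J: "total_order J"
    by (rule total_orderI_eq)
      (auto simp: J_def g le_refl intro: le_trans not_le_imp_le intro!: arg_cong[of _ _ \<iota>] antisym)
  have iff: "\<Theta> a \<sqsubseteq> \<Theta> b \<longleftrightarrow> a \<sqsubseteq>\<^bsub>lex_product J Z_chain\<^esub> b"
    if ab: "a \<in> carrier (lex_product J Z_chain)" "b \<in> carrier (lex_product J Z_chain)" for a b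
  proof -
    obtain x k y l where "a = (\<iota> x, k)" "b = (\<iota> y, l)" and xy: "x \<in> ?R" "y \<in> ?R"
      using ab by (auto simp: J_def)
    moreover have "\<iota> x = \<iota> y \<longleftrightarrow> x = y" using xy \<iota> by (auto dest: inj_onD)
    ultimately show ?thesis
      using zshift_le_iff_class_rep[of x y k l] by (auto simp: \<Theta>_def J_def g)
  qed
  have cl: "\<Theta> a \<in> carrier L" if "a \<in> carrier (lex_product J Z_chain)" for a
    using that by (auto simp: \<Theta>_def J_def g)
  have "inj_on \<Theta> (carrier (lex_product J Z_chain))"
  proof (rule inj_onI)
    interpret JZ: integral_chain "lex_product J Z_chain" lex_shift
      by (rule chain.lex_product_Z_integral) (simp add: chain_def J)
    fix a b assume ab: "a \<in> carrier (lex_product J Z_chain)" "b \<in> carrier (lex_product J Z_chain)" "\<Theta> a = \<Theta> b"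
    then have "a \<sqsubseteq>\<^bsub>lex_product J Z_chain\<^esub> b" "b \<sqsubseteq>\<^bsub>lex_product J Z_chain\<^esub> a"
      using iff cl le_refl by metis+
    then show "a = b" using ab JZ.antisym by blast
  qed
  moreover have "x \<in> \<Theta> ` carrier (lex_product J Z_chain)" if x: "x \<in> carrier L" for x
  proof -
    obtain k where k: "class_rep x = zshift k x" by (rule class_repE)
    have "x = zshift (- k) (class_rep x)" using zshift_add[OF x, of "- k" k] k by simp
    then have "x = \<Theta> (\<iota> (class_rep x), - k)" using x by (simp add: \<Theta>_def g)
    moreover have "(\<iota> (class_rep x), - k) \<in> carrier (lex_product J Z_chain)"
      using x class_rep_idem by (auto simp: J_def)
    ultimately show ?thesis by blast
  qed
  ultimately have "bij_betw \<Theta> (carrier (lex_product J Z_chain)) (carrier L)"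
    using cl by (auto simp: bij_betw_def)
  then show thesis using that J iff by blast
qed

end

lemma chain_action_transport:
  assumes act: "chain_action A L act" and faithful: "chain_action.faithful A L act"
    and \<Omega>: "total_order \<Omega>" and bij: "bij_betw \<Theta> (carrier \<Omega>) (carrier L)"
    and le: "\<forall>a\<in>carrier \<Omega>. \<forall>b\<in>carrier \<Omega>. \<Theta> a \<sqsubseteq>\<^bsub>L\<^esub> \<Theta> b \<longleftrightarrow> a \<sqsubseteq>\<^bsub>\<Omega>\<^esub> b"
  obtains act' where "chain_action A \<Omega> act'" "chain_action.faithful A \<Omega> act'"
proof -
  interpret chain_action A L act by fact
  let ?g = "inv_into (carrier \<Omega>) \<Theta>"
  have g: "?g p \<in> carrier \<Omega>" "\<Theta> (?g p) = p" if "p \<in> carrier L" for p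
    using bij that by (auto simp: bij_betw_def inv_into_into f_inv_into_f)
  have \<Theta>: "\<Theta> a \<in> carrier L" "?g (\<Theta> a) = a" if "a \<in> carrier \<Omega>" for a
    using bij that by (auto simp: bij_betw_def)
  have le': "?g p \<sqsubseteq>\<^bsub>\<Omega>\<^esub> ?g q \<longleftrightarrow> p \<sqsubseteq>\<^bsub>L\<^esub> q" if "p \<in> carrier L" "q \<in> carrier L" for p q
    using le[rule_format, of "?g p" "?g q"] that by (simp add: g)
  define act' where "act' x a = ?g (act x (\<Theta> a))" for x a
  have "chain_action_axioms A \<Omega> act'"
  proof (rule chain_action_axioms.intro)
    fix x y p assume xy: "x \<in> carrier A" "y \<in> carrier A" and p: "p \<in> carrier \<Omega>"
    show "act' (x \<otimes>\<^bsub>A\<^esub> y) p = act' x (act' y p)" using xy p by (simp add: act'_def g \<Theta> act_mult)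
    show "leq A x y \<Longrightarrow> act' x p \<sqsubseteq>\<^bsub>\<Omega>\<^esub> act' y p" using xy p by (simp add: act'_def \<Theta> le' act_leq)
    show "act' (x \<^bold>\<squnion> y) p = act' x p \<or> act' (x \<^bold>\<squnion> y) p = act' y p"
      using act_join[OF xy, of "\<Theta> p"] p by (auto simp: act'_def \<Theta>)
    show "act' (x \<^bold>\<sqinter> y) p = act' x p \<or> act' (x \<^bold>\<sqinter> y) p = act' y p"
      using act_meet[OF xy, of "\<Theta> p"] p by (auto simp: act'_def \<Theta>)
  qed (simp_all add: act'_def g \<Theta> le le' act_one act_mono)
  then have 1: "chain_action A \<Omega> act'"
    by (simp add: chain_action_def chain_def \<Omega> A.lpregroup_axioms)
  then interpret T: chain_action A \<Omega> act' .
  have "T.faithful" unfolding T.faithful_def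
  proof (intro ballI impI)
    fix x y assume xy: "x \<in> carrier A" "y \<in> carrier A" "\<not> leq A x y"
    then obtain p where "p \<in> carrier L" "\<not> act x p \<sqsubseteq>\<^bsub>L\<^esub> act y p"
      using faithful unfolding faithful_def by blast
    then show "\<exists>p\<in>carrier \<Omega>. \<not> act' x p \<sqsubseteq>\<^bsub>\<Omega>\<^esub> act' y p"
      using xy by (intro bexI[of _ "?g p"]) (simp_all add: act'_def g le')
  qed
  with 1 show thesis by (rule that)
qed

section \<open>The chain of translates of prime ideals\<close>

context lpregroup
begin

definition translate :: "'a set \<Rightarrow> 'a \<Rightarrow> 'a set" where
  "translate I x = {u \<in> carrier A. u \<otimes> x \<in> I}"

lemma prime_idealD:
  assumes "prime_ideal I"
  shows "x \<in> I \<Longrightarrow> x \<in> carrier A" "x \<in> I \<Longrightarrow> y \<in> carrier A \<Longrightarrow> y \<preceq> x \<Longrightarrow> y \<in> I"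
    "x \<in> I \<Longrightarrow> y \<in> I \<Longrightarrow> x \<^bold>\<squnion> y \<in> I"
    "x \<in> carrier A \<Longrightarrow> y \<in> carrier A \<Longrightarrow> x \<^bold>\<sqinter> y \<in> I \<Longrightarrow> x \<in> I \<or> y \<in> I"
  using assms by (auto simp: prime_ideal_def)

lemma translate_linear:
  assumes I: "prime_ideal I" and xy: "x \<in> carrier A" "y \<in> carrier A"
  shows "translate I x \<subseteq> translate I y \<or> translate I y \<subseteq> translate I x"
proof (rule ccontr)
  assume "\<not> ?thesis"
  then obtain u v where uv: "u \<in> carrier A" "v \<in> carrier A"
    and in_I: "u \<otimes> x \<in> I" "v \<otimes> y \<in> I" and not_in_I: "u \<otimes> y \<notin> I" "v \<otimes> x \<notin> I"
    by (auto simp: translate_def)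
  have "(u \<otimes> x) \<^bold>\<squnion> (v \<otimes> y) \<in> I" using prime_idealD(3)[OF I] in_I by blast
  then have "(v \<otimes> x) \<^bold>\<sqinter> (u \<otimes> y) \<in> I"
    by (rule prime_idealD(2)[OF I]) (use uv xy cross_mult_le in simp_all)
  then show False using prime_idealD(4)[OF I, of "v \<otimes> x" "u \<otimes> y"] uv xy not_in_I by simp
qed

text \<open>The left side refers to the set only and not to \<open>x\<close>, so an element acts on
  translates independently of how they are represented.\<close>

lemma translate_mult:
  assumes "a \<in> carrier A" "x \<in> carrier A"
  shows "{u \<in> carrier A. u \<otimes> a \<in> translate I x} = translate I (a \<otimes> x)"
  using assms by (auto simp: translate_def m_assoc)

lemma translate_antimono:
  assumes I: "prime_ideal I" and "a \<preceq> b" "a \<in> carrier A" "b \<in> carrier A"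
  shows "translate I b \<subseteq> translate I a"
proof
  fix u assume "u \<in> translate I b"
  then show "u \<in> translate I a"
    using prime_idealD(2)[OF I, of "u \<otimes> b" "u \<otimes> a"] assms by (simp add: translate_def mult_mono_right)
qed

lemma translate_join:
  assumes I: "prime_ideal I" and ab: "a \<in> carrier A" "b \<in> carrier A"
  shows "translate I (a \<^bold>\<squnion> b) = translate I a \<inter> translate I b"
proof
  show "translate I (a \<^bold>\<squnion> b) \<subseteq> translate I a \<inter> translate I b"
    using translate_antimono[OF I] ab by (simp add: L.join_left L.join_right)
  show "translate I a \<inter> translate I b \<subseteq> translate I (a \<^bold>\<squnion> b)"
  proof
    fix u assume "u \<in> translate I a \<inter> translate I b"
    then have u: "u \<in> carrier A" and "(u \<otimes> a) \<^bold>\<squnion> (u \<otimes> b) \<in> I"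
      using prime_idealD(3)[OF I] by (auto simp: translate_def)
    moreover have "u \<otimes> (a \<^bold>\<squnion> b) \<preceq> (u \<otimes> a) \<^bold>\<squnion> (u \<otimes> b)"
      by (rule mult_join_le) (use u ab in \<open>simp_all add: L.join_left L.join_right\<close>)
    ultimately show "u \<in> translate I (a \<^bold>\<squnion> b)"
      using prime_idealD(2)[OF I] ab by (simp add: translate_def)
  qed
qed

lemma translate_meet:
  assumes I: "prime_ideal I" and ab: "a \<in> carrier A" "b \<in> carrier A"
  shows "translate I (a \<^bold>\<sqinter> b) = translate I a \<union> translate I b"
proof
  show "translate I a \<union> translate I b \<subseteq> translate I (a \<^bold>\<sqinter> b)"
    using translate_antimono[OF I] ab by (simp add: L.meet_left L.meet_right)
  show "translate I (a \<^bold>\<sqinter> b) \<subseteq> translate I a \<union> translate I b"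
  proof
    fix u assume "u \<in> translate I (a \<^bold>\<sqinter> b)"
    then have u: "u \<in> carrier A" "u \<otimes> (a \<^bold>\<sqinter> b) \<in> I" by (auto simp: translate_def)
    moreover have "(u \<otimes> a) \<^bold>\<sqinter> (u \<otimes> b) \<preceq> u \<otimes> (a \<^bold>\<sqinter> b)"
      by (rule le_mult_meet) (use u ab in \<open>simp_all add: L.meet_left L.meet_right\<close>)
    ultimately have "(u \<otimes> a) \<^bold>\<sqinter> (u \<otimes> b) \<in> I" using prime_idealD(2)[OF I] ab by simp
    then show "u \<in> translate I a \<union> translate I b"
      using prime_idealD(4)[OF I] u ab by (simp add: translate_def)
  qed
qed

lemma join_mult:
  assumes "a \<in> carrier A" "b \<in> carrier A" "x \<in> carrier A"
  shows "(a \<^bold>\<squnion> b) \<otimes> x = (a \<otimes> x) \<^bold>\<squnion> (b \<otimes> x)"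
proof (rule le_antisym)
  show "(a \<^bold>\<squnion> b) \<otimes> x \<preceq> (a \<otimes> x) \<^bold>\<squnion> (b \<otimes> x)"
    by (rule join_mult_le) (use assms in \<open>simp_all add: L.join_left L.join_right\<close>)
  show "(a \<otimes> x) \<^bold>\<squnion> (b \<otimes> x) \<preceq> (a \<^bold>\<squnion> b) \<otimes> x"
    using assms by (simp add: L.join_le mult_mono_left L.join_left L.join_right)
qed (use assms in simp_all)

lemma meet_mult:
  assumes "a \<in> carrier A" "b \<in> carrier A" "x \<in> carrier A"
  shows "(a \<^bold>\<sqinter> b) \<otimes> x = (a \<otimes> x) \<^bold>\<sqinter> (b \<otimes> x)"
proof (rule le_antisym)
  show "(a \<otimes> x) \<^bold>\<sqinter> (b \<otimes> x) \<preceq> (a \<^bold>\<sqinter> b) \<otimes> x"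
    by (rule le_meet_mult) (use assms in \<open>simp_all add: L.meet_left L.meet_right\<close>)
  show "(a \<^bold>\<sqinter> b) \<otimes> x \<preceq> (a \<otimes> x) \<^bold>\<sqinter> (b \<otimes> x)"
    using assms by (simp add: L.meet_le mult_mono_left L.meet_left L.meet_right)
qed (use assms in simp_all)

end

lemma (in n_periodic) ex_faithful_chain_action:
  obtains C :: "('a set \<times> 'a set) gorder" and act
  where "chain_action A C act" "chain_action.faithful A C act"
proof -
  obtain W :: "'a set rel" where W: "well_order_on UNIV W" using well_order_on by blast
  \<comment> \<open>Translates shrink as their parameter grows, so within one prime ideal the order
    is reverse inclusion; the chains of different ideals are stacked along \<open>W\<close>.\<close>
  define C :: "('a set \<times> 'a set) gorder" where
    "C = \<lparr>carrier = {(I, X). prime_ideal I \<and> (\<exists>x\<in>carrier A. X = translate I x)}, eq = (=),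
          le = (\<lambda>(I, X) (I', X'). I \<noteq> I' \<and> (I, I') \<in> W \<or> I = I' \<and> X' \<subseteq> X)\<rparr>"
  define act where "act a = (\<lambda>(I, X). (I :: 'a set, {u \<in> carrier A. u \<otimes> a \<in> X}))" for a
  have W': "(I, K) \<in> W \<or> (K, I) \<in> W" "(I, K) \<in> W \<Longrightarrow> (K, I) \<in> W \<Longrightarrow> I = K"
    "(I, K) \<in> W \<Longrightarrow> (K, M) \<in> W \<Longrightarrow> (I, M) \<in> W" for I K M
  proof -
    have "refl_on UNIV W" "trans W" "antisym W" "total_on UNIV W"
      using W by (auto simp: order_on_defs)
    then show "(I, K) \<in> W \<or> (K, I) \<in> W" "(I, K) \<in> W \<Longrightarrow> (K, I) \<in> W \<Longrightarrow> I = K"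
      "(I, K) \<in> W \<Longrightarrow> (K, M) \<in> W \<Longrightarrow> (I, M) \<in> W"
      by (metis UNIV_I refl_onD total_on_def, blast dest: antisymD, blast dest: transD)
  qed
  have sel: "p \<in> carrier C \<longleftrightarrow> (\<exists>I x. p = (I, translate I x) \<and> prime_ideal I \<and> x \<in> carrier A)"
    "le C (I, X) (I', X') \<longleftrightarrow> I \<noteq> I' \<and> (I, I') \<in> W \<or> I = I' \<and> X' \<subseteq> X" for p I X I' X'
    by (auto simp: C_def)
  have act: "act a (I, translate I x) = (I, translate I (a \<otimes> x))"
    if "a \<in> carrier A" "x \<in> carrier A" for a I x
    using that translate_mult by (simp add: act_def)
  have total: "total_order C"
  proof (rule total_orderI_eq)
    show "eq C = (=)" by (simp add: C_def)
    fix p q assume "p \<in> carrier C" "q \<in> carrier C"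
    then obtain I x K y where pq: "p = (I, translate I x)" "q = (K, translate K y)"
      and I: "prime_ideal I" "x \<in> carrier A" "y \<in> carrier A"
      unfolding sel(1) by blast
    show "le C p q \<or> le C q p"
      using translate_linear[OF I] W'(1)[of I K] by (cases "I = K") (auto simp: pq sel(2))
  next
    fix p q r assume "le C p q" "le C q r"
    then show "le C p r"
      using W'(3)[of "fst p" "fst q" "fst r"] W'(2)[of "fst p" "fst q"]
      by (cases p; cases q; cases r) (auto simp: sel(2))
  next
    fix p q assume "le C p q" "le C q p"
    then show "p = q" using W'(2)[of "fst p" "fst q"] by (cases p; cases q) (auto simp: sel(2))
  next
    fix p assume "p \<in> carrier C"
    then show "le C p p" by (cases p) (simp add: sel(2))
  qed
  have "chain_action_axioms A C act"
  proof (rule chain_action_axioms.intro)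
    fix a b p assume ab: "a \<in> carrier A" "b \<in> carrier A" and "p \<in> carrier C"
    then obtain I x where p: "p = (I, translate I x)" "prime_ideal I" "x \<in> carrier A"
      unfolding sel(1) by blast
    show "act (a \<otimes> b) p = act a (act b p)" using ab p by (simp add: act m_assoc)
    show "a \<preceq> b \<Longrightarrow> le C (act a p) (act b p)"
      using ab p translate_antimono[of I "a \<otimes> x" "b \<otimes> x"] by (simp add: act sel(2) mult_mono_left)
    \<comment> \<open>Join and meet of elements become intersection and union of translates; of two
      comparable sets, each of these is one of the two.\<close>
    have lin: "translate I (a \<otimes> x) \<subseteq> translate I (b \<otimes> x) \<or> translate I (b \<otimes> x) \<subseteq> translate I (a \<otimes> x)"
      using translate_linear p ab by simp
    show "act (a \<^bold>\<squnion> b) p = act a p \<or> act (a \<^bold>\<squnion> b) p = act b p"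
      using lin ab p by (auto simp: act join_mult translate_join)
    show "act (a \<^bold>\<sqinter> b) p = act a p \<or> act (a \<^bold>\<sqinter> b) p = act b p"
      using lin ab p by (auto simp: act meet_mult translate_meet)
  next
    fix a p assume "a \<in> carrier A" "p \<in> carrier C"
    then show "act a p \<in> carrier C" unfolding sel(1) using act by fastforce
  next
    fix p assume "p \<in> carrier C"
    then show "act \<one> p = p" unfolding sel(1) using act[of \<one>] by auto
  next
    fix a p q assume "a \<in> carrier A" "le C p q"
    then show "le C (act a p) (act a q)" by (cases p; cases q) (auto simp: sel(2) act_def)
  qed
  then have action: "chain_action A C act"
    by (simp add: chain_action_def chain_def total lpregroup_axioms)
  then interpret chain_action A C act .
  have faithful unfolding faithful_def
  proof (intro ballI impI)
    fix a b assume ab: "a \<in> carrier A" "b \<in> carrier A" "\<not> a \<preceq> b"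
    then obtain I where I: "prime_ideal I" "b \<in> I" "a \<notin> I"
      using prime_ideal_separation by blast
    \<comment> \<open>At this point \<open>a\<close> and \<open>b\<close> are told apart by
      membership of the unit in their translates, which is membership of \<open>a\<close> and
      \<open>b\<close> in \<open>I\<close>.\<close>
    have "(I, translate I \<one>) \<in> carrier C" using I by (auto simp: sel(1))
    moreover have "\<one> \<in> translate I b" "\<one> \<notin> translate I a" using I ab by (auto simp: translate_def)
    then have "\<not> le C (act a (I, translate I \<one>)) (act b (I, translate I \<one>))"
      using ab by (auto simp: act sel(2))
    ultimately show "\<exists>p\<in>carrier C. \<not> le C (act a p) (act b p)" by blast
  qed
  with action show thesis by (rule that)
qed

text \<open>List lengths separate the data: length 1 codes \<open>I\<close>, length 2 codes
  \<open>X\<close>, and one length from 3 on codes the integer. The outer singleton only reaches the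
  type \<open>'a witness\<close>.\<close>

definition encode_witness :: "('a set \<times> 'a set) \<times> int \<Rightarrow> 'a witness" where
  "encode_witness = (\<lambda>((I, X), k).
     {{[u] | u. u \<in> I} \<union> {[u, u] | u. u \<in> X} \<union> {l. length l = int_encode k + 3}})"

lemma inj_encode_witness: "inj encode_witness"
proof (rule injI)
  fix p q :: "('a set \<times> 'a set) \<times> int"
  assume eq: "encode_witness p = encode_witness q"
  obtain I X k I' X' k' where pq: "p = ((I, X), k)" "q = ((I', X'), k')"
    by (metis prod.exhaust)
  let ?S = "\<lambda>I X k. {[u] | u. u \<in> I} \<union> {[u, u] | u. u \<in> X} \<union> {l. length l = int_encode k + 3}"
  have S: "?S I X k = ?S I' X' k'" using eq by (simp add: encode_witness_def pq)
  have "u \<in> I \<longleftrightarrow> u \<in> I'" "u \<in> X \<longleftrightarrow> u \<in> X'" for u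
    using S[THEN eqset_imp_iff, of "[u]"] S[THEN eqset_imp_iff, of "[u, u]"] by simp_all
  moreover have "int_encode k = int_encode k'"
    using S[THEN eqset_imp_iff, of "replicate (int_encode k + 3) undefined"]
    by (auto simp: numeral_3_eq_3)
  ultimately show "p = q" using injD[OF inj_int_encode] by (auto simp: pq)
qed

section \<open>The embedding into the wreath product\<close>

lemma lpg_embeds_isomorphic:
  assumes "lpg_embeds A B" "lpg_isomorphic B C"
  shows "lpg_embeds A C"
proof -
  obtain f where f: "f \<in> lpg_hom A B" "inj_on f (carrier A)" using assms(1) by (auto simp: lpg_embeds_def)
  obtain g where g: "g \<in> lpg_hom B C" "bij_betw g (carrier B) (carrier C)"
    using assms(2) by (auto simp: lpg_isomorphic_def)
  have cl: "f x \<in> carrier B" if "x \<in> carrier A" for x using f that by (auto simp: lpg_hom_def hom_def)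
  interpret A: lpregroup A using assms(1) by (simp add: lpg_embeds_def)
  have "g \<circ> f \<in> lpg_hom A C"
    using f(1) g(1) cl by (auto simp: lpg_hom_def hom_def join_pres_def meet_pres_def lat_sel)
  moreover have "inj_on (g \<circ> f) (carrier A)"
    using f(2) g(2) cl by (auto simp: inj_on_def bij_betw_def)
  ultimately show ?thesis using assms by (auto simp: lpg_embeds_def lpg_isomorphic_def)
qed

lemma (in n_periodic) embeds_Aut_wreath:
  obtains J :: "'a witness gorder" where "total_order J" "lpg_embeds A (AW n J)"
proof -
  obtain C :: "('a set \<times> 'a set) gorder" and act
    where act: "chain_action A C act" "chain_action.faithful A C act" by (rule ex_faithful_chain_action)
  interpret P: periodic_chain_action A n C act
    by (simp add: periodic_chain_action_def act n_periodic_axioms)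
  interpret R: integral_chain P.refined P.refined_shift by (rule P.integral_chain_refined)
  have "inj_on encode_witness (carrier P.refined)" using inj_encode_witness by (rule inj_on_subset) simp
  then obtain J :: "'a witness gorder" and \<Theta> where J: "total_order J"
    and \<Theta>: "bij_betw \<Theta> (carrier (lex_product J Z_chain)) (carrier P.refined)"
    "\<forall>a\<in>carrier (lex_product J Z_chain). \<forall>b\<in>carrier (lex_product J Z_chain).
      \<Theta> a \<sqsubseteq>\<^bsub>P.refined\<^esub> \<Theta> b \<longleftrightarrow> a \<sqsubseteq>\<^bsub>lex_product J Z_chain\<^esub> b"
    by (rule R.lex_product_representation)
  interpret J: chain J by (simp add: chain_def J)
  interpret JZ: integral_chain "lex_product J Z_chain" lex_shift by (rule J.lex_product_Z_integral)
  obtain act' where act': "chain_action A (lex_product J Z_chain) act'"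
    "chain_action.faithful A (lex_product J Z_chain) act'"
    by (rule chain_action_transport[OF P.chain_action_refined P.refined_faithful[OF act(2)]
          JZ.total_order_axioms \<Theta>])
  interpret Q: periodic_chain_action A n "lex_product J Z_chain" act'
    by (simp add: periodic_chain_action_def act' n_periodic_axioms)
  have "lpg_embeds A (AW n J)"
    by (rule lpg_embeds_isomorphic[OF Q.lpg_embeds_Fn_lpg[OF act'(2)] J.Fn_lpg_lex_isomorphic[OF n_pos]])
  with J show thesis by (rule that)
qed

theorem theorem2p16:
  fixes n :: nat
  assumes "n \<ge> 1"
  shows "(\<forall>J :: 'j gorder. total_order J \<longrightarrow>
            lpg_isomorphic (Fn_lpg n (lex_product J Z_chain)) (Aut_wreath J (Fn_lpg n Z_chain)))
       \<and> periodic_lpregroup n (Fn_lpg n Z_chain) \<and> lpg_simple (Fn_lpg n Z_chain)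
       \<and> (\<forall>A :: 'a lpg. periodic_lpregroup n A \<longrightarrow>
            (\<exists>(J :: 'a witness gorder) (H :: ('a witness \<Rightarrow> 'a witness) lpg) act.
               total_order J \<and> lgroup H \<and> monotone_action H J act \<and>
               lpg_embeds A (wreath H J act (Fn_lpg n Z_chain))))"
proof (intro conjI allI impI)
  fix J :: "'j gorder" assume "total_order J"
  then interpret J: chain J by (simp add: chain_def)
  show "lpg_isomorphic (Fn_lpg n (lex_product J Z_chain)) (Aut_wreath J (Fn_lpg n Z_chain))"
    by (rule J.Fn_lpg_lex_isomorphic[OF assms])
next
  show "periodic_lpregroup n (Fn_lpg n Z_chain)" by (rule Z.periodic_lpregroup_Fn_lpg)
  show "lpg_simple (Fn_lpg n Z_chain)" by (rule lpg_simple_Fn_Z[OF assms])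
next
  fix A :: "'a lpg" assume "periodic_lpregroup n A"
  then interpret A: n_periodic A n
    using assms by (simp add: n_periodic_def n_periodic_axioms_def periodic_lpregroup_def)
  obtain J :: "'a witness gorder" where J: "total_order J" and emb: "lpg_embeds A (AW n J)"
    by (rule A.embeds_Aut_wreath)
  interpret J: chain J by (simp add: chain_def J)
  show "\<exists>(J :: 'a witness gorder) (H :: ('a witness \<Rightarrow> 'a witness) lpg) act.
      total_order J \<and> lgroup H \<and> monotone_action H J act \<and>
      lpg_embeds A (wreath H J act (Fn_lpg n Z_chain))"
    using J J.lgroup_Aut J.monotone_action_Aut emb unfolding Aut_wreath_def by blast
qed

end
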